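(* Let $(R,\mathfrak m,k)$ be an $F$-finite noetherian local domain of characteristic $p>0$ and dimension $d$. Let $J_\bullet=\{J_n\}_{n\in\mathbb N}$ be a family of ideals of $R$ such that there are a nonzero $c\in R$ and a nonzero $\phi\in\mathrm{Hom}_R(F_*R,R)$ satisfying $cJ_n^{[p]}\subseteq J_{n+1}$ and $\phi(F_*J_{n+1})\subseteq J_n$ for all $n$. Let $I$ be an ideal such that for each $s\in\mathbb R$ there is an integer $\alpha$ with $\mathfrak m^{[p^{n+\alpha}]}\subseteq I^{\lceil sp^n\rceil}+J_n$ for all $n$. Set $I_n(s)=I^{\lceil sp^n\rceil}+J_n$. (1) Fix $t\in\mathbb R$. Choose $\alpha\in\mathbb N$ such that $\mathfrak m^{[p^{n+\alpha}]}\subseteq I^{\lceil tp^n\rceil}+J_n$ for all $n$. Then there exists a positive constant $C$, depending only on $c,\phi,I,\alpha$ and independent of the specific choice of $J_\bullet$, such that for any $s\in(-\infty,t]$ the limit $$h_{R,I,J_\bullet,d}(s)=\lim_{n\to\infty}\frac1{p^{nd}}\,l_R(R/I_n(s))$$ exists, and $$\left|\frac1{p^{nd}}\,l_R(R/I_n(s))-h_{R,I,J_\bullet,d}(s)\right|\le\frac C{p^n}\quad\text{for all }n\in\mathbb N.$$ (2) Given choices of $I,J_\bullet$ and $t\in\mathbb R$, one can choose $C$ depending only on $t$ such that the last displayed inequality holds for all $s\in[0,t]$ and all $n\in\mathbb N$. (3) On every bounded subset of $\mathbb R$, the sequence of functions $s\mapsto\frac1{p^{nd}}l_R(R/I_n(s))$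 converges uniformly to $h_{R,I,J_\bullet,d}(s)$.
   Context: $R$ is $F$-finite if its Frobenius endomorphism is a finite map. $l_R$ denotes length. For an ideal $\mathfrak a$, $\mathfrak a^{[p^n]}$ is the ideal generated by the $p^n$-th powers of elements of $\mathfrak a$. $F_*R$ is $R$ viewed as an $R$-module by restriction of scalars along Frobenius, and $F_*\mathfrak a\subseteq F_*R$ is the corresponding submodule for an ideal $\mathfrak a$. A nonpositive power of an ideal is the unit ideal by convention. *)

theory Defs
  imports
    "HOL-Algebra.Ring_Divisibility"
    "HOL-Algebra.Ideal_Product"
    "HOL-Algebra.Module"
    "HOL-Library.Extended_Nat"
    "HOL-Analysis.Uniform_Limit"
begin

section \<open>Chains, Krull dimension, characteristic, local rings\<close>

text \<open>Supremum of the numbers \<open>k\<close> of strict inclusions in chains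
  \<open>F\<^sub>0 \<subset> \<dots> \<subset> F\<^sub>k\<close> of members of the family.\<close>

definition chain_sup :: "'a set set \<Rightarrow> enat" where
  "chain_sup \<F> =
     Sup {enat k |k. \<exists>f :: nat \<Rightarrow> 'a set. (\<forall>i\<le>k. f i \<in> \<F>) \<and> (\<forall>i<k. f i \<subset> f (Suc i))}"

definition krull_dim :: "('a, 'b) ring_scheme \<Rightarrow> enat" where
  "krull_dim R = chain_sup {P. primeideal P R}"

text \<open>Same convention as \<^const>\<open>semiring_char\<close>: the nonnegative generator of the kernel of
  the canonical map from the integers.\<close>

definition ring_char :: "('a, 'b) ring_scheme \<Rightarrow> nat" where
  "ring_char R = Gcd {n :: nat. [n] \<cdot>\<^bsub>R\<^esub> \<one>\<^bsub>R\<^esub> = \<zero>\<^bsub>R\<^esub>}"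

definition local_ring :: "('a, 'b) ring_scheme \<Rightarrow> 'a set \<Rightarrow> bool" where
  "local_ring R \<mm> \<longleftrightarrow> cring R \<and> maximalideal \<mm> R \<and> (\<forall>M. maximalideal M R \<longrightarrow> M = \<mm>)"


section \<open>Modules\<close>

definition module_length :: "('a, 'b) ring_scheme \<Rightarrow> ('a, 'c, 'd) module_scheme \<Rightarrow> enat" where
  "module_length R M = chain_sup {N. submodule N R M}"

definition module_span ::
    "('a, 'b) ring_scheme \<Rightarrow> ('a, 'c, 'd) module_scheme \<Rightarrow> 'c set \<Rightarrow> 'c set" where
  "module_span R M A = \<Inter>{N. submodule N R M \<and> A \<subseteq> N}"

definition fg_module :: "('a, 'b) ring_scheme \<Rightarrow> ('a, 'c, 'd) module_scheme \<Rightarrow> bool" where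
  "fg_module R M \<longleftrightarrow> (\<exists>A. finite A \<and> A \<subseteq> carrier M \<and> module_span R M A = carrier M)"

definition module_Hom ::
    "('a, 'b) ring_scheme \<Rightarrow> ('a, 'c, 'd) module_scheme \<Rightarrow> ('a, 'e, 'f) module_scheme \<Rightarrow> ('c \<Rightarrow> 'e) set"
  where
  "module_Hom R M N = {f \<in> hom (add_monoid M) (add_monoid N).
     \<forall>r\<in>carrier R. \<forall>x\<in>carrier M. f (r \<odot>\<^bsub>M\<^esub> x) = r \<odot>\<^bsub>N\<^esub> f x}"

text \<open>The ring \<open>S\<close> as a module by restriction of scalars along a ring homomorphism \<open>f\<close> into \<open>S\<close>.\<close>

definition restrict_scalars ::
    "('a \<Rightarrow> 's) \<Rightarrow> ('s, 'c) ring_scheme \<Rightarrow> ('a, 's) module" where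
  "restrict_scalars f S =
     \<lparr>carrier = carrier S, mult = mult S, one = one S, zero = zero S, add = add S,
      smult = (\<lambda>r x. f r \<otimes>\<^bsub>S\<^esub> x)\<rparr>"

definition finite_ring_map ::
    "('a, 'b) ring_scheme \<Rightarrow> ('s, 'c) ring_scheme \<Rightarrow> ('a \<Rightarrow> 's) \<Rightarrow> bool" where
  "finite_ring_map R S f \<longleftrightarrow> f \<in> ring_hom R S \<and> fg_module R (restrict_scalars f S)"

definition self_module :: "('a, 'b) ring_scheme \<Rightarrow> ('a, 'a) module" where
  "self_module R = restrict_scalars (\<lambda>r. r) R"

definition quot_module :: "('a, 'b) ring_scheme \<Rightarrow> 'a set \<Rightarrow> ('a, 'a set) module" where
  "quot_module R \<aa> = restrict_scalars (\<lambda>r. \<aa> +>\<^bsub>R\<^esub> r) (R Quot \<aa>)"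


section \<open>Frobenius\<close>

definition frobenius :: "('a, 'b) ring_scheme \<Rightarrow> nat \<Rightarrow> 'a \<Rightarrow> 'a" where
  "frobenius R p = (\<lambda>r. r [^]\<^bsub>R\<^esub> p)"

definition F_finite :: "('a, 'b) ring_scheme \<Rightarrow> nat \<Rightarrow> bool" where
  "F_finite R p \<longleftrightarrow> finite_ring_map R R (frobenius R p)"

text \<open>The module \<open>F\<^sub>*R\<close>. It has the same carrier as \<open>R\<close>, and its submodule \<open>F\<^sub>*\<aa>\<close> has the
  same underlying set as the ideal \<open>\<aa>\<close>.\<close>

definition frob_push :: "('a, 'b) ring_scheme \<Rightarrow> nat \<Rightarrow> ('a, 'a) module" where
  "frob_push R p = restrict_scalars (frobenius R p) R"

text \<open>The ideal \<open>\<aa>\<^bsup>[q]\<^esup>\<close>.\<close>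

definition frob_power :: "('a, 'b) ring_scheme \<Rightarrow> 'a set \<Rightarrow> nat \<Rightarrow> 'a set" where
  "frob_power R \<aa> q = Idl\<^bsub>R\<^esub> ((\<lambda>x. x [^]\<^bsub>R\<^esub> q) ` \<aa>)"


section \<open>The ideals \<open>I\<^sub>n(s)\<close> and the h-function\<close>

text \<open>Powers of an ideal with integer exponent. As \<^const>\<open>nat\<close> sends nonpositive integers to 0,
  nonpositive powers are the unit ideal.\<close>

definition ideal_pow :: "('a, 'b) ring_scheme \<Rightarrow> 'a set \<Rightarrow> int \<Rightarrow> 'a set" where
  "ideal_pow R I k = I [^]\<^bsub>ideals_set R\<^esub> nat k"

definition I_seq ::
    "('a, 'b) ring_scheme \<Rightarrow> nat \<Rightarrow> 'a set \<Rightarrow> (nat \<Rightarrow> 'a set) \<Rightarrow> nat \<Rightarrow> real \<Rightarrow> 'a set" where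
  "I_seq R p I J n s = ideal_pow R I \<lceil>s * real (p ^ n)\<rceil> <+>\<^bsub>R\<^esub> J n"

definition I_length ::
    "('a, 'b) ring_scheme \<Rightarrow> nat \<Rightarrow> 'a set \<Rightarrow> (nat \<Rightarrow> 'a set) \<Rightarrow> nat \<Rightarrow> real \<Rightarrow> enat" where
  "I_length R p I J n s = module_length R (quot_module R (I_seq R p I J n s))"

text \<open>Only meaningful when the length is finite.\<close>

definition h_seq ::
    "('a, 'b) ring_scheme \<Rightarrow> nat \<Rightarrow> nat \<Rightarrow> 'a set \<Rightarrow> (nat \<Rightarrow> 'a set) \<Rightarrow> nat \<Rightarrow> real \<Rightarrow> real" where
  "h_seq R p d I J n s = real (the_enat (I_length R p I J n s)) / real (p ^ (n * d))"

definition h_fun ::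
    "('a, 'b) ring_scheme \<Rightarrow> nat \<Rightarrow> nat \<Rightarrow> 'a set \<Rightarrow> (nat \<Rightarrow> 'a set) \<Rightarrow> real \<Rightarrow> real" where
  "h_fun R p d I J s = lim (\<lambda>n. h_seq R p d I J n s)"


section \<open>Conditions on the family of ideals\<close>

definition frob_compatible ::
    "('a, 'b) ring_scheme \<Rightarrow> nat \<Rightarrow> 'a \<Rightarrow> ('a \<Rightarrow> 'a) \<Rightarrow> (nat \<Rightarrow> 'a set) \<Rightarrow> bool" where
  "frob_compatible R p c \<phi> J \<longleftrightarrow>
     (\<forall>n. ideal (J n) R) \<and>
     (\<forall>n. c <#\<^bsub>R\<^esub> frob_power R (J n) p \<subseteq> J (Suc n)) \<and>
     (\<forall>n. \<phi> ` J (Suc n) \<subseteq> J n)"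

text \<open>\<open>\<mm>\<^bsup>[p^(n+\<alpha>)]\<^esup> \<subseteq> I\<^bsup>\<lceil>s p^n\<rceil>\<^esup> + J\<^sub>n\<close> for all \<open>n\<close>. For negative \<open>\<alpha>\<close> and \<open>n < -\<alpha>\<close> the
  left-hand side is read as \<open>\<mm>\<^bsup>[1]\<^esup> = \<mm>\<close>. Enlarging \<open>\<alpha>\<close> weakens the condition, so asking for
  some integer \<open>\<alpha>\<close> is the same as asking for some natural number \<open>\<alpha>\<close>.\<close>

definition frob_contained ::
    "('a, 'b) ring_scheme \<Rightarrow> 'a set \<Rightarrow> nat \<Rightarrow> 'a set \<Rightarrow> (nat \<Rightarrow> 'a set) \<Rightarrow> real \<Rightarrow> int \<Rightarrow> bool"
  where
  "frob_contained R \<mm> p I J s \<alpha> \<longleftrightarrow>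
     (\<forall>n. frob_power R \<mm> (p ^ nat (int n + \<alpha>)) \<subseteq> I_seq R p I J n s)"

definition frob_bounded ::
    "('a, 'b) ring_scheme \<Rightarrow> 'a set \<Rightarrow> nat \<Rightarrow> 'a set \<Rightarrow> (nat \<Rightarrow> 'a set) \<Rightarrow> bool" where
  "frob_bounded R \<mm> p I J \<longleftrightarrow> (\<forall>s :: real. \<exists>\<alpha> :: int. frob_contained R \<mm> p I J s \<alpha>)"

end

theory Submission
  imports Defs
begin

text \<open>
  Lengths over the local ring of a prime \<open>Q\<close> are counted inside \<open>R\<close> itself, by chains of
  \<open>Q\<close>-saturated submodules, and \<open>\<rho> Q = [\<kappa>(Q) : \<kappa>(Q)\<^sup>p]\<close> is the length of \<open>F\<^sub>*(R/Q)\<close> at \<open>Q\<close>.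
  Comparing \<open>F\<^sub>*(R/P)\<close> with a free submodule of full rank \<open>\<rho> P\<close> shows that
  \<open>c \<aa>\<^bsup>[p]\<^esup> \<subseteq> \<aa>'\<close> implies \<open>\<rho> Q \<cdot> l(R/\<aa>') \<le> \<rho> P \<cdot> l(R/\<aa>)\<close> up to a multiple of the length of
  \<open>R/(\<aa>' + zR)\<close> for a fixed \<open>z \<notin> P\<close>. For the powers of one element this gives \<open>\<rho> P = p \<cdot> \<rho> Q\<close> whenever
  \<open>P \<subset> Q\<close> are adjacent primes, hence \<open>\<rho> 0 = p\<^sup>d \<cdot> \<rho> \<mm>\<close>; with Noetherian induction it also gives
  \<open>l(R/(\<aa> + \<mm>\<^bsup>[p^n]\<^esup>)) = O(p\<^bsup>n dim R/\<aa>\<^esup>)\<close>. So no dimension theory is needed.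

  A nonzero \<open>\<phi>\<close> yields the reverse comparison for \<open>P = 0\<close>. After multiplying \<open>\<phi>\<close> by the product of
  a set of generators of \<open>I\<close>, it carries \<open>I\<^sub>n\<^sub>+\<^sub>1(s)\<close> into \<open>I\<^sub>n(s)\<close> for all \<open>s\<close> at once. Thus
  \<open>a\<^sub>n = l(R/I\<^sub>n(s))\<close> satisfies \<open>\<bar>a\<^sub>n\<^sub>+\<^sub>1 - p\<^sup>d a\<^sub>n\<bar> = O(p\<^bsup>n(d-1)\<^esup>)\<close> with a constant depending only on
  \<open>c\<close>, \<open>\<phi>\<close>, \<open>I\<close> and \<open>\<alpha>\<close>, and \<open>a\<^sub>n / p\<^bsup>nd\<^esup>\<close> is a Cauchy sequence with geometric rate.
\<close>

section \<open>Chains of sets\<close>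

text \<open>All modules here are subsets of \<open>carrier R\<close>, which \<open>R\<close> and
  \<open>F_*R\<close> share. A length for either structure is then a matter of chains of sets, the
  scalar action being passed as an endomorphism \<sigma>. The weights \<rho> appear because the
  residue field need not be perfect: \<open>F_*(R/A)\<close> is \<rho> \<mm> times as long as
  \<open>R/A\<close>, while \<open>F_*R\<close> has rank \<rho> 0, and only their quotient
  \<open>p^d\<close> survives in the recursion for \<open>a_n\<close>. The constant must not depend
  on the family. Hence \<open>z\<close> is fixed before any \<open>J\<close> is given, and the error
  \<open>l(R/(I_n(s) + zR))\<close> is bounded by the colength of \<open>zR\<close> plus the
  Frobenius power of \<mm> with exponent \<open>p^(n+\<alpha>)\<close>, where the family no longer
  occurs. Its order drops below \<open>p^(nd)\<close> because \<open>R/zR\<close> has smaller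
  dimension. The twist of \<phi> by generators is forced by rounding: \<phi> maps \<open>I^N\<close>
  to roughly \<open>I^(N/p)\<close> with a bounded loss in the exponent, which the product of the
  generators restores, so that one map fits the ceilings for all \<open>s\<close>.\<close>

definition set_chain :: "'a set set \<Rightarrow> nat \<Rightarrow> (nat \<Rightarrow> 'a set) \<Rightarrow> bool" where
  "set_chain \<F> n f \<longleftrightarrow> (\<forall>i\<le>n. f i \<in> \<F>) \<and> (\<forall>i<n. f i \<subset> f (Suc i))"

lemma chain_sup_ge: "set_chain \<F> n f \<Longrightarrow> enat n \<le> chain_sup \<F>"
  unfolding chain_sup_def set_chain_def by (rule Sup_upper) blast

lemma chain_sup_le: "(\<And>n f. set_chain \<F> n f \<Longrightarrow> enat n \<le> b) \<Longrightarrow> chain_sup \<F> \<le> b"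
  unfolding chain_sup_def set_chain_def by (rule Sup_least) blast

text \<open>If no chain had \<open>n\<close> steps, all would have at most \<open>n - 1\<close>, and
  so would the supremum. Nonemptiness settles \<open>n = 0\<close>: the empty family also has
  supremum 0, but contains no chain.\<close>

lemma chain_sup_attained:
  assumes "chain_sup \<F> = enat n" and "\<F> \<noteq> {}"
  obtains f where "set_chain \<F> n f"
proof -
  have "\<exists>f. set_chain \<F> n f"
  proof (rule ccontr)
    assume no: "\<nexists>f. set_chain \<F> n f"
    obtain A where "A \<in> \<F>" using assms(2) by blast
    then have "set_chain \<F> 0 (\<lambda>_. A)" by (simp add: set_chain_def)
    with no have n: "n \<noteq> 0" by metis
    have "chain_sup \<F> \<le> enat (n - 1)"
    proof (rule chain_sup_le)
      fix k f assume k: "set_chain \<F> k f"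
      then have "enat k \<le> enat n" using chain_sup_ge assms(1) by metis
      moreover have "k \<noteq> n" using no k by blast
      ultimately show "enat k \<le> enat (n - 1)" by simp
    qed
    then show False using assms(1) n by simp
  qed
  then show ?thesis using that by blast
qed

lemma set_chain_mono: "set_chain \<F> n f \<Longrightarrow> i \<le> j \<Longrightarrow> j \<le> n \<Longrightarrow> f i \<subseteq> f j"
proof (induction j)
  case (Suc j)
  show ?case
  proof (cases "i = Suc j")
    case False
    then have "f i \<subseteq> f j" using Suc by simp
    moreover have "f j \<subset> f (Suc j)" using Suc.prems by (simp add: set_chain_def)
    ultimately show ?thesis by blast
  qed simp
qed simp

lemma set_chain_extend:
  assumes "set_chain \<F> n f" "f n \<subseteq> X" "X \<in> \<F>"
  obtains n' f' where "set_chain \<F> n' f'" "f' n' = X" "n \<le> n'" "f n \<noteq> X \<Longrightarrow> n < n'"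
proof (cases "f n = X")
  case False
  have "set_chain \<F> (Suc n) (f(Suc n := X))"
    using assms False by (auto simp: set_chain_def less_Suc_eq)
  then show ?thesis using that[of "Suc n" "f(Suc n := X)"] by simp
qed (use assms that in blast)

lemma chain_sup_map:
  assumes "\<And>A. A \<in> \<F> \<Longrightarrow> g A \<in> \<G>" "\<And>A B. A \<in> \<F> \<Longrightarrow> B \<in> \<F> \<Longrightarrow> A \<subset> B \<Longrightarrow> g A \<subset> g B"
  shows "chain_sup \<F> \<le> chain_sup \<G>"
proof (rule chain_sup_le)
  fix n f assume "set_chain \<F> n f"
  then have "set_chain \<G> n (g \<circ> f)" using assms by (auto simp: set_chain_def)
  then show "enat n \<le> chain_sup \<G>" by (rule chain_sup_ge)
qed

lemma chain_sup_mono: "\<F> \<subseteq> \<G> \<Longrightarrow> chain_sup \<F> \<le> chain_sup \<G>"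
  by (rule chain_sup_map[of \<F> "\<lambda>x. x"]) auto

text \<open>Each strict step in \<open>\<F>\<close> moves \<open>g\<close> or \<open>h\<close>
  strictly up, so the two image chains, with repetitions removed, have at least as many steps in
  total. This is the upper half of additivity of length.\<close>

lemma chain_sup_le_add:
  assumes g: "\<And>A. A \<in> \<F> \<Longrightarrow> g A \<in> \<G>" and h: "\<And>A. A \<in> \<F> \<Longrightarrow> h A \<in> \<H>"
    and mono: "\<And>A B. A \<in> \<F> \<Longrightarrow> B \<in> \<F> \<Longrightarrow> A \<subset> B \<Longrightarrow> g A \<subseteq> g B \<and> h A \<subseteq> h B \<and> (g A \<noteq> g B \<or> h A \<noteq> h B)"
  shows "chain_sup \<F> \<le> chain_sup \<G> + chain_sup \<H>"
proof (rule chain_sup_le)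
  fix n f assume f: "set_chain \<F> n f"
  have "\<exists>i a j b. set_chain \<G> i a \<and> a i = g (f k) \<and> set_chain \<H> j b \<and> b j = h (f k) \<and> k \<le> i + j"
    if "k \<le> n" for k using that
  proof (induction k)
    case 0
    have "set_chain \<G> 0 (\<lambda>_. g (f 0))" "set_chain \<H> 0 (\<lambda>_. h (f 0))"
      using f g h by (auto simp: set_chain_def)
    then show ?case by fastforce
  next
    case (Suc k)
    then obtain i a j b where IH: "set_chain \<G> i a" "a i = g (f k)" "set_chain \<H> j b"
      "b j = h (f k)" "k \<le> i + j" by force
    have in\<F>: "f k \<in> \<F>" "f (Suc k) \<in> \<F>" "f k \<subset> f (Suc k)"
      using f Suc.prems by (auto simp: set_chain_def)
    note m = mono[OF this]
    obtain i' a' where a': "set_chain \<G> i' a'" "a' i' = g (f (Suc k))" "i \<le> i'"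
      "a i \<noteq> g (f (Suc k)) \<Longrightarrow> i < i'"
      using set_chain_extend[OF IH(1), of "g (f (Suc k))"] m IH g[OF in\<F>(2)] by metis
    obtain j' b' where b': "set_chain \<H> j' b'" "b' j' = h (f (Suc k))" "j \<le> j'"
      "b j \<noteq> h (f (Suc k)) \<Longrightarrow> j < j'"
      using set_chain_extend[OF IH(3), of "h (f (Suc k))"] m IH h[OF in\<F>(2)] by metis
    have "Suc k \<le> i' + j'" using m IH a'(3,4) b'(3,4) by force
    then show ?case using a' b' by blast
  qed
  then obtain i a j b where "set_chain \<G> i a" "set_chain \<H> j b" "n \<le> i + j" by blast
  then have "enat i + enat j \<le> chain_sup \<G> + chain_sup \<H>"
    by (intro add_mono chain_sup_ge)
  then show "enat n \<le> chain_sup \<G> + chain_sup \<H>"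
    using \<open>n \<le> i + j\<close> by (metis enat_ord_simps(1) order_trans plus_enat_simps(1))
qed

lemma chain_sup_ge_add:
  assumes "\<G> \<subseteq> \<F>" "\<H> \<subseteq> \<F>" and sub: "\<And>A B. A \<in> \<G> \<Longrightarrow> B \<in> \<H> \<Longrightarrow> A \<subseteq> B"
    and ne: "\<G> \<noteq> {}" "\<H> \<noteq> {}"
  shows "chain_sup \<G> + chain_sup \<H> \<le> chain_sup \<F>"
proof -
  have concat: "enat (k + l) \<le> chain_sup \<F>" if f: "set_chain \<G> k f" and g: "set_chain \<H> l g" for k f l g
  proof -
    \<comment> \<open>Index \<open>k\<close> shows \<open>f k\<close> and index \<open>k + 1\<close>
      shows \<open>g 1\<close>. Dropping \<open>g 0\<close> keeps the junction strict even when
      \<open>f k = g 0\<close>.\<close>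
    have "set_chain \<F> (k + l) (\<lambda>i. if i \<le> k then f i else g (i - k))"
      unfolding set_chain_def
    proof (intro conjI allI impI)
      fix i assume "i \<le> k + l"
      then show "(if i \<le> k then f i else g (i - k)) \<in> \<F>"
        using f g assms(1,2) by (auto simp: set_chain_def)
    next
      fix i assume i: "i < k + l"
      consider "i < k" | "i = k" | "i > k" by linarith
      then show "(if i \<le> k then f i else g (i - k)) \<subset> (if Suc i \<le> k then f (Suc i) else g (Suc i - k))"
      proof cases
        case 2
        then have "f k \<subseteq> g 0" "g 0 \<subset> g (Suc 0)"
          using f g i sub by (auto simp: set_chain_def)
        then show ?thesis using 2 by auto
      next
        case 3
        then show ?thesis using g i by (simp add: set_chain_def Suc_diff_le)
      qed (use f in \<open>auto simp: set_chain_def\<close>)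
    qed
    then show ?thesis by (rule chain_sup_ge)
  qed
  show ?thesis
  proof (cases "chain_sup \<F>")
    case (enat N)
    have "chain_sup \<G> \<le> chain_sup \<F>" "chain_sup \<H> \<le> chain_sup \<F>"
      using assms(1,2) by (auto intro: chain_sup_mono)
    then obtain k l where kl: "chain_sup \<G> = enat k" "chain_sup \<H> = enat l"
      using enat by (metis enat_ile)
    obtain f where "set_chain \<G> k f" using chain_sup_attained[OF kl(1) ne(1)] .
    moreover obtain g where "set_chain \<H> l g" using chain_sup_attained[OF kl(2) ne(2)] .
    ultimately show ?thesis using concat kl by simp
  qed simp
qed

text \<open>A chain of maximal length has no room for a further member at either end or between
  neighbours. It takes the place of a composition series.\<close>

lemma set_chain_maximal:
  assumes "chain_sup \<F> = enat n" and f: "set_chain \<F> n f" and "M \<in> \<F>"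
  shows "\<not> M \<subset> f 0" "\<not> f n \<subset> M" "i < n \<Longrightarrow> \<not> (f i \<subset> M \<and> M \<subset> f (Suc i))"
proof -
  have no: "\<not> set_chain \<F> (Suc n) g" for g
    using chain_sup_ge[of \<F> "Suc n" g] assms(1) by auto
  show "\<not> f n \<subset> M"
    using no[of "f(Suc n := M)"] f assms(3) by (auto simp: set_chain_def less_Suc_eq le_Suc_eq)
  show "\<not> M \<subset> f 0"
  proof
    assume "M \<subset> f 0"
    then have "set_chain \<F> (Suc n) (\<lambda>i. if i = 0 then M else f (i - 1))"
      using f assms(3) unfolding set_chain_def
      by (intro conjI allI impI) (simp, case_tac i, simp_all)
    then show False using no by blast
  qed
  show "\<not> (f i \<subset> M \<and> M \<subset> f (Suc i))" if "i < n"
  proof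
    assume M: "f i \<subset> M \<and> M \<subset> f (Suc i)"
    have "set_chain \<F> (Suc n) (\<lambda>j. if j \<le> i then f j else if j = Suc i then M else f (j - 1))"
      unfolding set_chain_def
    proof (intro conjI allI impI)
      fix j assume "j < Suc n"
      consider "j < i" | "j = i" | "j = Suc i" | "j > Suc i" by linarith
      then show "(if j \<le> i then f j else if j = Suc i then M else f (j - 1)) \<subset>
         (if Suc j \<le> i then f (Suc j) else if Suc j = Suc i then M else f (Suc j - 1))"
        by cases (use f M \<open>j < Suc n\<close> \<open>i < n\<close> in
            \<open>cases j; simp add: set_chain_def\<close>)+
    qed (use f assms(3) that in \<open>auto simp: set_chain_def\<close>)
    then show False using no by blast
  qed
qed

section \<open>Lengths of localizations\<close>

context cring
begin

text \<open>Here \<open>\<sigma>\<close> is the identity or the Frobenius map. Members of \<open>lsub \<sigma>\<close> are the \<open>R\<close>-submodules of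
  \<open>R\<close> under restriction of scalars along \<open>\<sigma>\<close>. Those in \<open>ssub \<sigma> Q\<close> correspond to the submodules of the
  localization at \<open>Q\<close>, so that \<open>len \<sigma> Q A B\<close> is the length of \<open>(B/A)\<^sub>Q\<close> over \<open>R\<^sub>Q\<close>.\<close>

definition lsub :: "('a \<Rightarrow> 'a) \<Rightarrow> 'a set set" where
  "lsub \<sigma> = {N. N \<subseteq> carrier R \<and> \<zero> \<in> N \<and> (\<forall>x\<in>N. \<forall>y\<in>N. x \<oplus> y \<in> N) \<and>
     (\<forall>r\<in>carrier R. \<forall>x\<in>N. \<sigma> r \<otimes> x \<in> N)}"

definition satur :: "('a \<Rightarrow> 'a) \<Rightarrow> 'a set \<Rightarrow> 'a set \<Rightarrow> 'a set" where
  "satur \<sigma> Q N = {x \<in> carrier R. \<exists>t\<in>carrier R - Q. \<sigma> t \<otimes> x \<in> N}"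

definition ssub :: "('a \<Rightarrow> 'a) \<Rightarrow> 'a set \<Rightarrow> 'a set set" where
  "ssub \<sigma> Q = {N \<in> lsub \<sigma>. satur \<sigma> Q N \<subseteq> N}"

definition len :: "('a \<Rightarrow> 'a) \<Rightarrow> 'a set \<Rightarrow> 'a set \<Rightarrow> 'a set \<Rightarrow> enat" where
  "len \<sigma> Q A B = chain_sup {N \<in> ssub \<sigma> Q. A \<subseteq> N \<and> N \<subseteq> B}"

text \<open>With (\<sigma>, \<tau>) = (Frobenius, identity) these are the elements of
  \<open>Hom_R(F_*R, R)\<close>; with (identity, Frobenius) they are maps from \<open>R\<close> to
  \<open>F_*R\<close> such as \<open>s \<mapsto> F s \<otimes> u\<close>. Equal components give
  endomorphisms, for example multiplications.\<close>

definition semilinear :: "('a \<Rightarrow> 'a) \<Rightarrow> ('a \<Rightarrow> 'a) \<Rightarrow> ('a \<Rightarrow> 'a) \<Rightarrow> bool" where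
  "semilinear \<sigma> \<tau> \<theta> \<longleftrightarrow> \<theta> \<in> carrier R \<rightarrow> carrier R \<and>
     (\<forall>x\<in>carrier R. \<forall>y\<in>carrier R. \<theta> (x \<oplus> y) = \<theta> x \<oplus> \<theta> y) \<and>
     (\<forall>r\<in>carrier R. \<forall>x\<in>carrier R. \<theta> (\<sigma> r \<otimes> x) = \<tau> r \<otimes> \<theta> x)"

lemma lsubD:
  assumes "N \<in> lsub \<sigma>"
  shows "N \<subseteq> carrier R" "x \<in> N \<Longrightarrow> x \<in> carrier R" "\<zero> \<in> N"
    "x \<in> N \<Longrightarrow> y \<in> N \<Longrightarrow> x \<oplus> y \<in> N" "r \<in> carrier R \<Longrightarrow> x \<in> N \<Longrightarrow> \<sigma> r \<otimes> x \<in> N"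
  using assms unfolding lsub_def by auto

lemma lsubI:
  assumes "N \<subseteq> carrier R" "\<zero> \<in> N" "\<And>x y. x \<in> N \<Longrightarrow> y \<in> N \<Longrightarrow> x \<oplus> y \<in> N"
    "\<And>r x. r \<in> carrier R \<Longrightarrow> x \<in> N \<Longrightarrow> \<sigma> r \<otimes> x \<in> N"
  shows "N \<in> lsub \<sigma>"
  using assms unfolding lsub_def by auto

lemma lsub_minus:
  assumes \<sigma>: "\<sigma> \<in> ring_hom R R" and N: "N \<in> lsub \<sigma>" and "x \<in> N"
  shows "\<ominus> x \<in> N"
proof -
  have x: "x \<in> carrier R" using N \<open>x \<in> N\<close> by (auto dest: lsubD)
  interpret \<sigma>: ring_hom_ring R R \<sigma>
    by (rule ring_hom_ringI2[OF ring_axioms ring_axioms \<sigma>])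
  have "\<sigma> (\<ominus> \<one>) \<otimes> x = \<ominus> x" using x by (simp add: l_minus)
  then show ?thesis using lsubD(5)[OF N _ \<open>x \<in> N\<close>, of "\<ominus> \<one>"] by simp
qed

lemma lsub_diff:
  assumes "\<sigma> \<in> ring_hom R R" "N \<in> lsub \<sigma>" "x \<in> N" "y \<in> N"
  shows "x \<ominus> y \<in> N"
  using lsubD(4)[OF assms(2,3) lsub_minus[OF assms(1,2,4)]] by (simp add: a_minus_def)

lemma lsub_cancel:
  assumes "\<sigma> \<in> ring_hom R R" "N \<in> lsub \<sigma>" "x \<oplus> y \<in> N" "x \<in> N" "y \<in> carrier R"
  shows "y \<in> N"
proof -
  have "x \<in> carrier R" using assms by (auto dest: lsubD)
  then have "(x \<oplus> y) \<ominus> x = y" using assms(5) by algebra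
  then show ?thesis using lsub_diff[OF assms(1-4)] by simp
qed

lemma ssubD:
  assumes "N \<in> ssub \<sigma> Q"
  shows "N \<in> lsub \<sigma>"
    "t \<in> carrier R \<Longrightarrow> t \<notin> Q \<Longrightarrow> x \<in> carrier R \<Longrightarrow> \<sigma> t \<otimes> x \<in> N \<Longrightarrow> x \<in> N"
  using assms unfolding ssub_def satur_def by auto

lemma ssubI:
  assumes "N \<in> lsub \<sigma>" "\<And>t x. t \<in> carrier R \<Longrightarrow> t \<notin> Q \<Longrightarrow> x \<in> carrier R \<Longrightarrow> \<sigma> t \<otimes> x \<in> N \<Longrightarrow> x \<in> N"
  shows "N \<in> ssub \<sigma> Q"
  using assms unfolding ssub_def satur_def by auto

lemma carrier_lsub: "\<sigma> \<in> ring_hom R R \<Longrightarrow> carrier R \<in> lsub \<sigma>"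
  by (rule lsubI) (auto simp: ring_hom_closed)

lemma carrier_ssub: "\<sigma> \<in> ring_hom R R \<Longrightarrow> carrier R \<in> ssub \<sigma> Q"
  by (rule ssubI) (auto simp: carrier_lsub)

lemma Int_lsub: "M \<in> lsub \<sigma> \<Longrightarrow> N \<in> lsub \<sigma> \<Longrightarrow> M \<inter> N \<in> lsub \<sigma>"
  unfolding lsub_def by auto

lemma Int_ssub: "M \<in> ssub \<sigma> Q \<Longrightarrow> N \<in> ssub \<sigma> Q \<Longrightarrow> M \<inter> N \<in> ssub \<sigma> Q"
  by (rule ssubI) (auto intro: Int_lsub dest: ssubD)

section \<open>Sums, images and preimages of submodules\<close>

lemma set_add_mem: "z \<in> A <+>\<^bsub>R\<^esub> B \<longleftrightarrow> (\<exists>a\<in>A. \<exists>b\<in>B. z = a \<oplus> b)"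
  by (auto simp: set_add_def')

lemma set_add_lsub:
  assumes \<sigma>: "\<sigma> \<in> ring_hom R R" and M: "M \<in> lsub \<sigma>" and N: "N \<in> lsub \<sigma>"
  shows "M <+>\<^bsub>R\<^esub> N \<in> lsub \<sigma>"
proof (rule lsubI)
  show "M <+>\<^bsub>R\<^esub> N \<subseteq> carrier R" using lsubD(2)[OF M] lsubD(2)[OF N] by (auto simp: set_add_mem)
  show "\<zero> \<in> M <+>\<^bsub>R\<^esub> N" using lsubD(3)[OF M] lsubD(3)[OF N] by (force simp: set_add_mem)
next
  fix x y assume "x \<in> M <+>\<^bsub>R\<^esub> N" "y \<in> M <+>\<^bsub>R\<^esub> N"
  then obtain a b a' b' where *: "a \<in> M" "b \<in> N" "x = a \<oplus> b" "a' \<in> M" "b' \<in> N" "y = a' \<oplus> b'"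
    by (auto simp: set_add_mem)
  then have "x \<oplus> y = (a \<oplus> a') \<oplus> (b \<oplus> b')"
    using lsubD(2)[OF M] lsubD(2)[OF N] by (simp add: a_ac)
  then show "x \<oplus> y \<in> M <+>\<^bsub>R\<^esub> N" unfolding set_add_mem using * lsubD(4)[OF M] lsubD(4)[OF N] by blast
next
  fix r x assume r: "r \<in> carrier R" and "x \<in> M <+>\<^bsub>R\<^esub> N"
  then obtain a b where *: "a \<in> M" "b \<in> N" "x = a \<oplus> b" by (auto simp: set_add_mem)
  then have "\<sigma> r \<otimes> x = \<sigma> r \<otimes> a \<oplus> \<sigma> r \<otimes> b"
    using lsubD(2)[OF M] lsubD(2)[OF N] r by (simp add: r_distr ring_hom_closed[OF \<sigma>])
  then show "\<sigma> r \<otimes> x \<in> M <+>\<^bsub>R\<^esub> N" unfolding set_add_mem using * lsubD(5)[OF M r] lsubD(5)[OF N r] by blast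
qed

lemma set_add_upper:
  assumes "M \<in> lsub \<sigma>" "N \<in> lsub \<tau>"
  shows "M \<subseteq> M <+>\<^bsub>R\<^esub> N" "N \<subseteq> M <+>\<^bsub>R\<^esub> N"
proof -
  have "x \<in> M <+>\<^bsub>R\<^esub> N" if "x \<in> M" for x
    using lsubD(3)[OF assms(2)] lsubD(2)[OF assms(1) that] that r_zero by (force simp: set_add_mem)
  moreover have "x \<in> M <+>\<^bsub>R\<^esub> N" if "x \<in> N" for x
    using lsubD(3)[OF assms(1)] lsubD(2)[OF assms(2) that] that l_zero by (force simp: set_add_mem)
  ultimately show "M \<subseteq> M <+>\<^bsub>R\<^esub> N" "N \<subseteq> M <+>\<^bsub>R\<^esub> N" by auto
qed

lemma set_add_least: "L \<in> lsub \<sigma> \<Longrightarrow> M \<subseteq> L \<Longrightarrow> N \<subseteq> L \<Longrightarrow> M <+>\<^bsub>R\<^esub> N \<subseteq> L"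
  unfolding set_add_mem subset_iff using lsubD(4) by blast

lemma set_add_mono: "M \<subseteq> M' \<Longrightarrow> N \<subseteq> N' \<Longrightarrow> M <+>\<^bsub>R\<^esub> N \<subseteq> M' <+>\<^bsub>R\<^esub> N'"
  unfolding set_add_mem subset_iff by blast

lemma semilinear_zero: "semilinear \<sigma> \<tau> \<theta> \<Longrightarrow> \<theta> \<zero> = \<zero>"
proof -
  assume \<theta>: "semilinear \<sigma> \<tau> \<theta>"
  have z: "\<theta> \<zero> \<in> carrier R" using \<theta> by (auto simp: semilinear_def)
  have "\<theta> \<zero> \<oplus> \<theta> \<zero> = \<theta> (\<zero> \<oplus> \<zero>)" using \<theta> unfolding semilinear_def by (metis zero_closed)
  then show "\<theta> \<zero> = \<zero>" using z by simp
qed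

lemma image_lsub:
  assumes \<theta>: "semilinear \<sigma> \<tau> \<theta>" and \<tau>: "\<tau> \<in> ring_hom R R" and D: "D \<in> lsub \<sigma>"
  shows "\<theta> ` D \<in> lsub \<tau>"
proof (rule lsubI)
  show "\<theta> ` D \<subseteq> carrier R" using \<theta> lsubD(2)[OF D] by (auto simp: semilinear_def)
  show "\<zero> \<in> \<theta> ` D" using semilinear_zero[OF \<theta>] lsubD(3)[OF D] by force
next
  fix x y assume "x \<in> \<theta> ` D" "y \<in> \<theta> ` D"
  then obtain a b where *: "a \<in> D" "b \<in> D" "x = \<theta> a" "y = \<theta> b" by blast
  then have "x \<oplus> y = \<theta> (a \<oplus> b)" using \<theta> lsubD(2)[OF D] by (simp add: semilinear_def)
  then show "x \<oplus> y \<in> \<theta> ` D" using * lsubD(4)[OF D] by blast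
next
  fix r x assume r: "r \<in> carrier R" and "x \<in> \<theta> ` D"
  then obtain a where *: "a \<in> D" "x = \<theta> a" by blast
  then have "\<tau> r \<otimes> x = \<theta> (\<sigma> r \<otimes> a)" using \<theta> lsubD(2)[OF D] r by (simp add: semilinear_def)
  then show "\<tau> r \<otimes> x \<in> \<theta> ` D" using * lsubD(5)[OF D r] by blast
qed

lemma vimage_lsub:
  assumes \<theta>: "semilinear \<sigma> \<tau> \<theta>" and \<sigma>: "\<sigma> \<in> ring_hom R R" and N: "N \<in> lsub \<tau>"
  shows "{x \<in> carrier R. \<theta> x \<in> N} \<in> lsub \<sigma>"
  using \<theta> lsubD[OF N] semilinear_zero[OF \<theta>] ring_hom_closed[OF \<sigma>]
  by (intro lsubI) (auto simp: semilinear_def)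

lemma vimage_ssub:
  assumes \<theta>: "semilinear \<sigma> \<tau> \<theta>" and \<sigma>: "\<sigma> \<in> ring_hom R R" and N: "N \<in> ssub \<tau> Q"
  shows "{x \<in> carrier R. \<theta> x \<in> N} \<in> ssub \<sigma> Q"
  using vimage_lsub[OF \<theta> \<sigma> ssubD(1)[OF N]] ssubD(2)[OF N] \<theta>
  by (intro ssubI) (auto simp: semilinear_def)

context
  fixes Q assumes Q: "primeideal Q R"
begin

lemma prime_mem: "x \<in> Q \<Longrightarrow> x \<in> carrier R"
  by (meson Q ideal.Icarr primeideal.axioms(1))

lemma prime_one: "\<one> \<notin> Q"
  by (metis Q ideal.one_imp_carrier primeideal.I_notcarr primeideal.axioms(1))

lemma prime_mult: "s \<in> carrier R \<Longrightarrow> t \<in> carrier R \<Longrightarrow> s \<notin> Q \<Longrightarrow> t \<notin> Q \<Longrightarrow> s \<otimes> t \<notin> Q"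
  using primeideal.I_prime[OF Q] by blast

section \<open>Saturation at a prime and exactness properties of length\<close>

lemma satur_ssub:
  assumes \<sigma>: "\<sigma> \<in> ring_hom R R" and N: "N \<in> lsub \<sigma>"
  shows "satur \<sigma> Q N \<in> ssub \<sigma> Q"
proof -
  have c: "\<sigma> r \<in> carrier R" if "r \<in> carrier R" for r using \<sigma> that by (rule ring_hom_closed)
  have m: "\<sigma> (r \<otimes> s) = \<sigma> r \<otimes> \<sigma> s" if "r \<in> carrier R" "s \<in> carrier R" for r s
    using ring_hom_mult[OF \<sigma>] that by simp
  show ?thesis
  proof (intro ssubI lsubI)
    show "\<zero> \<in> satur \<sigma> Q N"
      unfolding satur_def using prime_one lsubD(3)[OF N] c by (auto intro!: bexI[of _ \<one>])
  next
    fix x y assume "x \<in> satur \<sigma> Q N" "y \<in> satur \<sigma> Q N"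
    then obtain s t where *: "s \<in> carrier R" "s \<notin> Q" "\<sigma> s \<otimes> x \<in> N" "t \<in> carrier R" "t \<notin> Q"
      "\<sigma> t \<otimes> y \<in> N" "x \<in> carrier R" "y \<in> carrier R" by (auto simp: satur_def)
    have "\<sigma> (s \<otimes> t) \<otimes> (x \<oplus> y) = \<sigma> t \<otimes> (\<sigma> s \<otimes> x) \<oplus> \<sigma> s \<otimes> (\<sigma> t \<otimes> y)"
      using * c by (simp add: m) algebra
    also have "\<dots> \<in> N" using * lsubD[OF N] by simp
    finally show "x \<oplus> y \<in> satur \<sigma> Q N" unfolding satur_def
      using * prime_mult by (auto intro!: bexI[of _ "s \<otimes> t"])
  next
    fix r x assume r: "r \<in> carrier R" and "x \<in> satur \<sigma> Q N"
    then obtain s where *: "s \<in> carrier R" "s \<notin> Q" "\<sigma> s \<otimes> x \<in> N" "x \<in> carrier R"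
      by (auto simp: satur_def)
    have "\<sigma> s \<otimes> (\<sigma> r \<otimes> x) = \<sigma> r \<otimes> (\<sigma> s \<otimes> x)" using * c r by (simp add: m_lcomm)
    also have "\<dots> \<in> N" using * lsubD[OF N] r by simp
    finally show "\<sigma> r \<otimes> x \<in> satur \<sigma> Q N" unfolding satur_def using * c r by auto
  next
    fix t x assume t: "t \<in> carrier R" "t \<notin> Q" "x \<in> carrier R" "\<sigma> t \<otimes> x \<in> satur \<sigma> Q N"
    then obtain s where *: "s \<in> carrier R" "s \<notin> Q" "\<sigma> s \<otimes> (\<sigma> t \<otimes> x) \<in> N" by (auto simp: satur_def)
    then have "\<sigma> (s \<otimes> t) \<otimes> x \<in> N" using t c by (simp add: m m_assoc)
    then show "x \<in> satur \<sigma> Q N" unfolding satur_def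
      using * t prime_mult by (auto intro!: bexI[of _ "s \<otimes> t"])
  qed (auto simp: satur_def)
qed

lemma satur_upper:
  assumes \<sigma>: "\<sigma> \<in> ring_hom R R" and "N \<subseteq> carrier R"
  shows "N \<subseteq> satur \<sigma> Q N"
  unfolding satur_def using assms prime_one ring_hom_one[OF \<sigma>] by (auto intro!: bexI[of _ \<one>])

lemma satur_least: "M \<in> ssub \<sigma> Q \<Longrightarrow> N \<subseteq> M \<Longrightarrow> satur \<sigma> Q N \<subseteq> M"
  unfolding satur_def by (auto dest: ssubD)

lemma satur_sum:
  assumes "\<sigma> \<in> ring_hom R R" "M \<in> lsub \<sigma>" "N \<in> lsub \<sigma>"
  shows "satur \<sigma> Q (M <+>\<^bsub>R\<^esub> N) \<in> ssub \<sigma> Q" "M \<subseteq> satur \<sigma> Q (M <+>\<^bsub>R\<^esub> N)"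
    "N \<subseteq> satur \<sigma> Q (M <+>\<^bsub>R\<^esub> N)"
proof -
  have l: "M <+>\<^bsub>R\<^esub> N \<in> lsub \<sigma>" using assms by (rule set_add_lsub)
  show "satur \<sigma> Q (M <+>\<^bsub>R\<^esub> N) \<in> ssub \<sigma> Q" using assms(1) l by (rule satur_ssub)
  have "M <+>\<^bsub>R\<^esub> N \<subseteq> satur \<sigma> Q (M <+>\<^bsub>R\<^esub> N)" using assms(1) lsubD(1)[OF l] by (rule satur_upper)
  then show "M \<subseteq> satur \<sigma> Q (M <+>\<^bsub>R\<^esub> N)" "N \<subseteq> satur \<sigma> Q (M <+>\<^bsub>R\<^esub> N)"
    using set_add_upper[OF assms(2,3)] by (auto intro: subset_trans)
qed

lemma satur_mono: "M \<subseteq> N \<Longrightarrow> satur \<sigma> Q M \<subseteq> satur \<sigma> Q N"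
  unfolding satur_def by auto

lemma satur_memI: "x \<in> carrier R \<Longrightarrow> t \<in> carrier R \<Longrightarrow> t \<notin> Q \<Longrightarrow> \<sigma> t \<otimes> x \<in> N \<Longrightarrow> x \<in> satur \<sigma> Q N"
  unfolding satur_def by auto

lemma satur_memE:
  assumes "x \<in> satur \<sigma> Q N"
  obtains t where "x \<in> carrier R" "t \<in> carrier R" "t \<notin> Q" "\<sigma> t \<otimes> x \<in> N"
  using assms unfolding satur_def by auto

text \<open>The submodules counted are saturated, so they contain \<open>A\<close> iff they contain
  its saturation. This lets the lower end of an interval be unsaturated.\<close>

lemma len_satur:
  assumes "\<sigma> \<in> ring_hom R R" "A \<subseteq> carrier R"
  shows "len \<sigma> Q (satur \<sigma> Q A) B = len \<sigma> Q A B"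
proof -
  have "{N \<in> ssub \<sigma> Q. satur \<sigma> Q A \<subseteq> N \<and> N \<subseteq> B} = {N \<in> ssub \<sigma> Q. A \<subseteq> N \<and> N \<subseteq> B}"
    using satur_upper[OF assms] satur_least by blast
  then show ?thesis by (simp add: len_def)
qed

lemma len_mono: "A' \<subseteq> A \<Longrightarrow> B \<subseteq> B' \<Longrightarrow> len \<sigma> Q A B \<le> len \<sigma> Q A' B'"
  unfolding len_def by (rule chain_sup_mono) auto

text \<open>Among comparable submodules, \<open>M\<close> is determined by
  \<open>M \<inter> B\<close> and the saturation of \<open>M + B\<close>: the modular law with
  denominators. The other inequality concatenates chains below and above \<open>B\<close>.\<close>

lemma len_add:
  assumes \<sigma>: "\<sigma> \<in> ring_hom R R" and B: "B \<in> ssub \<sigma> Q" and C: "C \<in> ssub \<sigma> Q" and "A \<subseteq> B" "B \<subseteq> C"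
  shows "len \<sigma> Q A C = len \<sigma> Q A B + len \<sigma> Q B C"
proof (rule antisym)
  let ?j = "\<lambda>M. satur \<sigma> Q (M <+>\<^bsub>R\<^esub> B)"
  show "len \<sigma> Q A C \<le> len \<sigma> Q A B + len \<sigma> Q B C"
    unfolding len_def
  proof (rule chain_sup_le_add[where g = "\<lambda>M. M \<inter> B" and h = ?j])
    fix M assume M: "M \<in> {N \<in> ssub \<sigma> Q. A \<subseteq> N \<and> N \<subseteq> C}"
    then show "M \<inter> B \<in> {N \<in> ssub \<sigma> Q. A \<subseteq> N \<and> N \<subseteq> B}"
      using B Int_ssub assms by auto
    have Ml: "M \<in> lsub \<sigma>" and Bl: "B \<in> lsub \<sigma>" and Cl: "C \<in> lsub \<sigma>"
      using M B C ssubD(1) by blast+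
    have MB: "M <+>\<^bsub>R\<^esub> B \<subseteq> C" using M assms(5) set_add_least[OF Cl] by auto
    then show "?j M \<in> {N \<in> ssub \<sigma> Q. B \<subseteq> N \<and> N \<subseteq> C}"
      using satur_sum[OF \<sigma> Ml Bl] satur_least[OF C] by simp
  next
    fix M N assume M: "M \<in> {N \<in> ssub \<sigma> Q. A \<subseteq> N \<and> N \<subseteq> C}" and N: "N \<in> {N \<in> ssub \<sigma> Q. A \<subseteq> N \<and> N \<subseteq> C}"
      and MN: "M \<subset> N"
    have "?j M \<subseteq> ?j N" using MN by (intro satur_mono set_add_mono) auto
    moreover have "?j M \<noteq> ?j N" if eq: "M \<inter> B = N \<inter> B"
    proof
      assume j: "?j M = ?j N"
      have "N \<subseteq> M"
      proof
        fix x assume x: "x \<in> N"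
        have Nl: "N \<in> lsub \<sigma>" and Bl: "B \<in> lsub \<sigma>" and Ml: "M \<in> lsub \<sigma>" using N B M ssubD(1) by blast+
        have "x \<in> ?j N"
          using satur_sum(2)[OF \<sigma> Nl Bl] x by (meson subsetD)
        then have "x \<in> ?j M" using j by simp
        then obtain t where t: "x \<in> carrier R" "t \<in> carrier R" "t \<notin> Q" "\<sigma> t \<otimes> x \<in> M <+>\<^bsub>R\<^esub> B"
          by (rule satur_memE)
        then obtain m b where mb: "m \<in> M" "b \<in> B" "\<sigma> t \<otimes> x = m \<oplus> b" by (auto simp: set_add_mem)
        have "b \<in> N"
          using lsub_cancel[OF \<sigma> Nl, of m b] mb lsubD(5)[OF Nl t(2) x] MN lsubD(2)[OF Bl] by auto
        then have "b \<in> M" using mb eq by blast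
        then have "\<sigma> t \<otimes> x \<in> M" using mb lsubD(4)[OF Ml] by simp
        then show "x \<in> M" using t M ssubD(2) by blast
      qed
      then show False using MN by blast
    qed
    ultimately show "M \<inter> B \<subseteq> N \<inter> B \<and> ?j M \<subseteq> ?j N \<and> (M \<inter> B \<noteq> N \<inter> B \<or> ?j M \<noteq> ?j N)"
      using MN by blast
  qed
  show "len \<sigma> Q A B + len \<sigma> Q B C \<le> len \<sigma> Q A C"
    unfolding len_def by (rule chain_sup_ge_add) (use assms in auto)
qed

text \<open>Locally at \<open>Q\<close>, \<theta> induces a map on \<open>D/E\<close> whose image
  modulo \<open>A\<close> contains \<open>B/A\<close>. Hence different submodules between
  \<open>A\<close> and \<open>B\<close> have different preimages in \<open>D\<close>.\<close>

lemma len_pull: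
  assumes \<sigma>: "\<sigma> \<in> ring_hom R R" and \<tau>: "\<tau> \<in> ring_hom R R" and \<theta>: "semilinear \<sigma> \<tau> \<theta>"
    and A: "A \<in> lsub \<tau>" and D: "D \<in> ssub \<sigma> Q"
    and gen: "B \<subseteq> satur \<tau> Q (A <+>\<^bsub>R\<^esub> \<theta> ` D)"
    and E: "\<And>x. x \<in> E \<Longrightarrow> x \<in> D \<and> \<theta> x \<in> satur \<tau> Q A"
  shows "len \<tau> Q A B \<le> len \<sigma> Q E D"
  unfolding len_def
proof (rule chain_sup_map[where g = "\<lambda>M. D \<inter> {x \<in> carrier R. \<theta> x \<in> M}"])
  fix M assume M: "M \<in> {N \<in> ssub \<tau> Q. A \<subseteq> N \<and> N \<subseteq> B}"
  then have "satur \<tau> Q A \<subseteq> M" using satur_least by blast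
  then show "D \<inter> {x \<in> carrier R. \<theta> x \<in> M} \<in> {N \<in> ssub \<sigma> Q. E \<subseteq> N \<and> N \<subseteq> D}"
    using M vimage_ssub[OF \<theta> \<sigma>] D E lsubD(2)[OF ssubD(1)[OF D]] Int_ssub[OF D] by blast
next
  fix M N assume M: "M \<in> {N \<in> ssub \<tau> Q. A \<subseteq> N \<and> N \<subseteq> B}" and N: "N \<in> {N \<in> ssub \<tau> Q. A \<subseteq> N \<and> N \<subseteq> B}"
    and MN: "M \<subset> N"
  have Ml: "M \<in> lsub \<tau>" and Nl: "N \<in> lsub \<tau>" using M N ssubD(1) by blast+
  obtain y where y: "y \<in> N" "y \<notin> M" using MN by blast
  then obtain t where t: "y \<in> carrier R" "t \<in> carrier R" "t \<notin> Q" "\<tau> t \<otimes> y \<in> A <+>\<^bsub>R\<^esub> \<theta> ` D"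
    using N gen satur_memE by blast
  then obtain a d where ad: "a \<in> A" "d \<in> D" "\<tau> t \<otimes> y = a \<oplus> \<theta> d" by (auto simp: set_add_mem)
  have d: "d \<in> carrier R" "\<theta> d \<in> carrier R" using ad D ssubD(1) lsubD(2) \<theta> unfolding semilinear_def by blast+
  have "\<theta> d \<in> N"
    using lsub_cancel[OF \<tau> Nl, of a "\<theta> d"] ad lsubD(5)[OF Nl t(2) y(1)] N d by auto
  moreover have "\<theta> d \<notin> M"
  proof
    assume "\<theta> d \<in> M"
    then have "\<tau> t \<otimes> y \<in> M" using ad M lsubD(4)[OF Ml] by auto
    then show False using y t M ssubD(2) by blast
  qed
  ultimately have "d \<in> D \<inter> {x \<in> carrier R. \<theta> x \<in> N}" "d \<notin> D \<inter> {x \<in> carrier R. \<theta> x \<in> M}" using ad d by auto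
  then show "D \<inter> {x \<in> carrier R. \<theta> x \<in> M} \<subset> D \<inter> {x \<in> carrier R. \<theta> x \<in> N}" using MN by blast
qed

text \<open>Locally at \<open>Q\<close> the kernel of \<open>D \<rightarrow> B/A\<close> lies in
  \<open>E\<close>, so \<open>D/E\<close> is a quotient of the image of \<open>D\<close> in
  \<open>B/A\<close>. Submodules between \<open>E\<close> and \<open>D\<close> contain the kernel
  and keep distinct images.\<close>

lemma len_push:
  assumes \<sigma>: "\<sigma> \<in> ring_hom R R" and \<tau>: "\<tau> \<in> ring_hom R R" and \<theta>: "semilinear \<sigma> \<tau> \<theta>"
    and A: "A \<in> lsub \<tau>" and D: "D \<in> lsub \<sigma>" and B: "B \<in> ssub \<tau> Q" "A \<subseteq> B" "\<theta> ` D \<subseteq> B"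
    and E: "\<And>x. x \<in> D \<Longrightarrow> \<theta> x \<in> A \<Longrightarrow> x \<in> satur \<sigma> Q E"
  shows "len \<sigma> Q E D \<le> len \<tau> Q A B"
  unfolding len_def
proof (rule chain_sup_map[where g = "\<lambda>M. satur \<tau> Q (A <+>\<^bsub>R\<^esub> \<theta> ` M)"])
  fix M assume M: "M \<in> {N \<in> ssub \<sigma> Q. E \<subseteq> N \<and> N \<subseteq> D}"
  then have im: "\<theta> ` M \<in> lsub \<tau>" using image_lsub[OF \<theta> \<tau>] ssubD(1) by blast
  have "\<theta> ` M \<subseteq> B" using M B(3) by auto
  then have "A <+>\<^bsub>R\<^esub> \<theta> ` M \<subseteq> B" by (rule set_add_least[OF ssubD(1)[OF B(1)] B(2)])
  then show "satur \<tau> Q (A <+>\<^bsub>R\<^esub> \<theta> ` M) \<in> {N \<in> ssub \<tau> Q. A \<subseteq> N \<and> N \<subseteq> B}"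
    using satur_sum[OF \<tau> A im] satur_least[OF B(1)] by simp
next
  fix M N assume M: "M \<in> {N \<in> ssub \<sigma> Q. E \<subseteq> N \<and> N \<subseteq> D}" and N: "N \<in> {N \<in> ssub \<sigma> Q. E \<subseteq> N \<and> N \<subseteq> D}"
    and MN: "M \<subset> N"
  have Ml: "M \<in> lsub \<sigma>" and Nl: "N \<in> lsub \<sigma>" using M N ssubD(1) by blast+
  have im: "\<theta> ` M \<in> lsub \<tau>" "\<theta> ` N \<in> lsub \<tau>" using image_lsub[OF \<theta> \<tau>] Ml Nl by blast+
  obtain y where y: "y \<in> N" "y \<notin> M" using MN by blast
  have yc: "y \<in> carrier R" using y lsubD(2)[OF Nl] by blast
  have "\<theta> y \<in> satur \<tau> Q (A <+>\<^bsub>R\<^esub> \<theta> ` N)"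
    using y satur_sum(3)[OF \<tau> A im(2)] by (meson imageI subsetD)
  moreover have "\<theta> y \<notin> satur \<tau> Q (A <+>\<^bsub>R\<^esub> \<theta> ` M)"
  proof
    assume "\<theta> y \<in> satur \<tau> Q (A <+>\<^bsub>R\<^esub> \<theta> ` M)"
    then obtain t where t: "\<theta> y \<in> carrier R" "t \<in> carrier R" "t \<notin> Q" "\<tau> t \<otimes> \<theta> y \<in> A <+>\<^bsub>R\<^esub> \<theta> ` M"
      by (rule satur_memE)
    then obtain a m where am: "a \<in> A" "m \<in> M" "\<tau> t \<otimes> \<theta> y = a \<oplus> \<theta> m" by (auto simp: set_add_mem)
    have \<sigma>t: "\<sigma> t \<otimes> y \<in> D" using N lsubD(5)[OF Nl t(2) y(1)] by blast
    have c: "a \<in> carrier R" "m \<in> carrier R" "\<theta> m \<in> carrier R" "\<sigma> t \<otimes> y \<in> carrier R" "\<ominus> m \<in> carrier R"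
      using am lsubD(2)[OF A] lsubD(2)[OF Ml] \<theta> t yc ring_hom_closed[OF \<sigma>] unfolding semilinear_def by auto
    have "\<theta> (\<ominus> m) \<oplus> \<theta> m = \<zero>"
      using \<theta> c semilinear_zero[OF \<theta>] unfolding semilinear_def by (metis l_neg)
    moreover have "\<theta> (\<ominus> m) \<in> carrier R" using c \<theta> unfolding semilinear_def by blast
    ultimately have neg: "\<theta> (\<ominus> m) = \<ominus> \<theta> m" using c by (simp add: minus_equality)
    have "\<theta> (\<sigma> t \<otimes> y \<oplus> \<ominus> m) = \<tau> t \<otimes> \<theta> y \<oplus> \<ominus> \<theta> m"
      using \<theta> c yc t neg unfolding semilinear_def by simp
    also have "\<dots> = a" using am c by (simp add: a_assoc r_neg)
    finally have "\<theta> (\<sigma> t \<otimes> y \<oplus> \<ominus> m) \<in> A" using am by simp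
    moreover have "\<sigma> t \<otimes> y \<oplus> \<ominus> m \<in> D"
      using \<sigma>t lsub_minus[OF \<sigma> Ml am(2)] M lsubD(4)[OF D] by blast
    ultimately have "\<sigma> t \<otimes> y \<oplus> \<ominus> m \<in> M" using E M satur_least by blast
    then have "\<sigma> t \<otimes> y \<oplus> \<ominus> m \<oplus> m \<in> M" using am(2) lsubD(4)[OF Ml] by blast
    then have "\<sigma> t \<otimes> y \<in> M" using c by (simp add: a_assoc l_neg)
    then show False using y yc t M ssubD(2) by blast
  qed
  moreover have "satur \<tau> Q (A <+>\<^bsub>R\<^esub> \<theta> ` M) \<subseteq> satur \<tau> Q (A <+>\<^bsub>R\<^esub> \<theta> ` N)"
    using MN by (intro satur_mono set_add_mono image_mono) auto
  ultimately show "satur \<tau> Q (A <+>\<^bsub>R\<^esub> \<theta> ` M) \<subset> satur \<tau> Q (A <+>\<^bsub>R\<^esub> \<theta> ` N)" by blast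
qed

end

section \<open>Ideals as submodules, residue fields and cyclic quotients\<close>

lemma id_hom: "(\<lambda>r. r) \<in> ring_hom R R"
  by (rule ring_hom_memI) auto

lemma semilinear_mult: "u \<in> carrier R \<Longrightarrow> \<sigma> \<in> ring_hom R R \<Longrightarrow> semilinear \<sigma> \<sigma> (\<lambda>s. s \<otimes> u)"
  using ring_hom_closed[of \<sigma> R R] by (auto simp: semilinear_def l_distr m_assoc)

lemma semilinear_hom: "u \<in> carrier R \<Longrightarrow> \<sigma> \<in> ring_hom R R \<Longrightarrow> semilinear (\<lambda>r. r) \<sigma> (\<lambda>s. \<sigma> s \<otimes> u)"
  using ring_hom_closed[of \<sigma> R R] ring_hom_add[of \<sigma> R R] ring_hom_mult[of \<sigma> R R]
  by (auto simp: semilinear_def l_distr m_assoc)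

lemma ideal_iff_lsub: "ideal N R \<longleftrightarrow> N \<in> lsub (\<lambda>r. r)"
proof
  assume "ideal N R"
  then interpret ideal N R .
  show "N \<in> lsub (\<lambda>r. r)" by (rule lsubI) (auto simp: I_l_closed)
next
  assume N: "N \<in> lsub (\<lambda>r. r)"
  note c = lsubD[OF N]
  show "ideal N R"
  proof (rule idealI[OF ring_axioms])
    show "subgroup N (add_monoid R)"
      using c lsub_minus[OF id_hom N] by (intro subgroup.intro) (auto simp flip: a_inv_def)
    show "a \<otimes> x \<in> N" if "a \<in> N" "x \<in> carrier R" for a x
      using c(5)[OF that(2,1)] c(2)[OF that(1)] that by (simp add: m_comm)
  qed (use c in auto)
qed

lemma ideal_lsub:
  assumes "ideal N R" "\<sigma> \<in> ring_hom R R" shows "N \<in> lsub \<sigma>"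
  using assms ring_hom_closed[OF assms(2)] unfolding ideal_iff_lsub by (auto simp: lsub_def)

lemma len_zero:
  assumes "\<sigma> \<in> ring_hom R R" "\<one> \<in> A" "ideal A R"
  shows "len \<sigma> Q A (carrier R) = 0"
proof -
  have "A = carrier R" using assms(2,3) by (simp add: ideal.one_imp_carrier)
  then have "{N \<in> ssub \<sigma> Q. A \<subseteq> N \<and> N \<subseteq> carrier R} = {carrier R}"
    using carrier_ssub[OF assms(1)] by auto
  moreover have "chain_sup {carrier R} \<le> 0"
  proof (rule chain_sup_le)
    fix n f assume "set_chain {carrier R} n f"
    then have "n = 0" by (cases n) (auto simp: set_chain_def)
    then show "enat n \<le> 0" by (simp add: zero_enat_def)
  qed
  ultimately show ?thesis by (simp add: len_def)
qed

lemma len_pos: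
  assumes "A \<in> ssub \<sigma> Q" "B \<in> ssub \<sigma> Q" "A \<subset> B"
  shows "1 \<le> len \<sigma> Q A B"
proof -
  have "set_chain {N \<in> ssub \<sigma> Q. A \<subseteq> N \<and> N \<subseteq> B} 1 (\<lambda>i. if i = 0 then A else B)"
    using assms by (auto simp: set_chain_def)
  then show ?thesis unfolding len_def one_enat_def by (rule chain_sup_ge)
qed

lemma prime_ssub:
  assumes Q: "primeideal Q R" shows "Q \<in> ssub (\<lambda>r. r) Q"
proof (rule ssubI)
  show "Q \<in> lsub (\<lambda>r. r)" using Q primeideal.axioms(1) ideal_iff_lsub by blast
qed (use primeideal.I_prime[OF Q] in blast)

text \<open>A saturated ideal strictly above \<open>Q\<close> contains some \<open>t\<close> outside
  \<open>Q\<close>, hence \<one>: locally at \<open>Q\<close> the quotient is the residue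
  field.\<close>

lemma len_prime_le:
  assumes Q: "primeideal Q R"
  shows "len (\<lambda>r. r) Q Q (carrier R) \<le> 1"
  unfolding len_def
proof (rule chain_sup_le)
  fix n f assume f: "set_chain {N \<in> ssub (\<lambda>r. r) Q. Q \<subseteq> N \<and> N \<subseteq> carrier R} n f"
  have *: "N = carrier R" if N: "N \<in> ssub (\<lambda>r. r) Q" "Q \<subset> N" for N
  proof -
    obtain t where t: "t \<in> N" "t \<notin> Q" using N by blast
    then have "t \<in> carrier R" using lsubD(2)[OF ssubD(1)[OF N(1)]] by blast
    then have "\<one> \<in> N" using ssubD(2)[OF N(1), of t \<one>] t by simp
    then show ?thesis using N ssubD(1) ideal_iff_lsub ideal.one_imp_carrier by metis
  qed
  show "enat n \<le> 1"
  proof (rule ccontr)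
    assume "\<not> enat n \<le> 1"
    then have n: "2 \<le> n" by (simp add: one_enat_def)
    then have s: "f 0 \<subset> f 1" "f 1 \<subset> f 2" using f by (auto simp: set_chain_def numeral_2_eq_2)
    have fm: "f i \<in> {N \<in> ssub (\<lambda>r. r) Q. Q \<subseteq> N \<and> N \<subseteq> carrier R}" if "i \<le> 2" for i
      using f n that by (auto simp: set_chain_def)
    have "Q \<subset> f 1" using fm[of 0] s(1) by auto
    then have "f 1 = carrier R" using *[of "f 1"] fm[of 1] by auto
    then show False using fm[of 2] s(2) by auto
  qed
qed

lemma add_cgen_memI: "a \<in> A \<Longrightarrow> r \<in> carrier R \<Longrightarrow> a \<oplus> r \<otimes> x \<in> A <+>\<^bsub>R\<^esub> PIdl x"
  unfolding set_add_mem cgenideal_def by blast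

lemma add_cgen_memE:
  assumes "z \<in> A <+>\<^bsub>R\<^esub> PIdl x"
  obtains a r where "a \<in> A" "r \<in> carrier R" "z = a \<oplus> r \<otimes> x"
  using assms unfolding set_add_mem cgenideal_def by blast

lemma add_cgen_ideal: "ideal A R \<Longrightarrow> x \<in> carrier R \<Longrightarrow> ideal (A <+>\<^bsub>R\<^esub> PIdl x) R"
  by (intro add_ideals cgenideal_ideal)

lemma add_cgen_upper:
  assumes "ideal A R" "x \<in> carrier R"
  shows "A \<subseteq> A <+>\<^bsub>R\<^esub> PIdl x" "x \<in> A <+>\<^bsub>R\<^esub> PIdl x"
  using set_add_upper[OF ideal_lsub[OF assms(1) id_hom] ideal_lsub[OF cgenideal_ideal[OF assms(2)] id_hom]]
    cgenideal_self[OF assms(2)] by auto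

lemma cgen_image: "PIdl x = (\<lambda>s. s \<otimes> x) ` carrier R"
  by (auto simp: cgenideal_def)

lemma colon_ideal:
  assumes "ideal A R" "x \<in> carrier R" shows "ideal {r \<in> carrier R. r \<otimes> x \<in> A} R"
  using vimage_lsub[OF semilinear_mult[OF assms(2) id_hom] id_hom] assms(1)
  by (simp add: ideal_iff_lsub)

lemma ideal_subset: "ideal A R \<Longrightarrow> A \<subseteq> carrier R"
  by (simp add: ideal_iff_lsub lsubD(1))

context
  fixes Q assumes Q: "primeideal Q R"
begin

text \<open>Right exactness of
  \<open>R/E \<rightarrow> R/N \<rightarrow> R/(N + \<sigma>(R) u)\<close>, the first map being
  \<open>s \<mapsto> \<sigma> s \<otimes> u\<close>. The cyclic piece is counted with the identity;
  this is how lengths for \<open>F\<close> are reduced to lengths of ideals.\<close>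

lemma len_split_hom:
  assumes \<sigma>: "\<sigma> \<in> ring_hom R R" and N: "N \<in> lsub \<sigma>" and u: "u \<in> carrier R"
    and E: "\<And>s. s \<in> E \<Longrightarrow> s \<in> carrier R \<and> \<sigma> s \<otimes> u \<in> N"
  shows "len \<sigma> Q N (carrier R) \<le> len (\<lambda>r. r) Q E (carrier R) +
    len \<sigma> Q (N <+>\<^bsub>R\<^esub> (\<lambda>s. \<sigma> s \<otimes> u) ` carrier R) (carrier R)"
proof -
  let ?U = "(\<lambda>s. \<sigma> s \<otimes> u) ` carrier R"
  let ?B = "satur \<sigma> Q (N <+>\<^bsub>R\<^esub> ?U)"
  have U: "?U \<in> lsub \<sigma>" by (rule image_lsub[OF semilinear_hom[OF u \<sigma>] \<sigma> carrier_lsub[OF id_hom]])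
  have B: "?B \<in> ssub \<sigma> Q" "N \<subseteq> ?B" using satur_sum[OF Q \<sigma> N U] by auto
  have "len \<sigma> Q N (carrier R) = len \<sigma> Q N ?B + len \<sigma> Q ?B (carrier R)"
    using lsubD(1)[OF ssubD(1)[OF B(1)]] by (intro len_add[OF Q \<sigma> B(1) carrier_ssub[OF \<sigma>] B(2)])
  also have "len \<sigma> Q ?B (carrier R) = len \<sigma> Q (N <+>\<^bsub>R\<^esub> ?U) (carrier R)"
    by (rule len_satur[OF Q \<sigma> lsubD(1)[OF set_add_lsub[OF \<sigma> N U]]])
  also have "len \<sigma> Q N ?B \<le> len (\<lambda>r. r) Q E (carrier R)"
    using satur_upper[OF Q \<sigma> lsubD(1)[OF N]] E
    by (intro len_pull[OF Q id_hom \<sigma> semilinear_hom[OF u \<sigma>] N carrier_ssub[OF id_hom]]) auto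
  finally show ?thesis by (simp add: add_mono)
qed

lemma len_split:
  assumes A: "ideal A R" and x: "x \<in> carrier R"
  shows "len (\<lambda>r. r) Q A (carrier R) \<le>
    len (\<lambda>r. r) Q {r \<in> carrier R. r \<otimes> x \<in> A} (carrier R) + len (\<lambda>r. r) Q (A <+>\<^bsub>R\<^esub> PIdl x) (carrier R)"
  using len_split_hom[OF id_hom ideal_lsub[OF A id_hom] x, of "{r \<in> carrier R. r \<otimes> x \<in> A}"]
  by (simp add: cgen_image)

text \<open>Multiplication by \<open>x\<close> is injective modulo the prime \<open>P\<close>, so
  \<open>R/(P + yR)\<close>, \<open>R/(P + xyR)\<close> and \<open>R/(P + xR)\<close> form a short
  exact sequence. Its left map enters through \<open>len_pull\<close> for one inequality and through
  \<open>len_push\<close> for the other.\<close>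

lemma len_mult:
  assumes P: "primeideal P R" and x: "x \<in> carrier R" "x \<notin> P" and y: "y \<in> carrier R"
  shows "len (\<lambda>r. r) Q (P <+>\<^bsub>R\<^esub> PIdl (x \<otimes> y)) (carrier R) =
    len (\<lambda>r. r) Q (P <+>\<^bsub>R\<^esub> PIdl x) (carrier R) + len (\<lambda>r. r) Q (P <+>\<^bsub>R\<^esub> PIdl y) (carrier R)"
proof -
  let ?A = "P <+>\<^bsub>R\<^esub> PIdl (x \<otimes> y)" and ?E = "P <+>\<^bsub>R\<^esub> PIdl y"
  let ?B = "satur (\<lambda>r. r) Q (P <+>\<^bsub>R\<^esub> PIdl x)"
  have Pi: "ideal P R" using P by (rule primeideal.axioms(1))
  have I: "ideal ?A R" "ideal ?E R" "ideal (P <+>\<^bsub>R\<^esub> PIdl x) R"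
    using Pi x y by (auto intro: add_cgen_ideal)
  have c: "carrier R \<in> ssub (\<lambda>r. r) Q" by (rule carrier_ssub[OF id_hom])
  have B: "?B \<in> ssub (\<lambda>r. r) Q" "P \<subseteq> ?B" "PIdl x \<subseteq> ?B"
    using satur_sum[OF Q id_hom ideal_lsub[OF Pi id_hom] ideal_lsub[OF cgenideal_ideal[OF x(1)] id_hom]] by auto
  have "PIdl (x \<otimes> y) \<subseteq> PIdl x" using x y by (auto simp: cgenideal_def) (metis m_assoc m_closed m_comm)
  then have AB: "?A \<subseteq> ?B" using set_add_least[OF ssubD(1)[OF B(1)] B(2)] B(3) by blast
  have "len (\<lambda>r. r) Q ?A (carrier R) = len (\<lambda>r. r) Q ?A ?B + len (\<lambda>r. r) Q ?B (carrier R)"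
    using lsubD(1)[OF ssubD(1)[OF B(1)]] by (intro len_add[OF Q id_hom B(1) c AB])
  also have "len (\<lambda>r. r) Q ?B (carrier R) = len (\<lambda>r. r) Q (P <+>\<^bsub>R\<^esub> PIdl x) (carrier R)"
    by (rule len_satur[OF Q id_hom ideal_subset[OF I(3)]])
  also have "len (\<lambda>r. r) Q ?A ?B = len (\<lambda>r. r) Q ?E (carrier R)"
  proof (rule antisym)
    show "len (\<lambda>r. r) Q ?A ?B \<le> len (\<lambda>r. r) Q ?E (carrier R)"
    proof (rule len_pull[OF Q id_hom id_hom semilinear_mult[OF x(1) id_hom] ideal_lsub[OF I(1) id_hom] c])
      show "?B \<subseteq> satur (\<lambda>r. r) Q (?A <+>\<^bsub>R\<^esub> (\<lambda>s. s \<otimes> x) ` carrier R)"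
        unfolding cgen_image[symmetric]
        by (intro satur_mono[OF Q] set_add_mono add_cgen_upper(1)[OF Pi]) (use x y in auto)
      fix s assume "s \<in> ?E"
      then obtain a r where *: "a \<in> P" "r \<in> carrier R" "s = a \<oplus> r \<otimes> y"
        by (rule add_cgen_memE)
      have ac: "a \<in> carrier R" using * prime_mem[OF P] by blast
      have "s \<otimes> x = a \<otimes> x \<oplus> r \<otimes> (x \<otimes> y)" unfolding *(3) using *(2) ac x y by algebra
      moreover have "a \<otimes> x \<in> P" using * x Pi by (simp add: ideal.I_r_closed)
      ultimately have "s \<otimes> x \<in> ?A" using add_cgen_memI[of "a \<otimes> x" P r] * by simp
      then show "s \<in> carrier R \<and> s \<otimes> x \<in> satur (\<lambda>r. r) Q ?A"
        using satur_upper[OF Q id_hom ideal_subset[OF I(1)]] * ac y by auto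
    qed
    show "len (\<lambda>r. r) Q ?E (carrier R) \<le> len (\<lambda>r. r) Q ?A ?B"
    proof (rule len_push[OF Q id_hom id_hom semilinear_mult[OF x(1) id_hom] ideal_lsub[OF I(1) id_hom]
          ssubD(1)[OF c] B(1) AB])
      show "(\<lambda>s. s \<otimes> x) ` carrier R \<subseteq> ?B" using B(3) by (simp add: cgen_image)
      fix s assume s: "s \<in> carrier R" "s \<otimes> x \<in> ?A"
      from s(2) obtain a r where *: "a \<in> P" "r \<in> carrier R" "s \<otimes> x = a \<oplus> r \<otimes> (x \<otimes> y)"
        by (rule add_cgen_memE)
      have ac: "a \<in> carrier R" using * prime_mem[OF P] by blast
      have "(s \<ominus> r \<otimes> y) \<otimes> x = s \<otimes> x \<ominus> r \<otimes> (x \<otimes> y)" using s * x y by algebra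
      also have "\<dots> = a" unfolding *(3) using ac * x y by algebra
      finally have "s \<ominus> r \<otimes> y \<in> P"
        using primeideal.I_prime[OF P, of "s \<ominus> r \<otimes> y" x] s * x y by auto
      moreover have "s = (s \<ominus> r \<otimes> y) \<oplus> r \<otimes> y" using s * y by algebra
      ultimately have "s \<in> ?E" using add_cgen_memI[of "s \<ominus> r \<otimes> y" P r y] * by simp
      then show "s \<in> satur (\<lambda>r. r) Q ?E" using satur_upper[OF Q id_hom ideal_subset[OF I(2)]] by blast
    qed
  qed
  finally show ?thesis by (simp add: add.commute)
qed

lemma len_power:
  assumes P: "primeideal P R" and x: "x \<in> carrier R" "x \<notin> P"
  shows "len (\<lambda>r. r) Q (P <+>\<^bsub>R\<^esub> PIdl (x [^] (n::nat))) (carrier R) =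
    enat n * len (\<lambda>r. r) Q (P <+>\<^bsub>R\<^esub> PIdl x) (carrier R)"
proof (induction n)
  case 0
  have Pi: "ideal P R" using P by (rule primeideal.axioms(1))
  have "\<one> \<in> P <+>\<^bsub>R\<^esub> PIdl \<one>" using add_cgen_upper(2)[OF Pi, of \<one>] by simp
  then show ?case using len_zero[OF id_hom _ add_cgen_ideal[OF Pi, of \<one>]] by (simp add: zero_enat_def[symmetric])
next
  case (Suc n)
  have "x [^] Suc n = x \<otimes> x [^] n" using x by (simp add: m_comm)
  then have "len (\<lambda>r. r) Q (P <+>\<^bsub>R\<^esub> PIdl (x [^] Suc n)) (carrier R) =
    len (\<lambda>r. r) Q (P <+>\<^bsub>R\<^esub> PIdl x) (carrier R) + enat n * len (\<lambda>r. r) Q (P <+>\<^bsub>R\<^esub> PIdl x) (carrier R)"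
    using len_mult[OF P x, of "x [^] n"] x Suc.IH by simp
  also have "\<dots> = enat (Suc n) * len (\<lambda>r. r) Q (P <+>\<^bsub>R\<^esub> PIdl x) (carrier R)"
    by (simp flip: eSuc_enat add: mult_eSuc)
  finally show ?case .
qed

end

end

text \<open>A nonempty chain of ideals in a Noetherian ring contains its union, so Zorn's lemma
  yields a maximal counterexample.\<close>

lemma (in noetherian_ring) ideal_induct [consumes 1, case_names ideal]:
  assumes "ideal A R"
    and step: "\<And>A. ideal A R \<Longrightarrow> (\<And>B. ideal B R \<Longrightarrow> A \<subset> B \<Longrightarrow> P B) \<Longrightarrow> P A"
  shows "P A"
proof (rule ccontr)
  assume "\<not> P A"
  define S where "S = {I. ideal I R \<and> \<not> P I}"
  have "A \<in> S" using assms(1) \<open>\<not> P A\<close> by (simp add: S_def)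
  have "\<exists>M\<in>S. \<forall>X\<in>S. M \<subseteq> X \<longrightarrow> X = M"
  proof (rule subset_Zorn)
    fix C assume C: "subset.chain S C"
    show "\<exists>U\<in>S. \<forall>X\<in>C. X \<subseteq> U"
    proof (cases "C = {}")
      case False
      have "subset.chain {I. ideal I R} C"
        using C by (auto simp: subset_chain_def S_def)
      then have "\<Union>C \<in> C" using ideal_chain_is_trivial[OF False] by blast
      then show ?thesis using C by (auto simp: subset_chain_def)
    qed (use \<open>A \<in> S\<close> in blast)
  qed
  then obtain M where M: "M \<in> S" "\<And>X. X \<in> S \<Longrightarrow> M \<subseteq> X \<Longrightarrow> X = M" by blast
  have "P M" by (rule step) (use M in \<open>auto simp: S_def\<close>)
  then show False using M(1) by (simp add: S_def)
qed

lemma (in cring) not_prime_witness: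
  assumes "ideal A R" "\<one> \<notin> A" "\<not> primeideal A R"
  obtains x y where "x \<in> carrier R" "y \<in> carrier R" "x \<notin> A" "y \<notin> A" "x \<otimes> y \<in> A"
proof -
  have "A \<noteq> carrier R" using assms(2) by auto
  then show ?thesis using primeidealI[OF assms(1) is_cring] assms(3) that by metis
qed

text \<open>The hypothesis makes \<open>Q\<close> minimal over \<open>A\<close>, unless
  \<open>A\<close> is not inside \<open>Q\<close> and the localized quotient vanishes. If a proper
  \<open>A\<close> is not prime, \<open>x\<close> and \<open>y\<close> outside \<open>A\<close> have
  product in \<open>A\<close>; then \<open>(A : x)\<close> and \<open>A + xR\<close> are strictly
  larger, and Noetherian induction applies to both.\<close>

lemma (in noetherian_domain) len_finite:
  assumes "ideal A R" and Q: "primeideal Q R"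
    and "\<And>P. primeideal P R \<Longrightarrow> A \<subseteq> P \<Longrightarrow> P \<subseteq> Q \<Longrightarrow> P = Q"
  shows "len (\<lambda>r. r) Q A (carrier R) \<noteq> \<infinity>"
  using assms(1,3)
proof (induction rule: ideal_induct)
  case (ideal A)
  show ?case
  proof (cases "\<one> \<in> A")
    case True
    then show ?thesis using len_zero[OF id_hom _ ideal(1)] by simp
  next
    case one: False
    show ?thesis
    proof (cases "A \<subseteq> Q")
      case False
      then obtain t where t: "t \<in> A" "t \<notin> Q" by blast
      then have tc: "t \<in> carrier R" using ideal(1) ideal.Icarr by metis
      let ?C = "satur (\<lambda>r. r) Q A"
      have C: "?C \<in> ssub (\<lambda>r. r) Q" using satur_ssub[OF Q id_hom ideal_lsub[OF ideal(1) id_hom]] .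
      have "\<one> \<in> ?C" using t tc satur_memI[OF Q, of \<one> t] by simp
      then have "len (\<lambda>r. r) Q ?C (carrier R) = 0"
        using len_zero[OF id_hom] C ssubD(1) ideal_iff_lsub by blast
      then show ?thesis using len_satur[OF Q id_hom ideal_subset[OF ideal(1)]] by simp
    next
      case AQ: True
      show ?thesis
      proof (cases "primeideal A R")
        case True
        then have "A = Q" using ideal(3) AQ by blast
        then have "len (\<lambda>r. r) Q A (carrier R) \<le> 1" using len_prime_le[OF Q] by simp
        then show ?thesis by (metis infinity_ileE one_enat_def)
      next
        case False
        then obtain x y where xy: "x \<in> carrier R" "y \<in> carrier R" "x \<notin> A" "y \<notin> A" "x \<otimes> y \<in> A"
          using not_prime_witness[OF ideal(1) one] by blast
        let ?B = "{r \<in> carrier R. r \<otimes> x \<in> A}" and ?C = "A <+>\<^bsub>R\<^esub> PIdl x"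
        have B: "ideal ?B R" "A \<subset> ?B"
          using colon_ideal[OF ideal(1) xy(1)] ideal.Icarr[OF ideal(1)] ideal.I_r_closed[OF ideal(1)] xy
          by (auto simp: m_comm)
        have C: "ideal ?C R" "A \<subset> ?C"
          using add_cgen_ideal[OF ideal(1) xy(1)] add_cgen_upper[OF ideal(1) xy(1)] xy by auto
        have "len (\<lambda>r. r) Q ?B (carrier R) \<noteq> \<infinity>" "len (\<lambda>r. r) Q ?C (carrier R) \<noteq> \<infinity>"
          using ideal(2)[OF B] ideal(2)[OF C] ideal(3) B(2) C(2) by (meson psubset_imp_subset subset_trans)+
        then show ?thesis using len_split[OF Q ideal(1) xy(1)]
          by (auto simp: enat_ile)
      qed
    qed
  qed
qed

section \<open>Residue degrees of the Frobenius map\<close>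

locale F_finite_domain = noetherian_domain R for R (structure) +
  fixes p :: nat
  assumes F_finite: "F_finite R p" and p_ge_2: "2 \<le> p"
begin

abbreviation F :: "'a \<Rightarrow> 'a" where "F \<equiv> frobenius R p"

text \<open>The degree of \<open>\<kappa>(Q)\<close> over \<open>\<kappa>(Q)\<^sup>p\<close>. For \<open>Q = 0\<close> it is the rank of \<open>F\<^sub>*R\<close>.\<close>

definition \<rho> :: "'a set \<Rightarrow> enat" where "\<rho> Q = len F Q Q (carrier R)"

lemma F_hom: "F \<in> ring_hom R R"
  using F_finite by (simp add: F_finite_def finite_ring_map_def)

lemma F_pow: "F x = x [^] p" by (simp add: frobenius_def)

lemma F_closed [simp]: "x \<in> carrier R \<Longrightarrow> F x \<in> carrier R"
  by (simp add: F_pow)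

lemma F_mult: "x \<in> carrier R \<Longrightarrow> y \<in> carrier R \<Longrightarrow> F (x \<otimes> y) = F x \<otimes> F y"
  using ring_hom_mult[OF F_hom] .

lemma F_add: "x \<in> carrier R \<Longrightarrow> y \<in> carrier R \<Longrightarrow> F (x \<oplus> y) = F x \<oplus> F y"
  using ring_hom_add[OF F_hom] .

lemma F_eq_mult:
  assumes "x \<in> carrier R" shows "F x = x [^] (p - 1) \<otimes> x"
  using p_ge_2 nat_pow_Suc[of x "p - 1"] by (simp add: F_pow)

lemma F_in_ideal: "ideal A R \<Longrightarrow> x \<in> A \<Longrightarrow> F x \<in> A"
  using ideal.Icarr[of A R x] F_eq_mult[of x] by (simp add: ideal.I_l_closed)

lemma F_mem_prime:
  assumes Q: "primeideal Q R" and x: "x \<in> carrier R" "F x \<in> Q" shows "x \<in> Q"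
proof -
  have "x [^] n \<in> Q \<Longrightarrow> x \<in> Q" for n :: nat
    by (induction n) (use prime_one[OF Q] primeideal.I_prime[OF Q, of "x [^] _" x] x in auto)
  then show ?thesis using x by (simp add: F_pow)
qed

lemma F_generators:
  obtains A where "finite A" "A \<subseteq> carrier R" "\<And>N. N \<in> lsub F \<Longrightarrow> A \<subseteq> N \<Longrightarrow> N = carrier R"
proof -
  let ?M = "restrict_scalars F R"
  obtain A where A: "finite A" "A \<subseteq> carrier R" "module_span R ?M A = carrier R"
    using F_finite by (auto simp: F_finite_def finite_ring_map_def fg_module_def restrict_scalars_def)
  have "N = carrier R" if N: "N \<in> lsub F" "A \<subseteq> N" for N
  proof -
    have "subgroup N (add_monoid R)"
      using lsubD[OF N(1)] lsub_minus[OF F_hom N(1)] by (intro subgroup.intro) (auto simp flip: a_inv_def)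
    then have "submodule N R ?M"
      using lsubD(5)[OF N(1)]
      by (auto simp: submodule_def submodule_axioms_def restrict_scalars_def subgroup_def m_inv_def)
    then have "module_span R ?M A \<subseteq> N" using N(2) by (auto simp: module_span_def)
    then show ?thesis using A(3) lsubD(1)[OF N(1)] by auto
  qed
  then show ?thesis using that A by blast
qed

section \<open>Lengths of ideals seen in the Frobenius pushforward\<close>

lemma ssub_id_F:
  assumes Q: "primeideal Q R" and N: "N \<in> ssub (\<lambda>r. r) Q" shows "N \<in> ssub F Q"
proof (rule ssubI)
  show "N \<in> lsub F" using ssubD(1)[OF N] ideal_lsub[OF _ F_hom] ideal_iff_lsub by blast
  show "x \<in> N" if "t \<in> carrier R" "t \<notin> Q" "x \<in> carrier R" "F t \<otimes> x \<in> N" for t x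
    using ssubD(2)[OF N, of "F t" x] F_mem_prime[OF Q, of t] that by auto
qed

text \<open>Denominators \<open>t\<close> and \<open>F t = t^p\<close> are interchangeable for
  ideals: \<open>F t\<close> avoids \<open>Q\<close> when \<open>t\<close> does, and it is a
  multiple of \<open>t\<close>.\<close>

lemma satur_F_ideal:
  assumes Q: "primeideal Q R" and A: "ideal A R" shows "satur F Q A = satur (\<lambda>r. r) Q A"
proof
  show "satur F Q A \<subseteq> satur (\<lambda>r. r) Q A"
    unfolding satur_def using F_mem_prime[OF Q] F_closed by blast
  have "F t \<otimes> x \<in> A" if "t \<in> carrier R" "x \<in> carrier R" "t \<otimes> x \<in> A" for t x
    using that ideal.I_l_closed[OF A that(3), of "t [^] (p - 1)"] by (simp add: F_eq_mult m_assoc)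
  then show "satur (\<lambda>r. r) Q A \<subseteq> satur F Q A" unfolding satur_def by blast
qed

lemma \<rho>_ge_1: assumes Q: "primeideal Q R" shows "1 \<le> \<rho> Q"
  unfolding \<rho>_def
  using prime_mem[OF Q] prime_one[OF Q]
  by (intro len_pos ssub_id_F[OF Q prime_ssub[OF Q]] carrier_ssub F_hom) auto

text \<open>Locally at \<open>Q\<close>, \<open>B/A\<close> is simple, so any \<open>u\<close> in
  \<open>B\<close> outside \<open>A\<close> generates it with annihilator \<open>Q\<close>.
  Multiplication by \<open>u\<close> then identifies \<open>F_*(R/Q)\<close> with
  \<open>F_*(B/A)\<close>.\<close>

lemma len_F_adjacent:
  assumes Q: "primeideal Q R" and A: "A \<in> ssub (\<lambda>r. r) Q" and B: "B \<in> ssub (\<lambda>r. r) Q" and AB: "A \<subset> B"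
    and adj: "\<And>M. M \<in> ssub (\<lambda>r. r) Q \<Longrightarrow> \<not> (A \<subset> M \<and> M \<subset> B)"
  shows "len F Q A B = \<rho> Q"
proof -
  obtain u where u: "u \<in> B" "u \<notin> A" using AB by blast
  have uc: "u \<in> carrier R" using u lsubD(2)[OF ssubD(1)[OF B]] by blast
  have Ai: "ideal A R" and Bi: "ideal B R" using A B ssubD(1) ideal_iff_lsub by blast+
  have step: "B = satur (\<lambda>r. r) Q (A <+>\<^bsub>R\<^esub> PIdl v)" if v: "v \<in> B" "v \<notin> A" for v
  proof -
    have vc: "v \<in> carrier R" using v lsubD(2)[OF ssubD(1)[OF B]] by blast
    let ?M = "satur (\<lambda>r. r) Q (A <+>\<^bsub>R\<^esub> PIdl v)"
    have M: "?M \<in> ssub (\<lambda>r. r) Q" "A \<subseteq> ?M" "PIdl v \<subseteq> ?M"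
      using satur_sum[OF Q id_hom ideal_lsub[OF Ai id_hom] ideal_lsub[OF cgenideal_ideal[OF vc] id_hom]] by auto
    have "PIdl v \<subseteq> B" using cgenideal_minimal[OF Bi v(1)] .
    then have "?M \<subseteq> B" using AB by (intro satur_least[OF Q B] set_add_least[OF ssubD(1)[OF B]]) auto
    moreover have "A \<noteq> ?M" using M(3) cgenideal_self[OF vc] v(2) by blast
    ultimately show ?thesis using adj[OF M(1)] M(2) by blast
  qed
  have colon: "s \<otimes> u \<in> A \<longleftrightarrow> s \<in> Q" if s: "s \<in> carrier R" for s
  proof
    assume "s \<otimes> u \<in> A" then show "s \<in> Q" using ssubD(2)[OF A s _ uc] u by blast
  next
    assume sQ: "s \<in> Q"
    \<comment> \<open>A Nakayama argument: outside \<open>A\<close>, the element \<open>s u\<close>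
      would generate \<open>B\<close> as well, and \<open>t u = a + r s u\<close> would put
      \<open>(t - r s) u\<close> into \<open>A\<close> with \<open>t - r s\<close> outside
      \<open>Q\<close>.\<close>
    show "s \<otimes> u \<in> A"
    proof (rule ccontr)
      assume "s \<otimes> u \<notin> A"
      then have "u \<in> satur (\<lambda>r. r) Q (A <+>\<^bsub>R\<^esub> PIdl (s \<otimes> u))"
        using step[of "s \<otimes> u"] ideal.I_l_closed[OF Bi u(1) s] u(1) by blast
      then obtain t where t: "t \<in> carrier R" "t \<notin> Q" "t \<otimes> u \<in> A <+>\<^bsub>R\<^esub> PIdl (s \<otimes> u)"
        by (rule satur_memE[OF Q])
      from t(3) obtain a r where ar: "a \<in> A" "r \<in> carrier R" "t \<otimes> u = a \<oplus> r \<otimes> (s \<otimes> u)"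
        by (rule add_cgen_memE)
      have ac: "a \<in> carrier R" using ar ideal.Icarr[OF Ai] by blast
      have "(t \<ominus> r \<otimes> s) \<otimes> u = t \<otimes> u \<ominus> r \<otimes> (s \<otimes> u)" using t(1) ar(2) s uc by algebra
      also have "\<dots> = a" unfolding ar(3) using ac ar(2) s uc by algebra
      finally have "(t \<ominus> r \<otimes> s) \<otimes> u \<in> A" using ar by simp
      moreover have "t \<ominus> r \<otimes> s \<notin> Q"
      proof
        assume h: "t \<ominus> r \<otimes> s \<in> Q"
        have Ql: "Q \<in> lsub (\<lambda>r. r)" using prime_ssub[OF Q] ssubD(1) by blast
        have "(t \<ominus> r \<otimes> s) \<oplus> r \<otimes> s \<in> Q" using lsubD(4,5)[OF Ql] h ar sQ by blast
        moreover have "(t \<ominus> r \<otimes> s) \<oplus> r \<otimes> s = t" using t(1) ar(2) s by algebra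
        ultimately show False using t by simp
      qed
      ultimately have "u \<in> A" using ssubD(2)[OF A _ _ uc] t ar s by (metis minus_closed m_closed)
      then show False using u by blast
    qed
  qed
  have Al: "A \<in> lsub F" by (rule ideal_lsub[OF Ai F_hom])
  show ?thesis unfolding \<rho>_def
  proof (rule antisym)
    have "B = satur F Q (A <+>\<^bsub>R\<^esub> (\<lambda>s. s \<otimes> u) ` carrier R)"
      using step[OF u] satur_F_ideal[OF Q add_cgen_ideal[OF Ai uc]] by (simp add: cgen_image)
    then show "len F Q A B \<le> len F Q Q (carrier R)"
      using satur_upper[OF Q F_hom lsubD(1)[OF Al]] colon prime_mem[OF Q]
      by (intro len_pull[OF Q F_hom F_hom semilinear_mult[OF uc F_hom] Al carrier_ssub[OF F_hom]]) auto
    show "len F Q Q (carrier R) \<le> len F Q A B"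
      using colon AB ideal.I_l_closed[OF Bi u(1)] satur_upper[OF Q F_hom ideal_subset] Q
      by (intro len_push[OF Q F_hom F_hom semilinear_mult[OF uc F_hom] Al carrier_lsub[OF F_hom]
            ssub_id_F[OF Q B]]) (auto dest: primeideal.axioms(1))
  qed
qed

text \<open>A longest chain of saturated ideals above \<open>A\<close> is a composition series with
  all factors \<open>\<kappa>(Q)\<close>, and each factor has length \<rho> \<open>Q\<close> under
  \<open>F\<close>. An infinite length stays infinite, as chains of ideals are chains of
  \<open>F\<close>-submodules.\<close>

lemma len_F:
  assumes Q: "primeideal Q R" and A: "ideal A R"
  shows "len F Q A (carrier R) = \<rho> Q * len (\<lambda>r. r) Q A (carrier R)"
proof -
  let ?A = "satur (\<lambda>r. r) Q A" and ?F = "{N \<in> ssub (\<lambda>r. r) Q. satur (\<lambda>r. r) Q A \<subseteq> N \<and> N \<subseteq> carrier R}"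
  have As: "?A \<in> ssub (\<lambda>r. r) Q" by (rule satur_ssub[OF Q id_hom ideal_lsub[OF A id_hom]])
  have e1: "len (\<lambda>r. r) Q A (carrier R) = len (\<lambda>r. r) Q ?A (carrier R)"
    by (rule len_satur[OF Q id_hom ideal_subset[OF A], symmetric])
  have e2: "len F Q A (carrier R) = len F Q ?A (carrier R)"
    using len_satur[OF Q F_hom ideal_subset[OF A]] satur_F_ideal[OF Q A] by simp
  show ?thesis
  proof (cases "len (\<lambda>r. r) Q ?A (carrier R)")
    case infinity
    have "len (\<lambda>r. r) Q ?A (carrier R) \<le> len F Q ?A (carrier R)"
      unfolding len_def using ssub_id_F[OF Q] by (intro chain_sup_mono) auto
    moreover have "0 < \<rho> Q" using \<rho>_ge_1[OF Q] by (metis gr_zeroI not_one_le_zero)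
    ultimately show ?thesis using infinity e1 e2 by (simp add: imult_infinity_right)
  next
    case (enat n)
    have Asub: "?A \<in> ?F" "carrier R \<in> ?F"
      using As carrier_ssub[OF id_hom] lsubD(1)[OF ssubD(1)[OF As]] by auto
    have n: "chain_sup ?F = enat n" using enat by (simp add: len_def)
    then obtain f where f: "set_chain ?F n f" using chain_sup_attained Asub by blast
    have fF: "f i \<in> ?F" if "i \<le> n" for i using f that by (auto simp: set_chain_def)
    have f0: "f 0 = ?A" using set_chain_maximal(1)[OF n f Asub(1)] fF[of 0] by blast
    have fn: "f n = carrier R" using set_chain_maximal(2)[OF n f Asub(2)] fF[of n] by blast
    have "len F Q ?A (f k) = enat k * \<rho> Q" if "k \<le> n" for k using that
    proof (induction k)
      case 0
      have "len F Q ?A ?A \<le> 0" unfolding len_def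
      proof (rule chain_sup_le)
        fix m g assume g: "set_chain {N \<in> ssub F Q. ?A \<subseteq> N \<and> N \<subseteq> ?A} m g"
        have "m = 0"
        proof (rule ccontr)
          assume "m \<noteq> 0"
          then have "g 0 \<in> {N \<in> ssub F Q. ?A \<subseteq> N \<and> N \<subseteq> ?A}" "g 1 \<in> {N \<in> ssub F Q. ?A \<subseteq> N \<and> N \<subseteq> ?A}"
            "g 0 \<subset> g 1" using g unfolding set_chain_def by simp_all
          then show False by blast
        qed
        then show "enat m \<le> 0" by (simp add: zero_enat_def)
      qed
      then show ?case using f0 by (simp add: zero_enat_def[symmetric])
    next
      case (Suc k)
      have k: "f k \<in> ssub (\<lambda>r. r) Q" "f (Suc k) \<in> ssub (\<lambda>r. r) Q" "f k \<subset> f (Suc k)" "?A \<subseteq> f k"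
        using fF[of k] fF[of "Suc k"] f Suc.prems by (auto simp: set_chain_def)
      have "len F Q ?A (f (Suc k)) = len F Q ?A (f k) + len F Q (f k) (f (Suc k))"
        using k ssub_id_F[OF Q] by (intro len_add[OF Q F_hom]) auto
      also have "len F Q (f k) (f (Suc k)) = \<rho> Q"
      proof (rule len_F_adjacent[OF Q k(1-3)])
        fix M assume M: "M \<in> ssub (\<lambda>r. r) Q"
        show "\<not> (f k \<subset> M \<and> M \<subset> f (Suc k))"
        proof
          assume h: "f k \<subset> M \<and> M \<subset> f (Suc k)"
          then have "M \<in> ?F" using M k(4) lsubD(1)[OF ssubD(1)[OF M]] by auto
          then show False using set_chain_maximal(3)[OF n f, of M k] h Suc.prems by simp
        qed
      qed
      finally show ?case using Suc by (simp flip: eSuc_enat add: mult_eSuc add.commute)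
    qed
    from this[of n] show ?thesis using fn e1 e2 enat by (simp add: mult.commute)
  qed
qed

section \<open>Bases of the pushforward up to denominators\<close>

lemma F_span_lsub: "u \<in> carrier R \<Longrightarrow> (\<lambda>s. F s \<otimes> u) ` carrier R \<in> lsub F"
  by (rule image_lsub[OF semilinear_hom F_hom carrier_lsub[OF id_hom]]) (auto simp: F_hom)

text \<open>Finitely many generators of \<open>F_*R\<close> are adjoined to \<open>Q\<close> one at
  a time. As \<open>F\<close> maps \<open>Q\<close> into \<open>Q\<close>, each contributes a
  quotient of \<open>R/Q\<close>, of length at most 1.\<close>

lemma \<rho>_finite:
  assumes Q: "primeideal Q R" shows "\<rho> Q \<noteq> \<infinity>"
proof -
  obtain A where A: "finite A" "A \<subseteq> carrier R" "\<And>N. N \<in> lsub F \<Longrightarrow> A \<subseteq> N \<Longrightarrow> N = carrier R"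
    using F_generators by blast
  have Qi: "ideal Q R" using Q by (rule primeideal.axioms(1))
  have "\<exists>N\<in>lsub F. A \<subseteq> N \<and> Q \<subseteq> N \<and> (\<exists>n. \<rho> Q \<le> enat n + len F Q N (carrier R))"
    using A(1,2)
  proof (induction A)
    case empty
    show ?case by (rule bexI[OF _ ideal_lsub[OF Qi F_hom]]) (auto simp: \<rho>_def intro!: exI[of _ 0] simp flip: zero_enat_def)
  next
    case (insert g A)
    then obtain N n where N: "N \<in> lsub F" "A \<subseteq> N" "Q \<subseteq> N" "\<rho> Q \<le> enat n + len F Q N (carrier R)" by auto
    have g: "g \<in> carrier R" using insert by simp
    let ?N = "N <+>\<^bsub>R\<^esub> (\<lambda>s. F s \<otimes> g) ` carrier R"
    have N': "?N \<in> lsub F" "N \<subseteq> ?N" "(\<lambda>s. F s \<otimes> g) ` carrier R \<subseteq> ?N"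
      using set_add_lsub[OF F_hom N(1) F_span_lsub[OF g]] set_add_upper[OF N(1) F_span_lsub[OF g]] by auto
    have "F \<one> \<otimes> g = g" using g ring_hom_one[OF F_hom] by simp
    then have "g \<in> (\<lambda>s. F s \<otimes> g) ` carrier R" by (metis image_eqI one_closed)
    then have "g \<in> ?N" using N'(3) by blast
    have "len F Q N (carrier R) \<le> len (\<lambda>r. r) Q Q (carrier R) + len F Q ?N (carrier R)"
    proof (rule len_split_hom[OF Q F_hom N(1) g])
      fix s assume s: "s \<in> Q"
      have "F s \<otimes> g \<in> Q" using F_in_ideal[OF Qi s] g ideal.I_r_closed[OF Qi] by blast
      then show "s \<in> carrier R \<and> F s \<otimes> g \<in> N" using s prime_mem[OF Q] N(3) by blast
    qed
    also have "\<dots> \<le> 1 + len F Q ?N (carrier R)" using len_prime_le[OF Q] by (rule add_right_mono)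
    finally have "\<rho> Q \<le> enat n + (1 + len F Q ?N (carrier R))" using N(4) by (meson add_left_mono order_trans)
    then have "\<rho> Q \<le> enat (Suc n) + len F Q ?N (carrier R)"
      by (simp add: one_enat_def add.assoc[symmetric])
    then show ?case using N' \<open>g \<in> ?N\<close> N by (intro bexI[of _ ?N]) auto
  qed
  then obtain n where "\<rho> Q \<le> enat n + len F Q (carrier R) (carrier R)" using A(3) by blast
  then show ?thesis using len_zero[OF F_hom one_closed oneideal] by (auto simp: enat_ile)
qed

text \<open>The span of the first \<open>i\<close> elements over the \<open>p\<close>-th powers,
  lifted from \<open>R/P\<close> to \<open>R\<close> by the start value \<open>P\<close>. Building
  it in order allows coefficients to be compared from the top down.\<close>

fun Fspan :: "'a set \<Rightarrow> (nat \<Rightarrow> 'a) \<Rightarrow> nat \<Rightarrow> 'a set" where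
  "Fspan P u 0 = P"
| "Fspan P u (Suc i) = Fspan P u i <+>\<^bsub>R\<^esub> (\<lambda>s. F s \<otimes> u i) ` carrier R"

lemma Fspan_lsub:
  assumes "ideal P R" "\<And>j. j < i \<Longrightarrow> u j \<in> carrier R"
  shows "Fspan P u i \<in> lsub F"
  using assms(2)
proof (induction i)
  case 0
  then show ?case using ideal_lsub[OF assms(1) F_hom] by simp
next
  case (Suc i)
  then show ?case using set_add_lsub[OF F_hom _ F_span_lsub, of "Fspan P u i" "u i"] by simp
qed

lemma Fspan_SucE:
  assumes "x \<in> Fspan P u (Suc i)"
  obtains w s where "w \<in> Fspan P u i" "s \<in> carrier R" "x = w \<oplus> F s \<otimes> u i"
  using assms by (auto simp: set_add_mem)

lemma Fspan_mono:
  assumes P: "ideal P R" and u: "\<And>j. j < k \<Longrightarrow> u j \<in> carrier R" and "i \<le> k"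
  shows "Fspan P u i \<subseteq> Fspan P u k"
  using assms(3,2)
proof (induction rule: dec_induct)
  case (step n)
  have "Fspan P u n \<subseteq> Fspan P u (Suc n)"
    using set_add_upper(1)[OF Fspan_lsub[OF P] F_span_lsub, of n u "u n"] step by simp
  then show ?case using step by auto
qed simp

text \<open>The \<open>u i\<close> form a basis of \<open>\<kappa>(P)\<close> over \<open>\<kappa>(P)\<^sup>p\<close>, and \<open>z\<close> is a common denominator for the
  expansions of the elements of \<open>R\<close> in this basis.\<close>

lemma F_basis:
  assumes P: "primeideal P R" and r: "\<rho> P = enat r"
  obtains u z where "\<And>i. i < r \<Longrightarrow> u i \<in> carrier R"
    "\<And>i s. i < r \<Longrightarrow> s \<in> carrier R \<Longrightarrow> F s \<otimes> u i \<in> Fspan P u i \<Longrightarrow> s \<in> P"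
    "z \<in> carrier R" "z \<notin> P" "\<And>x. x \<in> carrier R \<Longrightarrow> z \<otimes> x \<in> Fspan P u r"
proof -
  let ?F = "{N \<in> ssub F P. P \<subseteq> N \<and> N \<subseteq> carrier R}"
  have Pi: "ideal P R" using P by (rule primeideal.axioms(1))
  have mem: "P \<in> ?F" "carrier R \<in> ?F"
    using ssub_id_F[OF P prime_ssub[OF P]] carrier_ssub[OF F_hom] ideal_subset[OF Pi] by auto
  have n: "chain_sup ?F = enat r" using r by (simp add: \<rho>_def len_def)
  then obtain f where f: "set_chain ?F r f" using chain_sup_attained mem by blast
  have fF: "f i \<in> ?F" if "i \<le> r" for i using f that by (auto simp: set_chain_def)
  have f0: "f 0 = P" using set_chain_maximal(1)[OF n f mem(1)] fF[of 0] by blast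
  have fr: "f r = carrier R" using set_chain_maximal(2)[OF n f mem(2)] fF[of r] by blast
  have "\<forall>i<r. \<exists>x. x \<in> f (Suc i) \<and> x \<notin> f i" using f by (auto simp: set_chain_def)
  then obtain u where u: "\<And>i. i < r \<Longrightarrow> u i \<in> f (Suc i) \<and> u i \<notin> f i" by metis
  have uc: "u i \<in> carrier R" if "i < r" for i using u[OF that] fF[of "Suc i"] that by auto
  \<comment> \<open>The \<open>u i\<close> come from a longest chain \<open>f\<close>. Adjoining
    \<open>u k\<close> leads strictly beyond \<open>f k\<close>, and no saturated submodule lies
    strictly between \<open>f k\<close> and \<open>f (Suc k)\<close>, so the saturated span fills
    \<open>f (Suc k)\<close>.\<close>
  have sp: "satur F P (Fspan P u k) = f k" if "k \<le> r" for k using that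
  proof (induction k)
    case 0
    have "satur F P P \<subseteq> P" using mem(1) satur_least[OF P, of P F P] by auto
    then show ?case using f0 satur_upper[OF P F_hom ideal_subset[OF Pi]] by auto
  next
    case (Suc k)
    then have IH: "satur F P (Fspan P u k) = f k" and k: "k < r" by auto
    let ?M = "satur F P (Fspan P u (Suc k))"
    have l: "Fspan P u k \<in> lsub F" using Fspan_lsub[OF Pi] uc k by auto
    have uk: "(\<lambda>s. F s \<otimes> u k) ` carrier R \<in> lsub F" using F_span_lsub uc[OF k] .
    have M: "?M \<in> ssub F P" "Fspan P u k \<subseteq> ?M" "(\<lambda>s. F s \<otimes> u k) ` carrier R \<subseteq> ?M"
      using satur_sum[OF P F_hom l uk] by auto
    have fs: "f (Suc k) \<in> ssub F P" "f (Suc k) \<in> lsub F" using fF[of "Suc k"] k ssubD(1) by auto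
    have "f k \<subseteq> ?M" using satur_least[OF P M(1,2)] IH by simp
    moreover have "F \<one> \<otimes> u k = u k" using uc[OF k] ring_hom_one[OF F_hom] by simp
    then have "u k \<in> (\<lambda>s. F s \<otimes> u k) ` carrier R" by (metis image_eqI one_closed)
    then have "u k \<in> ?M" using M(3) by blast
    moreover have "Fspan P u k \<subseteq> f (Suc k)"
      using IH satur_upper[OF P F_hom lsubD(1)[OF l]] set_chain_mono[OF f, of k "Suc k"] k by auto
    then have "Fspan P u (Suc k) \<subseteq> f (Suc k)"
      using lsubD(5)[OF fs(2)] u[OF k] unfolding Fspan.simps by (intro set_add_least[OF fs(2)]) auto
    then have "?M \<subseteq> f (Suc k)" by (rule satur_least[OF P fs(1)])
    moreover have "?M \<in> ?F" using M(1) \<open>f k \<subseteq> ?M\<close> fF[of k] k lsubD(1)[OF ssubD(1)[OF M(1)]] by auto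
    ultimately show ?case using set_chain_maximal(3)[OF n f, of ?M k] k u[OF k] by blast
  qed
  have free: "s \<in> P" if i: "i < r" and s: "s \<in> carrier R" "F s \<otimes> u i \<in> Fspan P u i" for i s
  proof (rule ccontr)
    assume "s \<notin> P"
    then have "u i \<in> satur F P (Fspan P u i)" using satur_memI[OF P, of "u i" s F] uc i s by blast
    then show False using sp[of i] u[OF i] i by simp
  qed
  have W: "Fspan P u r \<in> lsub F" using Fspan_lsub[OF Pi] uc by auto
  obtain A where A: "finite A" "A \<subseteq> carrier R" "\<And>N. N \<in> lsub F \<Longrightarrow> A \<subseteq> N \<Longrightarrow> N = carrier R"
    using F_generators by blast
  \<comment> \<open>Finitely many generators of \<open>F_*R\<close> have a common denominator
    \<open>F t\<close>. The elements that it carries into the span form an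
    \<open>F\<close>-submodule, so it serves all of \<open>R\<close> and becomes the required
    \<open>z\<close>.\<close>
  have "\<exists>t\<in>carrier R - P. \<forall>g\<in>A. F t \<otimes> g \<in> Fspan P u r"
    using A(1,2)
  proof (induction A)
    case empty
    then show ?case using prime_one[OF P] by (auto intro!: bexI[of _ \<one>])
  next
    case (insert g A)
    then obtain t where t: "t \<in> carrier R" "t \<notin> P" "\<forall>g\<in>A. F t \<otimes> g \<in> Fspan P u r" by auto
    have g: "g \<in> carrier R" using insert by simp
    then have "g \<in> satur F P (Fspan P u r)" using sp[of r] fr by simp
    then obtain s where s: "s \<in> carrier R" "s \<notin> P" "F s \<otimes> g \<in> Fspan P u r" by (rule satur_memE[OF P])
    have "F (s \<otimes> t) \<otimes> h \<in> Fspan P u r" if "h \<in> insert g A" for h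
    proof -
      have h: "h \<in> carrier R" using that insert by auto
      have eq: "F (s \<otimes> t) \<otimes> h = F t \<otimes> (F s \<otimes> h)" "F (s \<otimes> t) \<otimes> h = F s \<otimes> (F t \<otimes> h)"
        using s t h by (simp_all add: F_mult m_ac)
      show ?thesis
      proof (cases "h = g")
        case True
        then show ?thesis unfolding eq(1) using s(3) lsubD(5)[OF W t(1)] by blast
      next
        case False
        then show ?thesis unfolding eq(2) using that t(3) lsubD(5)[OF W s(1)] by blast
      qed
    qed
    then show ?case using prime_mult[OF P s(1) t(1) s(2) t(2)] s t by (intro bexI[of _ "s \<otimes> t"]) auto
  qed
  then obtain t where t: "t \<in> carrier R" "t \<notin> P" "\<And>g. g \<in> A \<Longrightarrow> F t \<otimes> g \<in> Fspan P u r" by auto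
  have tA: "x \<otimes> F t \<in> Fspan P u r" if "x \<in> A" for x
    using t(3)[OF that] that A(2) t(1) m_comm[of x "F t"] by auto
  have "{x \<in> carrier R. x \<otimes> F t \<in> Fspan P u r} = carrier R"
    by (rule A(3)[OF vimage_lsub[OF semilinear_mult[OF F_closed[OF t(1)] F_hom] F_hom W]])
      (use A(2) tA in auto)
  then have "x \<otimes> F t \<in> Fspan P u r" if "x \<in> carrier R" for x using that by blast
  then have mult: "F t \<otimes> x \<in> Fspan P u r" if "x \<in> carrier R" for x
    using that t(1) by (metis F_closed m_comm)
  have "F t \<notin> P" using F_mem_prime[OF P t(1)] t(2) by blast
  show ?thesis by (rule that[of u "F t"]) (fact uc free F_closed[OF t(1)] \<open>F t \<notin> P\<close> mult)+
qed

text \<open>\<open>R/A'\<close> is filtered by \<open>A' + c W\<close>, with \<open>W\<close>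
  running through the partial spans of a basis. Since \<open>c F(s) u\<close> lies in
  \<open>A'\<close> for \<open>s\<close> in \<open>A\<close>, each of the \<rho> \<open>P\<close>
  steps is a quotient of \<open>R/A\<close>. The full span contains \<open>zR\<close>, so what
  remains is a quotient of \<open>R/(A' + c z R)\<close>.\<close>

lemma len_F_le:
  assumes P: "primeideal P R"
  obtains z where "z \<in> carrier R" "z \<notin> P"
    "\<And>Q A A' c. primeideal Q R \<Longrightarrow> ideal A' R \<Longrightarrow> P \<subseteq> A' \<Longrightarrow> c \<in> carrier R \<Longrightarrow> A \<subseteq> carrier R \<Longrightarrow>
      (\<And>s. s \<in> A \<Longrightarrow> c \<otimes> F s \<in> A') \<Longrightarrow>
      \<rho> Q * len (\<lambda>r. r) Q A' (carrier R) \<le> \<rho> P * len (\<lambda>r. r) Q A (carrier R) +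
        \<rho> Q * len (\<lambda>r. r) Q (A' <+>\<^bsub>R\<^esub> PIdl (c \<otimes> z)) (carrier R)"
proof -
  obtain r where r: "\<rho> P = enat r" using \<rho>_finite[OF P] by auto
  obtain u z where u: "\<And>i. i < r \<Longrightarrow> u i \<in> carrier R"
    and z: "z \<in> carrier R" "z \<notin> P" "\<And>x. x \<in> carrier R \<Longrightarrow> z \<otimes> x \<in> Fspan P u r"
    using F_basis[OF P r] by metis
  have Pi: "ideal P R" using P by (rule primeideal.axioms(1))
  show ?thesis
  proof (rule that[OF z(1,2)])
    fix Q A A' c
    assume Q: "primeideal Q R" and A': "ideal A' R" and PA: "P \<subseteq> A'" and c: "c \<in> carrier R"
      and A: "A \<subseteq> carrier R" and cA: "\<And>s. s \<in> A \<Longrightarrow> c \<otimes> F s \<in> A'"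
    let ?W = "\<lambda>i. A' <+>\<^bsub>R\<^esub> (\<lambda>x. x \<otimes> c) ` Fspan P u i"
    let ?L = "len (\<lambda>r. r) Q A (carrier R)"
    have A'l: "A' \<in> lsub F" by (rule ideal_lsub[OF A' F_hom])
    have Wl: "(\<lambda>x. x \<otimes> c) ` Fspan P u i \<in> lsub F" if "i \<le> r" for i
      by (rule image_lsub[OF semilinear_mult[OF c F_hom] F_hom Fspan_lsub[OF Pi]]) (use u that in auto)
    have "len F Q A' (carrier R) \<le> enat i * ?L + len F Q (?W i) (carrier R)" if "i \<le> r" for i
      using that
    proof (induction i)
      case 0
      have "(\<lambda>x. x \<otimes> c) ` P \<subseteq> A'" using PA ideal.I_r_closed[OF A' _ c] by blast
      then have "?W 0 \<subseteq> A'" using set_add_least[OF A'l] by simp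
      then show ?case using len_mono[OF Q, of "?W 0" A' "carrier R" "carrier R" F]
        by (simp add: zero_enat_def[symmetric])
    next
      case (Suc i)
      have ui: "u i \<in> carrier R" using u Suc.prems by simp
      have l: "?W i \<in> lsub F" using set_add_lsub[OF F_hom A'l Wl] Suc.prems by simp
      let ?U = "(\<lambda>s. F s \<otimes> (u i \<otimes> c)) ` carrier R"
      have "len F Q (?W i) (carrier R) \<le> ?L + len F Q (?W i <+>\<^bsub>R\<^esub> ?U) (carrier R)"
      proof (rule len_split_hom[OF Q F_hom l])
        fix s assume s: "s \<in> A"
        then have sc: "s \<in> carrier R" using A by blast
        have "F s \<otimes> (u i \<otimes> c) = u i \<otimes> (c \<otimes> F s)" using sc ui c by (simp add: m_ac)
        also have "\<dots> \<in> A'" using ideal.I_l_closed[OF A' cA[OF s] ui] .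
        finally have "F s \<otimes> (u i \<otimes> c) \<in> ?W i" using set_add_upper(1)[OF A'l Wl, of i] Suc.prems by auto
        then show "s \<in> carrier R \<and> F s \<otimes> (u i \<otimes> c) \<in> ?W i" using sc by simp
      qed (use ui c in simp)
      also have "len F Q (?W i <+>\<^bsub>R\<^esub> ?U) (carrier R) \<le> len F Q (?W (Suc i)) (carrier R)"
      proof (rule len_mono[OF Q _ order_refl])
        have ll: "?W i <+>\<^bsub>R\<^esub> ?U \<in> lsub F" using set_add_lsub[OF F_hom l F_span_lsub] ui c by simp
        have s1: "?W i \<subseteq> ?W i <+>\<^bsub>R\<^esub> ?U" "?U \<subseteq> ?W i <+>\<^bsub>R\<^esub> ?U"
          using set_add_upper[OF l F_span_lsub] ui c by auto
        have s2: "A' \<subseteq> ?W i" "(\<lambda>x. x \<otimes> c) ` Fspan P u i \<subseteq> ?W i"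
          using set_add_upper[OF A'l Wl] Suc.prems by auto
        have "x \<otimes> c \<in> ?W i <+>\<^bsub>R\<^esub> ?U" if "x \<in> Fspan P u (Suc i)" for x
        proof -
          from that obtain w s where ws: "w \<in> Fspan P u i" "s \<in> carrier R" "x = w \<oplus> F s \<otimes> u i"
            by (rule Fspan_SucE)
          have wc: "w \<in> carrier R" using lsubD(2)[OF Fspan_lsub[OF Pi] ws(1)] u Suc.prems by auto
          have "x \<otimes> c = w \<otimes> c \<oplus> F s \<otimes> (u i \<otimes> c)" using ws wc ui c by (simp add: l_distr m_assoc)
          moreover have "w \<otimes> c \<in> ?W i <+>\<^bsub>R\<^esub> ?U" using ws(1) s1(1) s2(2) by blast
          moreover have "F s \<otimes> (u i \<otimes> c) \<in> ?W i <+>\<^bsub>R\<^esub> ?U" using ws(2) s1(2) by blast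
          ultimately show ?thesis using lsubD(4)[OF ll] by simp
        qed
        then show "?W (Suc i) \<subseteq> ?W i <+>\<^bsub>R\<^esub> ?U"
          using s1(1) s2(1) by (intro set_add_least[OF ll]) blast+
      qed
      finally have "len F Q (?W i) (carrier R) \<le> ?L + len F Q (?W (Suc i)) (carrier R)"
        by (simp add: add_left_mono)
      then have "len F Q A' (carrier R) \<le> enat i * ?L + (?L + len F Q (?W (Suc i)) (carrier R))"
        using Suc by (meson Suc_leD add_left_mono order_trans)
      then show ?case by (simp flip: eSuc_enat add: mult_eSuc add_ac)
    qed
    then have "len F Q A' (carrier R) \<le> \<rho> P * ?L + len F Q (?W r) (carrier R)" by (simp add: r)
    also have "len F Q (?W r) (carrier R) \<le> len F Q (A' <+>\<^bsub>R\<^esub> PIdl (c \<otimes> z)) (carrier R)"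
    proof (intro len_mono[OF Q _ order_refl] set_add_mono order_refl)
      show "PIdl (c \<otimes> z) \<subseteq> (\<lambda>x. x \<otimes> c) ` Fspan P u r"
      proof
        fix y assume "y \<in> PIdl (c \<otimes> z)"
        then obtain s where s: "s \<in> carrier R" "y = s \<otimes> (c \<otimes> z)" by (auto simp: cgenideal_def)
        then have "y = (z \<otimes> s) \<otimes> c" using c z(1) by (simp add: m_ac)
        then show "y \<in> (\<lambda>x. x \<otimes> c) ` Fspan P u r" using z(3)[OF s(1)] by blast
      qed
    qed
    finally show "\<rho> Q * len (\<lambda>r. r) Q A' (carrier R) \<le> \<rho> P * ?L +
        \<rho> Q * len (\<lambda>r. r) Q (A' <+>\<^bsub>R\<^esub> PIdl (c \<otimes> z)) (carrier R)"
      using len_F[OF Q A'] len_F[OF Q add_cgen_ideal[OF A', of "c \<otimes> z"]] c z(1)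
      by (simp add: add_left_mono)
  qed
qed

text \<open>Modulo \<open>P\<close> the full span \<open>W\<close> is free over the
  \<open>p\<close>-th powers, so \<open>W / F(y) W\<close> consists of \<rho> \<open>P\<close>
  copies of \<open>R/(P + yR)\<close>; the filtration \<open>?W\<close> bounds each copy from below.
  As \<open>F(y) z R\<close> lies in \<open>F(y) W\<close>, the total is at most the length of
  \<open>F_*(R/(P + F(y) z R))\<close>.\<close>

lemma \<rho>_len_le:
  assumes P: "primeideal P R"
  obtains z where "z \<in> carrier R" "z \<notin> P"
    "\<And>Q y. primeideal Q R \<Longrightarrow> y \<in> carrier R \<Longrightarrow> y \<notin> P \<Longrightarrow>
      \<rho> P * len (\<lambda>r. r) Q (P <+>\<^bsub>R\<^esub> PIdl y) (carrier R) \<le>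
        \<rho> Q * len (\<lambda>r. r) Q (P <+>\<^bsub>R\<^esub> PIdl (F y \<otimes> z)) (carrier R)"
proof -
  obtain r where r: "\<rho> P = enat r" using \<rho>_finite[OF P] by auto
  obtain u z where u: "\<And>i. i < r \<Longrightarrow> u i \<in> carrier R"
    and free: "\<And>i s. i < r \<Longrightarrow> s \<in> carrier R \<Longrightarrow> F s \<otimes> u i \<in> Fspan P u i \<Longrightarrow> s \<in> P"
    and z: "z \<in> carrier R" "z \<notin> P" "\<And>x. x \<in> carrier R \<Longrightarrow> z \<otimes> x \<in> Fspan P u r"
    using F_basis[OF P r] by metis
  have Pi: "ideal P R" using P by (rule primeideal.axioms(1))
  have Sl: "Fspan P u i \<in> lsub F" if "i \<le> r" for i using Fspan_lsub[OF Pi] u that by auto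
  have Sm: "Fspan P u i \<subseteq> Fspan P u k" if "i \<le> k" "k \<le> r" for i k using Fspan_mono[OF Pi _ that(1)] u that by auto
  show ?thesis
  proof (rule that[OF z(1,2)])
    fix Q y assume Q: "primeideal Q R" and y: "y \<in> carrier R" "y \<notin> P"
    let ?Y = "(\<lambda>x. x \<otimes> F y) ` Fspan P u r"
    let ?W = "\<lambda>i. Fspan P u i <+>\<^bsub>R\<^esub> ?Y"
    let ?E = "P <+>\<^bsub>R\<^esub> PIdl y"
    let ?L = "len (\<lambda>r. r) Q ?E (carrier R)"
    have Ei: "ideal ?E R" by (rule add_cgen_ideal[OF Pi y(1)])
    have Yl: "?Y \<in> lsub F"
      by (rule image_lsub[OF semilinear_mult[OF F_closed[OF y(1)] F_hom] F_hom Sl]) simp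
    have Wl: "?W i \<in> lsub F" if "i \<le> r" for i using set_add_lsub[OF F_hom Sl[OF that] Yl] .
    \<comment> \<open>The coefficients of \<open>w\<close> beyond \<open>u i\<close> are removed
      from the top down: if \<open>a\<close> is the last one, freeness puts \<open>y a\<close> into
      \<open>P\<close>, and \<open>y\<close> is outside \<open>P\<close>.\<close>
    have descend: "w \<in> Fspan P u (Suc i)"
      if "Suc i \<le> k" "k \<le> r" "w \<in> Fspan P u k" "w \<otimes> F y \<in> Fspan P u (Suc i)" for i k w
      using that
    proof (induction k arbitrary: w rule: dec_induct)
      case (step k)
      have uk: "u k \<in> carrier R" using u step.prems by simp
      from step.prems(2) obtain v a where va: "v \<in> Fspan P u k" "a \<in> carrier R" "w = v \<oplus> F a \<otimes> u k"
        by (rule Fspan_SucE)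
      have kl: "Fspan P u k \<in> lsub F" using Sl step.prems by simp
      have vc: "v \<in> carrier R" using lsubD(2)[OF kl va(1)] .
      have "v \<otimes> F y \<in> Fspan P u k"
        using lsubD(5)[OF kl y(1) va(1)] vc y(1) by (simp add: m_comm)
      moreover have "w \<otimes> F y \<in> Fspan P u k" using step.prems(3) Sm[of "Suc i" k] step by auto
      moreover have "w \<otimes> F y = v \<otimes> F y \<oplus> F (y \<otimes> a) \<otimes> u k"
        unfolding va(3) F_mult[OF y(1) va(2)]
        using vc uk F_closed[OF y(1)] F_closed[OF va(2)] by algebra
      ultimately have "F (y \<otimes> a) \<otimes> u k \<in> Fspan P u k"
        using lsub_cancel[OF F_hom kl, of "v \<otimes> F y" "F (y \<otimes> a) \<otimes> u k"] va uk y(1) by simp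
      then have "y \<otimes> a \<in> P" using free[of k "y \<otimes> a"] step.prems y(1) va by simp
      then have "a \<in> P" using primeideal.I_prime[OF P y(1) va(2)] y(2) by blast
      then have "F a \<otimes> u k \<in> P" using ideal.I_r_closed[OF Pi F_in_ideal[OF Pi] uk] by blast
      then have "F a \<otimes> u k \<in> Fspan P u k" using Sm[of 0 k] step.prems by auto
      then have "w \<in> Fspan P u k" using va lsubD(4)[OF kl] by simp
      then show ?case using step by simp
    qed
    \<comment> \<open>Comparison of coefficients at \<open>u i\<close>: if \<open>a\<close> is that
      of \<open>w\<close>, then \<open>s - a y\<close> lies in \<open>P\<close>, so \<open>s\<close>
      lies in \<open>P + yR\<close>. This is the kernel condition of
      \<open>len_push\<close>.\<close>
    have colon: "s \<in> ?E" if i: "i < r" and s: "s \<in> carrier R" "F s \<otimes> u i \<in> ?W i" for i s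
    proof -
      have ui: "u i \<in> carrier R" using u i .
      have il: "Fspan P u i \<in> lsub F" and sl: "Fspan P u (Suc i) \<in> lsub F"
        using Sl[of i] Sl[of "Suc i"] i by auto
      obtain v w where vw: "v \<in> Fspan P u i" "w \<in> Fspan P u r" "F s \<otimes> u i = v \<oplus> w \<otimes> F y"
        using s(2) by (auto simp: set_add_mem)
      have vc: "v \<in> carrier R" "w \<in> carrier R" using lsubD(2)[OF il vw(1)] lsubD(2)[OF Sl vw(2)] by auto
      have "F s \<otimes> u i \<in> Fspan P u (Suc i)"
        using set_add_upper(2)[OF il F_span_lsub[OF ui]] s(1) by auto
      then have "v \<oplus> w \<otimes> F y \<in> Fspan P u (Suc i)" by (simp only: vw(3))
      moreover have "v \<in> Fspan P u (Suc i)" using vw(1) Sm[of i "Suc i"] i by auto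
      ultimately have "w \<otimes> F y \<in> Fspan P u (Suc i)" 
        by (rule lsub_cancel[OF F_hom sl]) (use vc y(1) in simp)
      then have "w \<in> Fspan P u (Suc i)" by (rule descend[OF Suc_leI[OF i] order_refl vw(2)])
      then obtain w' a where wa: "w' \<in> Fspan P u i" "a \<in> carrier R" "w = w' \<oplus> F a \<otimes> u i" by (rule Fspan_SucE)
      have w'c: "w' \<in> carrier R" using lsubD(2)[OF il wa(1)] .
      let ?d = "s \<ominus> a \<otimes> y"
      have d: "?d \<in> carrier R" using s wa y by simp
      have se: "s = ?d \<oplus> a \<otimes> y" using s(1) wa(2) y(1) by algebra
      have "F s = F ?d \<oplus> F a \<otimes> F y" using arg_cong[OF se, of F] F_add[OF d, of "a \<otimes> y"] wa y(1) F_mult by simp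
      then have "F ?d \<otimes> u i \<oplus> F a \<otimes> F y \<otimes> u i = v \<oplus> (w' \<oplus> F a \<otimes> u i) \<otimes> F y"
        using vw(3) wa d y(1) ui by (simp add: l_distr)
      also have "\<dots> = (v \<oplus> F y \<otimes> w') \<oplus> F a \<otimes> F y \<otimes> u i"
        using vc w'c wa(2) ui y(1) F_closed[OF wa(2)] F_closed[OF y(1)] by algebra
      finally have "F ?d \<otimes> u i = v \<oplus> F y \<otimes> w'"
        using d wa(2) y(1) ui vc w'c by simp
      then have "F ?d \<otimes> u i \<in> Fspan P u i" using lsubD(4)[OF il vw(1) lsubD(5)[OF il y(1) wa(1)]] by simp
      then have "?d \<in> P" using free[OF i d] by blast
      then have "?d \<oplus> a \<otimes> y \<in> ?E" using add_cgen_memI wa(2) by blast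
      then show ?thesis using se by simp
    qed
    have "enat i * ?L \<le> len F Q (?W 0) (satur F Q (?W i))" if "i \<le> r" for i
      using that
    proof (induction i)
      case (Suc i)
      have ui: "u i \<in> carrier R" using u Suc.prems by simp
      have il: "Fspan P u i \<in> lsub F" using Sl Suc.prems by simp
      have m1: "?W 0 \<subseteq> ?W i" using Sm[of 0 i] Suc.prems by (intro set_add_mono) auto
      have m2: "?W i \<subseteq> ?W (Suc i)" using Sm[of i "Suc i"] Suc.prems by (intro set_add_mono) auto
      have up: "?W j \<subseteq> satur F Q (?W j)" if "j \<le> r" for j by (rule satur_upper[OF Q F_hom lsubD(1)[OF Wl[OF that]]])
      have ss: "satur F Q (?W j) \<in> ssub F Q" if "j \<le> r" for j by (rule satur_ssub[OF Q F_hom Wl[OF that]])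
      have "?L \<le> len F Q (?W i) (satur F Q (?W (Suc i)))"
      proof (rule len_push[OF Q id_hom F_hom semilinear_hom[OF ui F_hom] Wl carrier_lsub[OF id_hom] ss])
        show "?W i \<subseteq> satur F Q (?W (Suc i))" using m2 up[of "Suc i"] Suc.prems by auto
        have "(\<lambda>s. F s \<otimes> u i) ` carrier R \<subseteq> Fspan P u (Suc i)"
          using set_add_upper(2)[OF il F_span_lsub[OF ui]] by simp
        also have "\<dots> \<subseteq> ?W (Suc i)" using set_add_upper(1)[OF Sl[OF Suc.prems] Yl] .
        finally show "(\<lambda>s. F s \<otimes> u i) ` carrier R \<subseteq> satur F Q (?W (Suc i))"
          using up[of "Suc i"] Suc.prems by auto
        show "s \<in> satur (\<lambda>r. r) Q ?E" if "s \<in> carrier R" "F s \<otimes> u i \<in> ?W i" for s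
          using colon[of i s] that Suc.prems satur_upper[OF Q id_hom ideal_subset[OF Ei]] by auto
      qed (use Suc.prems in auto)
      also have "\<dots> = len F Q (satur F Q (?W i)) (satur F Q (?W (Suc i)))"
        using len_satur[OF Q F_hom lsubD(1)[OF Wl]] Suc.prems by simp
      finally have "enat i * ?L + ?L \<le> len F Q (?W 0) (satur F Q (?W i)) +
          len F Q (satur F Q (?W i)) (satur F Q (?W (Suc i)))"
        using Suc by (intro add_mono) auto
      also have "\<dots> = len F Q (?W 0) (satur F Q (?W (Suc i)))"
        using m1 up[of i] Suc.prems satur_mono[OF Q m2]
        by (intro len_add[OF Q F_hom ss ss, symmetric]) auto
      finally show ?case by (simp flip: eSuc_enat add: mult_eSuc add_ac)
    qed (simp add: zero_enat_def[symmetric])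
    then have "\<rho> P * ?L \<le> len F Q (?W 0) (satur F Q (?W r))" by (simp add: r)
    also have "\<dots> \<le> len F Q (P <+>\<^bsub>R\<^esub> PIdl (F y \<otimes> z)) (carrier R)"
    proof (rule len_mono[OF Q])
      have "PIdl (F y \<otimes> z) \<subseteq> ?Y"
      proof
        fix x assume "x \<in> PIdl (F y \<otimes> z)"
        then obtain s where s: "s \<in> carrier R" "x = s \<otimes> (F y \<otimes> z)" by (auto simp: cgenideal_def)
        then have "x = (z \<otimes> s) \<otimes> F y" using y z(1) by (simp add: m_ac)
        then show "x \<in> ?Y" using z(3)[OF s(1)] by blast
      qed
      then show "P <+>\<^bsub>R\<^esub> PIdl (F y \<otimes> z) \<subseteq> ?W 0" by (intro set_add_mono) auto
    qed (auto simp: satur_def)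
    also have "\<dots> = \<rho> Q * len (\<lambda>r. r) Q (P <+>\<^bsub>R\<^esub> PIdl (F y \<otimes> z)) (carrier R)"
      using len_F[OF Q add_cgen_ideal[OF Pi]] y z(1) by simp
    finally show "\<rho> P * ?L \<le> \<rho> Q * len (\<lambda>r. r) Q (P <+>\<^bsub>R\<^esub> PIdl (F y \<otimes> z)) (carrier R)" .
  qed
qed

end

section \<open>Residue degrees of adjacent primes\<close>

lemma nat_le_of_mult_le_add:
  fixes a b k :: nat
  assumes "\<And>n. a * n \<le> b * n + k" shows "a \<le> b"
proof (rule ccontr)
  assume "\<not> a \<le> b"
  then have "(b + 1) * (k + 1) \<le> a * (k + 1)" by (intro mult_right_mono) auto
  then show False using assms[of "k + 1"] by simp
qed

context F_finite_domain
begin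

text \<open>Both inequalities come from comparing lengths modulo \<open>x\<^sup>n\<close>, for \<open>x \<in> Q - P\<close>, as \<open>n\<close> grows: the
  main terms are linear in \<open>n\<close> and the error terms are bounded.\<close>

lemma \<rho>_adjacent:
  assumes P: "primeideal P R" and Q: "primeideal Q R" and PQ: "P \<subset> Q"
    and adj: "\<And>P'. primeideal P' R \<Longrightarrow> \<not> (P \<subset> P' \<and> P' \<subset> Q)"
  shows "\<rho> P = enat p * \<rho> Q"
proof -
  have Pi: "ideal P R" using P by (rule primeideal.axioms(1))
  let ?l = "\<lambda>w. len (\<lambda>r. r) Q (P <+>\<^bsub>R\<^esub> PIdl w) (carrier R)"
  \<comment> \<open>A prime between \<open>P + wR\<close> and \<open>Q\<close> contains
    \<open>P\<close> strictly, so by adjacency it equals \<open>Q\<close>; this is the minimality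
    that finiteness requires.\<close>
  have fin: "\<exists>k. ?l w = enat k" if w: "w \<in> carrier R" "w \<notin> P" for w
  proof -
    have "P' = Q" if P': "primeideal P' R" "P <+>\<^bsub>R\<^esub> PIdl w \<subseteq> P'" "P' \<subseteq> Q" for P'
      using adj[OF P'(1)] add_cgen_upper[OF Pi w(1)] w(2) P'(2,3) by blast
    then show ?thesis using len_finite[OF add_cgen_ideal[OF Pi w(1)] Q] by blast
  qed
  obtain x where x: "x \<in> Q" "x \<notin> P" using PQ by blast
  have xc: "x \<in> carrier R" using x(1) prime_mem[OF Q] by blast
  obtain a where a: "\<rho> P = enat a" using \<rho>_finite[OF P] by auto
  obtain b where b: "\<rho> Q = enat b" using \<rho>_finite[OF Q] by auto
  obtain l where l: "?l x = enat l" using fin[OF xc x(2)] by blast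
  have "1 \<le> ?l x"
  proof -
    let ?B = "satur (\<lambda>r. r) Q (P <+>\<^bsub>R\<^esub> PIdl x)"
    have Qi: "ideal Q R" using Q by (rule primeideal.axioms(1))
    have Bi: "ideal (P <+>\<^bsub>R\<^esub> PIdl x) R" by (rule add_cgen_ideal[OF Pi xc])
    have "?B \<subseteq> Q"
      using PQ cgenideal_minimal[OF Qi x(1)] set_add_least[OF ideal_lsub[OF Qi id_hom]]
      by (intro satur_least[OF Q prime_ssub[OF Q]]) auto
    then have "?B \<subset> carrier R" using prime_mem[OF Q] prime_one[OF Q] by blast
    then have "1 \<le> len (\<lambda>r. r) Q ?B (carrier R)"
      by (intro len_pos satur_ssub[OF Q id_hom ideal_lsub[OF Bi id_hom]] carrier_ssub id_hom)
    then show ?thesis using len_satur[OF Q id_hom ideal_subset[OF Bi]] by simp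
  qed
  then have l1: "1 \<le> l" using l by (simp add: one_enat_def)
  have pw: "?l (x [^] n) = enat (n * l)" for n :: nat using len_power[OF Q P xc x(2), of n] l by simp
  have xn: "x [^] n \<notin> P" for n :: nat
    by (induction n) (use prime_one[OF P] prime_mult[OF P] xc x(2) in auto)
  have Fx: "F (x [^] n) = x [^] (n * p)" for n :: nat using xc by (simp add: F_pow nat_pow_pow)
  have "b * p \<le> a"
  proof -
    obtain z where z: "z \<in> carrier R" "z \<notin> P"
      "\<And>Q A A' c. primeideal Q R \<Longrightarrow> ideal A' R \<Longrightarrow> P \<subseteq> A' \<Longrightarrow> c \<in> carrier R \<Longrightarrow> A \<subseteq> carrier R \<Longrightarrow>
      (\<And>s. s \<in> A \<Longrightarrow> c \<otimes> F s \<in> A') \<Longrightarrow>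
      \<rho> Q * len (\<lambda>r. r) Q A' (carrier R) \<le> \<rho> P * len (\<lambda>r. r) Q A (carrier R) +
        \<rho> Q * len (\<lambda>r. r) Q (A' <+>\<^bsub>R\<^esub> PIdl (c \<otimes> z)) (carrier R)"
      using len_F_le[OF P] by blast
    obtain k where k: "?l z = enat k" using fin[OF z(1,2)] by blast
    \<comment> \<open>The instance \<open>c = \<one>\<close> with \<open>x^n\<close> and
      \<open>F(x^n) = x^(np)\<close>. The error term is at most the length at \<open>z\<close>,
      which does not depend on \<open>n\<close>.\<close>
    have bound: "b * (n * p * l) \<le> a * (n * l) + b * k" for n
    proof -
      let ?A = "P <+>\<^bsub>R\<^esub> PIdl (x [^] n)" and ?A' = "P <+>\<^bsub>R\<^esub> PIdl (x [^] (n * p))"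
      have A: "ideal ?A R" and A': "ideal ?A' R" using add_cgen_ideal[OF Pi] xc by auto
      have "\<rho> Q * len (\<lambda>r. r) Q ?A' (carrier R) \<le> \<rho> P * len (\<lambda>r. r) Q ?A (carrier R) +
        \<rho> Q * len (\<lambda>r. r) Q (?A' <+>\<^bsub>R\<^esub> PIdl (\<one> \<otimes> z)) (carrier R)"
      proof (rule z(3)[OF Q A' _ one_closed ideal_subset[OF A]])
        show "P \<subseteq> ?A'" using add_cgen_upper(1)[OF Pi, of "x [^] (n * p)"] xc by simp
        fix s assume "s \<in> ?A"
        then obtain v t where vt: "v \<in> P" "t \<in> carrier R" "s = v \<oplus> t \<otimes> x [^] n" by (rule add_cgen_memE)
        have vc: "v \<in> carrier R" using prime_mem[OF P vt(1)] .
        have "F s = F v \<oplus> F t \<otimes> x [^] (n * p)" using vt vc xc by (simp add: F_add F_mult Fx)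
        then show "\<one> \<otimes> F s \<in> ?A'" using add_cgen_memI[OF F_in_ideal[OF Pi vt(1)] F_closed[OF vt(2)]] vc vt(2) xc
          by simp
      qed
      also have "len (\<lambda>r. r) Q (?A' <+>\<^bsub>R\<^esub> PIdl (\<one> \<otimes> z)) (carrier R) \<le> ?l z"
        using z(1) add_cgen_upper(1)[OF Pi, of "x [^] (n * p)"] xc
        by (intro len_mono[OF Q] set_add_mono) auto
      finally show ?thesis using pw a b k by (simp add: add_left_mono mult_left_mono)
    qed
    have "b * p * l * n \<le> a * l * n + b * k" for n using bound[of n] by (simp add: mult_ac)
    then have "b * p * l \<le> a * l" by (rule nat_le_of_mult_le_add)
    then show ?thesis using l1 by simp
  qed
  moreover have "a \<le> b * p"
  proof -
    obtain z where z: "z \<in> carrier R" "z \<notin> P"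
      "\<And>Q y. primeideal Q R \<Longrightarrow> y \<in> carrier R \<Longrightarrow> y \<notin> P \<Longrightarrow>
        \<rho> P * len (\<lambda>r. r) Q (P <+>\<^bsub>R\<^esub> PIdl y) (carrier R) \<le>
        \<rho> Q * len (\<lambda>r. r) Q (P <+>\<^bsub>R\<^esub> PIdl (F y \<otimes> z)) (carrier R)"
      using \<rho>_len_le[OF P] by blast
    obtain k where k: "?l z = enat k" using fin[OF z(1,2)] by blast
    \<comment> \<open>The instance \<open>y = x^n\<close>. Lengths modulo \<open>P\<close> are
      additive in products, so the factor \<open>z\<close> adds only a constant.\<close>
    have "a * l * n \<le> b * p * l * n + b * k" for n
    proof -
      have "\<rho> P * ?l (x [^] n) \<le> \<rho> Q * ?l (x [^] (n * p) \<otimes> z)"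
        using z(3)[OF Q, of "x [^] n"] xc xn by (simp add: Fx)
      also have "?l (x [^] (n * p) \<otimes> z) = ?l (x [^] (n * p)) + ?l z"
        using len_mult[OF Q P _ xn z(1)] xc by simp
      finally show ?thesis using pw a b k by (simp add: algebra_simps)
    qed
    then have "a * l \<le> b * p * l" by (rule nat_le_of_mult_le_add)
    then show ?thesis using l1 by simp
  qed
  ultimately show ?thesis using a b by (simp add: mult.commute)
qed

end

lemma (in noetherian_domain) exists_maximal:
  assumes "ideal A R" "\<one> \<notin> A" shows "\<exists>M. maximalideal M R \<and> A \<subseteq> M"
  using assms
proof (induction rule: ideal_induct)
  case (ideal A)
  show ?case
  proof (cases "\<exists>B. ideal B R \<and> A \<subset> B \<and> \<one> \<notin> B")
    case True
    then show ?thesis using ideal(2) by blast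
  next
    case False
    have "maximalideal A R"
    proof (rule maximalidealI[OF ideal(1)])
      show "carrier R \<noteq> A" using ideal(3) by auto
      fix J assume "ideal J R" "A \<subseteq> J" "J \<subseteq> carrier R"
      then show "J = A \<or> J = carrier R" using False ideal.one_imp_carrier by blast
    qed
    then show ?thesis by blast
  qed
qed

section \<open>Growth of colengths\<close>

locale F_finite_local_domain = F_finite_domain R p for R (structure) and p +
  fixes \<mm> :: "'a set" and d :: nat
  assumes local: "local_ring R \<mm>" and dim: "krull_dim R = enat d"
begin

lemma mm_prime: "primeideal \<mm> R"
  using local maximalideal_prime by (simp add: local_ring_def)

lemma prime_le_mm: assumes P: "primeideal P R" shows "P \<subseteq> \<mm>"
  using exists_maximal[OF primeideal.axioms(1)[OF P] prime_one[OF P]] local by (auto simp: local_ring_def)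

text \<open>The dimension of \<open>R/P\<close>.\<close>

definition coht :: "'a set \<Rightarrow> enat" where
  "coht P = chain_sup {P'. primeideal P' R \<and> P \<subseteq> P'}"

lemma coht_finite: "coht P \<noteq> \<infinity>"
proof -
  have "coht P \<le> krull_dim R" unfolding coht_def krull_dim_def by (rule chain_sup_mono) auto
  then show ?thesis using dim by (metis infinity_ileE)
qed

lemma coht_zero: "coht {\<zero>} = enat d"
proof -
  have "{P'. primeideal P' R \<and> {\<zero>} \<subseteq> P'} = {P'. primeideal P' R}"
    using additive_subgroup.zero_closed[OF ideal.axioms(1)[OF primeideal.axioms(1)]] by auto
  then show ?thesis using dim by (simp add: coht_def krull_dim_def)
qed

lemma coht_less:
  assumes P: "primeideal P R" and P': "primeideal P' R" and "P \<subset> P'"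
  shows "coht P' < coht P"
proof -
  obtain n where n: "coht P' = enat n" using coht_finite by auto
  let ?F = "\<lambda>P. {P'. primeideal P' R \<and> P \<subseteq> P'}"
  obtain f where f: "set_chain (?F P') n f"
    using chain_sup_attained[OF n[unfolded coht_def]] P' by blast
  have "set_chain (?F P) (Suc n) (\<lambda>i. if i = 0 then P else f (i - 1))"
    unfolding set_chain_def
  proof (intro conjI allI impI)
    fix i assume "i \<le> Suc n"
    then show "(if i = 0 then P else f (i - 1)) \<in> ?F P" using f assms by (cases i) (auto simp: set_chain_def)
  next
    fix i assume "i < Suc n"
    then show "(if i = 0 then P else f (i - 1)) \<subset> (if Suc i = 0 then P else f (Suc i - 1))"
      using f assms(3) by (cases i) (auto simp: set_chain_def)
  qed
  then have "enat (Suc n) \<le> coht P" unfolding coht_def by (rule chain_sup_ge)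
  then show ?thesis using n by (simp add: Suc_ile_eq)
qed

text \<open>\<open>Q\<close> is the second member of a longest chain of primes from
  \<open>P\<close>: the rest of that chain bounds its coheight from below, and
  \<open>P \<subset> Q\<close> bounds it from above.\<close>

lemma coht_Suc:
  assumes P: "primeideal P R" and k: "coht P = enat (Suc k)"
  obtains Q where "primeideal Q R" "P \<subset> Q" "coht Q = enat k"
    "\<And>P'. primeideal P' R \<Longrightarrow> \<not> (P \<subset> P' \<and> P' \<subset> Q)"
proof -
  let ?F = "\<lambda>P. {P'. primeideal P' R \<and> P \<subseteq> P'}"
  note n = k[unfolded coht_def]
  obtain f where f: "set_chain (?F P) (Suc k) f" using chain_sup_attained[OF n] P by blast
  have f0: "f 0 = P"
    using set_chain_maximal(1)[OF n f, of P] P f by (auto simp: set_chain_def)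
  have f1: "primeideal (f 1) R" "P \<subset> f 1" using f f0 by (auto simp: set_chain_def)
  have adj: "\<not> (P \<subset> P' \<and> P' \<subset> f 1)" if "primeideal P' R" for P'
    using set_chain_maximal(3)[OF n f, of P' 0] that f0 by auto
  have "set_chain (?F (f 1)) k (\<lambda>i. f (Suc i))"
    using f set_chain_mono[OF f, of 1] by (auto simp: set_chain_def)
  then have "enat k \<le> coht (f 1)" unfolding coht_def by (rule chain_sup_ge)
  moreover have "coht (f 1) < enat (Suc k)" using coht_less[OF P f1] k by simp
  then have "coht (f 1) \<le> enat k" by (metis eSuc_enat iless_Suc_eq enat_iless enat_ord_simps(1))
  ultimately show ?thesis using that[OF f1] adj by simp
qed

lemma \<rho>_coht:
  assumes "primeideal P R" "coht P = enat k" shows "\<rho> P = enat (p ^ k) * \<rho> \<mm>"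
  using assms
proof (induction k arbitrary: P)
  case 0
  have "P = \<mm>" using prime_le_mm[OF 0(1)] coht_less[OF 0(1) mm_prime] 0(2)
    by (auto simp: zero_enat_def[symmetric])
  moreover have "enat (p ^ 0) = 1" by (simp add: one_enat_def)
  ultimately show ?case by (metis mult_1)
next
  case (Suc k)
  obtain Q where Q: "primeideal Q R" "P \<subset> Q" "coht Q = enat k"
    "\<And>P'. primeideal P' R \<Longrightarrow> \<not> (P \<subset> P' \<and> P' \<subset> Q)" using coht_Suc[OF Suc.prems] by blast
  have "\<rho> P = enat p * \<rho> Q" using \<rho>_adjacent[OF Suc.prems(1) Q(1,2,4)] by blast
  also have "\<rho> Q = enat (p ^ k) * \<rho> \<mm>" by (rule Suc.IH[OF Q(1,3)])
  finally show ?case by (simp flip: mult.assoc)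
qed

text \<open>Ideals are already saturated at \<mm> (\<open>ideal_mm_ssub\<close>), so for an ideal
  this is the colength \<open>l_R(R/A)\<close>; see \<open>module_length_quot\<close>.\<close>

definition L :: "'a set \<Rightarrow> enat" where "L A = len (\<lambda>r. r) \<mm> A (carrier R)"

definition M :: "nat \<Rightarrow> 'a set" where "M n = frob_power R \<mm> (p ^ n)"

lemma frob_power_ideal: "ideal A R \<Longrightarrow> ideal (frob_power R A q) R"
  unfolding frob_power_def using ideal_subset by (intro genideal_ideal) auto

lemma frob_power_mem: "ideal A R \<Longrightarrow> x \<in> A \<Longrightarrow> x [^] q \<in> frob_power R A q"
  unfolding frob_power_def using ideal_subset by (intro subsetD[OF genideal_self]) auto

lemma frob_power_least:
  assumes "ideal B R" "\<And>x. x \<in> A \<Longrightarrow> x [^] q \<in> B" shows "frob_power R A q \<subseteq> B"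
  unfolding frob_power_def using assms by (intro genideal_minimal) auto

lemma mm_ideal: "ideal \<mm> R" using mm_prime by (rule primeideal.axioms(1))

lemma M_ideal: "ideal (M n) R" unfolding M_def by (rule frob_power_ideal[OF mm_ideal])

text \<open>\<open>F\<close> is a ring homomorphism, so the elements that it carries into
  \<open>M (Suc n)\<close> form an ideal, and testing the generators of \<open>M n\<close> is
  enough.\<close>

lemma F_M: assumes "x \<in> M n" shows "F x \<in> M (Suc n)"
proof -
  let ?B = "{x \<in> carrier R. F x \<in> M (Suc n)}"
  have "semilinear (\<lambda>r. r) F F" by (simp add: semilinear_def F_add F_mult)
  then have "ideal ?B R"
    unfolding ideal_iff_lsub by (rule vimage_lsub[OF _ id_hom ideal_lsub[OF M_ideal F_hom]])
  moreover have "x [^] (p ^ n) \<in> ?B" if "x \<in> \<mm>" for x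
  proof -
    have xc: "x \<in> carrier R" using prime_mem[OF mm_prime that] .
    then have "F (x [^] (p ^ n)) = x [^] (p ^ Suc n)" by (simp add: F_pow nat_pow_pow mult.commute)
    then show ?thesis using frob_power_mem[OF mm_ideal that, of "p ^ Suc n"] xc by (simp add: M_def)
  qed
  ultimately have "M n \<subseteq> ?B" unfolding M_def by (rule frob_power_least)
  then show ?thesis using assms by auto
qed

lemma L_mono: "A \<subseteq> B \<Longrightarrow> L B \<le> L A"
  unfolding L_def by (rule len_mono[OF mm_prime]) auto

lemma L_finite:
  assumes A: "ideal A R" and "M n \<subseteq> A" shows "L A \<noteq> \<infinity>"
  unfolding L_def
proof (rule len_finite[OF A mm_prime])
  fix P assume P: "primeideal P R" "A \<subseteq> P" "P \<subseteq> \<mm>"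
  have "x \<in> P" if x: "x \<in> \<mm>" for x
  proof -
    have xc: "x \<in> carrier R" using prime_mem[OF mm_prime x] .
    have "x [^] (p ^ n) \<in> P" using frob_power_mem[OF mm_ideal x] assms(2) P(2) by (auto simp: M_def)
    moreover have "x [^] k \<in> P \<Longrightarrow> x \<in> P" for k :: nat
      by (induction k) (use prime_one[OF P(1)] primeideal.I_prime[OF P(1) _ xc, of "x [^] _"] xc in auto)
    ultimately show ?thesis by blast
  qed
  then show "P = \<mm>" using P(3) by blast
qed

lemma L_one: "ideal A R \<Longrightarrow> \<one> \<in> A \<Longrightarrow> L A = 0"
  unfolding L_def by (rule len_zero[OF id_hom])

lemma sum_ideal_upper:
  assumes "ideal A R" "ideal B R"
  shows "ideal (A <+>\<^bsub>R\<^esub> B) R" "A \<subseteq> A <+>\<^bsub>R\<^esub> B" "B \<subseteq> A <+>\<^bsub>R\<^esub> B"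
  using add_ideals[OF assms] set_add_upper[OF ideal_lsub[OF assms(1) id_hom] ideal_lsub[OF assms(2) id_hom]] by auto

lemma sum_ideal_least: "ideal C R \<Longrightarrow> A \<subseteq> C \<Longrightarrow> B \<subseteq> C \<Longrightarrow> A <+>\<^bsub>R\<^esub> B \<subseteq> C"
  using set_add_least ideal_iff_lsub by blast

end

text \<open>Up to the factor \<open>B^n\<close> the increments are at most
  \<open>C / p^n \<le> C / 2^n\<close>, and these sum to at most \<open>C\<close>.\<close>

lemma geometric_growth:
  fixes a :: "nat \<Rightarrow> real"
  assumes step: "\<And>n. a (Suc n) \<le> B * a n + C * (B / p) ^ Suc n" and B: "B \<ge> 0" and p: "p \<ge> 2" and C: "C \<ge> 0"
  shows "a n \<le> (a 0 + C) * B ^ n"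
proof -
  \<comment> \<open>The induction carries the partial sum
    \<open>1/2 + ... + (1/2)^n = 1 - (1/2)^n\<close>.\<close>
  have *: "a n \<le> (a 0 + C * (1 - (1/2) ^ n)) * B ^ n" for n
  proof (induction n)
    case (Suc n)
    have "(B / p) ^ Suc n \<le> (B / 2) ^ Suc n"
      using B p by (intro power_mono divide_left_mono) auto
    then have "C * (B / p) ^ Suc n \<le> C * ((1/2) ^ Suc n * B ^ Suc n)"
      using C by (intro mult_left_mono) (auto simp: power_divide)
    then have "a (Suc n) \<le> B * ((a 0 + C * (1 - (1/2) ^ n)) * B ^ n) + C * ((1/2) ^ Suc n * B ^ Suc n)"
      using step[of n] mult_left_mono[OF Suc B] by linarith
    also have "\<dots> = (a 0 + C * (1 - (1/2) ^ Suc n)) * B ^ Suc n" by (simp add: algebra_simps)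
    finally show ?case .
  qed simp
  note *[of n]
  also have "(a 0 + C * (1 - (1/2) ^ n)) * B ^ n \<le> (a 0 + C) * B ^ n"
    using B C by (intro mult_right_mono) (auto simp: algebra_simps)
  finally show ?thesis .
qed

context F_finite_local_domain
begin

text \<open>The base is written \<open>p\<^sup>K / p\<close> because \<open>K = 0\<close> occurs: it forces \<open>A = R\<close>.\<close>

lemma L_growth:
  assumes "ideal A R" "\<And>P. primeideal P R \<Longrightarrow> A \<subseteq> P \<Longrightarrow> coht P < enat K"
  shows "\<exists>C\<ge>0. \<forall>n. real (the_enat (L (A <+>\<^bsub>R\<^esub> M n))) \<le> C * (real p ^ K / p) ^ n"
  using assms
proof (induction arbitrary: K rule: ideal_induct)
  case (ideal A)
  note A = ideal(1)
  have AM: "ideal (A <+>\<^bsub>R\<^esub> M n) R" "A \<subseteq> A <+>\<^bsub>R\<^esub> M n" "M n \<subseteq> A <+>\<^bsub>R\<^esub> M n" for n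
    using sum_ideal_upper[OF A M_ideal] by auto
  show ?case
  proof (cases "\<one> \<in> A")
    case True
    then have "L (A <+>\<^bsub>R\<^esub> M n) = 0" for n using L_one AM by blast
    then show ?thesis by (intro exI[of _ 0]) (simp add: zero_enat_def)
  next
    case one: False
    show ?thesis
    proof (cases "primeideal A R")
      \<comment> \<open>With \<open>k\<close> the dimension of \<open>R/A\<close>, the comparison of
        \<open>A + M n\<close> with \<open>A + M (Suc n)\<close> has leading factor
        \<open>\<rho> A / \<rho> \<mm> = p^k\<close>, and its error is the colength of
        \<open>A + zR + M (Suc n)\<close>. Primes above \<open>A + zR\<close> have coheight below
        \<open>k\<close>, so the induction hypothesis applies with \<open>k\<close> in place of
        \<open>K\<close>.\<close>
      case P: True
      obtain k where k: "coht A = enat k" using coht_finite by auto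
      have kK: "k < K" using ideal(3)[OF P] k by simp
      obtain z where z: "z \<in> carrier R" "z \<notin> A"
        "\<And>Q B B' c. primeideal Q R \<Longrightarrow> ideal B' R \<Longrightarrow> A \<subseteq> B' \<Longrightarrow> c \<in> carrier R \<Longrightarrow> B \<subseteq> carrier R \<Longrightarrow>
          (\<And>s. s \<in> B \<Longrightarrow> c \<otimes> F s \<in> B') \<Longrightarrow>
          \<rho> Q * len (\<lambda>r. r) Q B' (carrier R) \<le> \<rho> A * len (\<lambda>r. r) Q B (carrier R) +
            \<rho> Q * len (\<lambda>r. r) Q (B' <+>\<^bsub>R\<^esub> PIdl (c \<otimes> z)) (carrier R)"
        using len_F_le[OF P] by blast
      let ?Z = "A <+>\<^bsub>R\<^esub> PIdl z"
      have Z: "ideal ?Z R" "A \<subset> ?Z"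
        using add_cgen_ideal[OF A z(1)] add_cgen_upper[OF A z(1)] z(2) by auto
      have "coht P' < enat k" if "primeideal P' R" "?Z \<subseteq> P'" for P'
        using coht_less[OF P that(1)] Z(2) that(2) k by auto
      then obtain C where C: "C \<ge> 0" "\<And>n. real (the_enat (L (?Z <+>\<^bsub>R\<^esub> M n))) \<le> C * (real p ^ k / p) ^ n"
        using ideal(2)[OF Z] by blast
      let ?a = "\<lambda>n. real (the_enat (L (A <+>\<^bsub>R\<^esub> M n)))"
      obtain e where e: "\<rho> \<mm> = enat e" "1 \<le> e"
        using \<rho>_finite[OF mm_prime] \<rho>_ge_1[OF mm_prime] by (auto simp: one_enat_def)
      have "?a (Suc n) \<le> real p ^ k * ?a n + C * (real p ^ k / p) ^ Suc n" for n
      proof -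
        let ?B = "A <+>\<^bsub>R\<^esub> M n" and ?B' = "A <+>\<^bsub>R\<^esub> M (Suc n)"
        have "\<rho> \<mm> * L ?B' \<le> \<rho> A * L ?B + \<rho> \<mm> * L (?B' <+>\<^bsub>R\<^esub> PIdl (\<one> \<otimes> z))"
          unfolding L_def
        proof (rule z(3)[OF mm_prime AM(1) AM(2) one_closed ideal_subset[OF AM(1)]])
          fix s assume "s \<in> ?B"
          then obtain a b where ab: "a \<in> A" "b \<in> M n" "s = a \<oplus> b" by (auto simp: set_add_mem)
          have c: "a \<in> carrier R" "b \<in> carrier R" using ab ideal.Icarr[OF A] ideal.Icarr[OF M_ideal] by auto
          have "F s = F a \<oplus> F b" using ab c F_add by simp
          then show "\<one> \<otimes> F s \<in> ?B'"
            using F_in_ideal[OF A ab(1)] F_M[OF ab(2)] c by (auto simp: set_add_mem)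
        qed
        also have "L (?B' <+>\<^bsub>R\<^esub> PIdl (\<one> \<otimes> z)) \<le> L (?Z <+>\<^bsub>R\<^esub> M (Suc n))"
        proof -
          have "ideal (?B' <+>\<^bsub>R\<^esub> PIdl (\<one> \<otimes> z)) R" using add_cgen_ideal[OF AM(1)] z(1) by simp
          note least = sum_ideal_least[OF this]
          show ?thesis
          proof (intro L_mono least)
          show "A \<subseteq> ?B' <+>\<^bsub>R\<^esub> PIdl (\<one> \<otimes> z)" "M (Suc n) \<subseteq> ?B' <+>\<^bsub>R\<^esub> PIdl (\<one> \<otimes> z)"
            using AM(2,3)[of "Suc n"] add_cgen_upper(1)[OF AM(1), of "\<one> \<otimes> z" "Suc n"] z(1) by auto
          show "PIdl z \<subseteq> ?B' <+>\<^bsub>R\<^esub> PIdl (\<one> \<otimes> z)"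
            using sum_ideal_upper(3)[OF AM(1) cgenideal_ideal[OF z(1)]] z(1) by simp
          qed
        qed
        finally have le: "\<rho> \<mm> * L ?B' \<le> \<rho> A * L ?B + \<rho> \<mm> * L (?Z <+>\<^bsub>R\<^esub> M (Suc n))"
          by (simp add: add_left_mono mult_left_mono)
        obtain x where x: "L ?B = enat x" using L_finite[OF AM(1,3)] by auto
        obtain y where y: "L ?B' = enat y" using L_finite[OF AM(1,3)] by auto
        obtain w where w: "L (?Z <+>\<^bsub>R\<^esub> M (Suc n)) = enat w"
          using L_finite[OF sum_ideal_upper(1,3)[OF Z(1) M_ideal]] by auto
        have "e * y \<le> p ^ k * e * x + e * w" using le x y w e \<rho>_coht[OF P k] by simp
        then have "e * y \<le> e * (p ^ k * x + w)" by (simp add: algebra_simps)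
        then have "y \<le> p ^ k * x + w" using e(2) by simp
        then have "real y \<le> real p ^ k * real x + real w"
          by (metis of_nat_add of_nat_le_iff of_nat_mult of_nat_power)
        then show ?thesis using C(2)[of "Suc n"] x y w by simp
      qed
      then have g: "?a n \<le> (?a 0 + C) * (real p ^ k) ^ n" for n
        by (rule geometric_growth) (use p_ge_2 C(1) in auto)
      have "real p ^ k \<le> real p ^ K / p"
      proof -
        have "real p ^ Suc k \<le> real p ^ K" using kK p_ge_2 by (intro power_increasing) auto
        then show ?thesis using p_ge_2 by (simp add: field_simps)
      qed
      then have "(?a 0 + C) * (real p ^ k) ^ n \<le> (?a 0 + C) * (real p ^ K / p) ^ n" for n
        using C(1) by (intro mult_left_mono power_mono) auto
      then show ?thesis using g C(1) order_trans by (intro exI[of _ "?a 0 + C"]) fastforce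
    next
      case False
      then obtain x y where xy: "x \<in> carrier R" "y \<in> carrier R" "x \<notin> A" "y \<notin> A" "x \<otimes> y \<in> A"
        using not_prime_witness[OF A one] by blast
      let ?B = "{r \<in> carrier R. r \<otimes> x \<in> A}" and ?C = "A <+>\<^bsub>R\<^esub> PIdl x"
      have B: "ideal ?B R" "A \<subset> ?B"
        using colon_ideal[OF A xy(1)] ideal.Icarr[OF A] ideal.I_r_closed[OF A] xy
        by (auto simp: m_comm)
      have C: "ideal ?C R" "A \<subset> ?C"
        using add_cgen_ideal[OF A xy(1)] add_cgen_upper[OF A xy(1)] xy by auto
      obtain c1 where c1: "c1 \<ge> 0" "\<And>n. real (the_enat (L (?B <+>\<^bsub>R\<^esub> M n))) \<le> c1 * (real p ^ K / p) ^ n"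
        using ideal(2)[OF B, of K] ideal(3) B(2) by (meson psubset_imp_subset subset_trans)
      obtain c2 where c2: "c2 \<ge> 0" "\<And>n. real (the_enat (L (?C <+>\<^bsub>R\<^esub> M n))) \<le> c2 * (real p ^ K / p) ^ n"
        using ideal(2)[OF C, of K] ideal(3) C(2) by (meson psubset_imp_subset subset_trans)
      \<comment> \<open>The quotient is split along \<open>x\<close>. The colon ideal of
        \<open>A + M n\<close> by \<open>x\<close> contains \<open>(A : x) + M n\<close>, so both
        parts are controlled by ideals strictly larger than \<open>A\<close>.\<close>
      have "real (the_enat (L (A <+>\<^bsub>R\<^esub> M n))) \<le> (c1 + c2) * (real p ^ K / p) ^ n" for n
      proof -
        have "L (A <+>\<^bsub>R\<^esub> M n) \<le> L {r \<in> carrier R. r \<otimes> x \<in> A <+>\<^bsub>R\<^esub> M n} + L (A <+>\<^bsub>R\<^esub> M n <+>\<^bsub>R\<^esub> PIdl x)"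
          unfolding L_def by (rule len_split[OF mm_prime AM(1) xy(1)])
        also have "L {r \<in> carrier R. r \<otimes> x \<in> A <+>\<^bsub>R\<^esub> M n} \<le> L (?B <+>\<^bsub>R\<^esub> M n)"
          using AM(2,3)[of n] ideal.I_r_closed[OF M_ideal[of n] _ xy(1)] ideal.Icarr[OF M_ideal[of n]]
          by (intro L_mono sum_ideal_least[OF colon_ideal[OF AM(1) xy(1)]]) auto
        also have "L (A <+>\<^bsub>R\<^esub> M n <+>\<^bsub>R\<^esub> PIdl x) \<le> L (?C <+>\<^bsub>R\<^esub> M n)"
        proof (intro L_mono sum_ideal_least[OF add_cgen_ideal[OF AM(1) xy(1)]])
          show "A \<subseteq> A <+>\<^bsub>R\<^esub> M n <+>\<^bsub>R\<^esub> PIdl x" "M n \<subseteq> A <+>\<^bsub>R\<^esub> M n <+>\<^bsub>R\<^esub> PIdl x"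
            using AM(2,3)[of n] add_cgen_upper(1)[OF AM(1) xy(1), of n] by auto
          show "PIdl x \<subseteq> A <+>\<^bsub>R\<^esub> M n <+>\<^bsub>R\<^esub> PIdl x"
            by (rule sum_ideal_upper(3)[OF AM(1) cgenideal_ideal[OF xy(1)]])
        qed
        finally have le: "L (A <+>\<^bsub>R\<^esub> M n) \<le> L (?B <+>\<^bsub>R\<^esub> M n) + L (?C <+>\<^bsub>R\<^esub> M n)"
          by (simp add: add_left_mono add_right_mono)
        obtain u where u: "L (?B <+>\<^bsub>R\<^esub> M n) = enat u"
          using L_finite[OF sum_ideal_upper(1,3)[OF B(1) M_ideal]] by auto
        obtain v where v: "L (?C <+>\<^bsub>R\<^esub> M n) = enat v"
          using L_finite[OF sum_ideal_upper(1,3)[OF C(1) M_ideal]] by auto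
        obtain w where w: "L (A <+>\<^bsub>R\<^esub> M n) = enat w" using L_finite[OF AM(1,3)] by auto
        have "real w \<le> real u + real v" using le u v w by simp
        then show ?thesis using c1(2)[of n] c2(2)[of n] u v w by (simp add: distrib_right)
      qed
      then show ?thesis using c1(1) c2(1) by (intro exI[of _ "c1 + c2"]) auto
    qed
  qed
qed

end

section \<open>Comparison through a Frobenius-linear map\<close>

text \<open>The tails are dominated by a geometric series of ratio \<open>1/p \<le> 1/2\<close>; the
  factor 2 is the sum of the powers of 1/2.\<close>

lemma geometric_limit:
  fixes b :: "nat \<Rightarrow> real"
  assumes step: "\<And>n. \<bar>b (Suc n) - b n\<bar> \<le> C / p ^ n" and p: "p \<ge> 2" and C: "C \<ge> 0"
  shows "b \<longlonglongrightarrow> lim b" and "\<bar>b n - lim b\<bar> \<le> 2 * C / p ^ n"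
proof -
  have diff: "\<bar>b (n + k) - b n\<bar> \<le> 2 * C / p ^ n * (1 - (1/2) ^ k)" for n k
  proof (induction k)
    case (Suc k)
    have "C / p ^ (n + k) = C / p ^ n * (1 / p) ^ k" by (simp add: power_add power_divide)
    also have "\<dots> \<le> C / p ^ n * (1 / 2) ^ k"
      using p C by (intro mult_left_mono power_mono) (auto simp: field_simps)
    finally have "\<bar>b (n + Suc k) - b (n + k)\<bar> \<le> C / p ^ n * (1/2) ^ k"
      using step[of "n + k"] by simp
    then have "\<bar>b (n + Suc k) - b n\<bar> \<le> C / p ^ n * (1/2) ^ k + 2 * C / p ^ n * (1 - (1/2) ^ k)"
      using Suc by linarith
    also have "\<dots> = 2 * C / p ^ n * (1 - (1/2) ^ Suc k)" using p by (simp add: field_simps)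
    finally show ?case .
  qed simp
  have bound: "\<bar>b m - b n\<bar> \<le> 2 * C / p ^ n" if "n \<le> m" for m n
  proof -
    have "2 * C / p ^ n * (1 - (1/2) ^ (m - n)) \<le> 2 * C / p ^ n * 1"
      using p C by (intro mult_left_mono) auto
    then show ?thesis using diff[of n "m - n"] that by simp
  qed
  have "(\<lambda>n. 2 * C * (1 / p) ^ n) \<longlonglongrightarrow> 2 * C * 0"
    using p by (intro tendsto_mult tendsto_const LIMSEQ_realpow_zero) auto
  then have lim0: "(\<lambda>n. 2 * C / p ^ n) \<longlonglongrightarrow> 0" by (simp add: power_divide)
  have "Cauchy b"
  proof (rule metric_CauchyI)
    fix e :: real assume "e > 0"
    then obtain N where N: "\<And>n. n \<ge> N \<Longrightarrow> \<bar>2 * C / p ^ n\<bar> < e / 2"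
      using LIMSEQ_D[OF lim0, of "e / 2"] by auto
    have "dist (b m) (b n) < e" if "m \<ge> N" "n \<ge> N" for m n
    proof -
      have "2 * C / p ^ N < e / 2" using N[OF order_refl] abs_ge_self[of "2 * C / p ^ N"] by linarith
      then show ?thesis using bound[OF that(1)] bound[OF that(2)] unfolding dist_real_def by linarith
    qed
    then show "\<exists>N. \<forall>m\<ge>N. \<forall>n\<ge>N. dist (b m) (b n) < e" by blast
  qed
  then show l: "b \<longlonglongrightarrow> lim b" by (simp add: Cauchy_convergent_iff convergent_LIMSEQ_iff)
  have "(\<lambda>m. \<bar>b m - b n\<bar>) \<longlonglongrightarrow> \<bar>lim b - b n\<bar>" using l by (intro tendsto_intros)
  then have "\<bar>lim b - b n\<bar> \<le> 2 * C / p ^ n"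
    by (rule LIMSEQ_le_const2) (use bound in blast)
  then show "\<bar>b n - lim b\<bar> \<le> 2 * C / p ^ n" by (simp add: abs_minus_commute)
qed

context F_finite_local_domain
begin

text \<open>Elements outside \<mm> are units, since a non-unit lies in some maximal ideal.\<close>

lemma ideal_mm_ssub: assumes A: "ideal A R" shows "A \<in> ssub (\<lambda>r. r) \<mm>"
proof (rule ssubI[OF ideal_lsub[OF A id_hom]])
  fix t x assume t: "t \<in> carrier R" "t \<notin> \<mm>" and x: "x \<in> carrier R" "t \<otimes> x \<in> A"
  have "\<one> \<in> PIdl t"
  proof (rule ccontr)
    assume "\<one> \<notin> PIdl t"
    then obtain N where "maximalideal N R" "PIdl t \<subseteq> N"
      using exists_maximal[OF cgenideal_ideal[OF t(1)]] by blast
    then have "PIdl t \<subseteq> \<mm>" using local by (auto simp: local_ring_def)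
    then show False using cgenideal_self[OF t(1)] t(2) by blast
  qed
  then obtain s where s: "s \<in> carrier R" "\<one> = s \<otimes> t" by (auto simp: cgenideal_def)
  have "s \<otimes> (t \<otimes> x) = (s \<otimes> t) \<otimes> x" using s(1) t(1) x(1) by (simp add: m_assoc)
  then have "s \<otimes> (t \<otimes> x) = x" using x(1) by (simp add: s(2)[symmetric])
  then show "x \<in> A" using ideal.I_l_closed[OF A x(2) s(1)] by simp
qed

lemma zero_prime: "primeideal {\<zero>} R" by (rule zeroprimeideal)

lemma \<rho>_zero: "\<rho> {\<zero>} = enat (p ^ d) * \<rho> \<mm>" by (rule \<rho>_coht[OF zero_prime coht_zero])

lemma semilinear_comp_mult:
  assumes \<phi>: "semilinear F (\<lambda>r. r) \<phi>" and v: "v \<in> carrier R"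
  shows "semilinear F (\<lambda>r. r) (\<lambda>x. \<phi> (v \<otimes> x))"
proof -
  have "\<phi> (v \<otimes> (F r \<otimes> x)) = r \<otimes> \<phi> (v \<otimes> x)" if "r \<in> carrier R" "x \<in> carrier R" for r x
  proof -
    have "v \<otimes> (F r \<otimes> x) = F r \<otimes> (v \<otimes> x)" using that v by (simp add: m_lcomm)
    then show ?thesis using \<phi> that v by (simp add: semilinear_def)
  qed
  then show ?thesis using \<phi> v by (auto simp: semilinear_def r_distr)
qed

text \<open>A triangular system is enough to replace a pair of dual bases for the pairing
  \<open>(x, y) \<mapsto> \<phi> (x y)\<close>.\<close>

lemma triangular_duals:
  assumes \<phi>: "semilinear F (\<lambda>r. r) \<phi>" and x0: "x0 \<in> carrier R" "\<phi> x0 \<noteq> \<zero>"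
    and "enat k \<le> \<rho> {\<zero>}"
  shows "\<exists>v w. \<forall>j<k. v j \<in> carrier R \<and> w j \<in> carrier R \<and> \<phi> (v j \<otimes> w j) \<noteq> \<zero> \<and>
    (\<forall>i<j. \<phi> (v i \<otimes> w j) = \<zero>)"
  using assms(4)
proof (induction k)
  case (Suc k)
  have k: "enat k < \<rho> {\<zero>}" using Suc.prems by (simp add: Suc_ile_eq)
  then obtain v w where vw: "\<And>j. j < k \<Longrightarrow> v j \<in> carrier R \<and> w j \<in> carrier R \<and> \<phi> (v j \<otimes> w j) \<noteq> \<zero> \<and>
    (\<forall>i<j. \<phi> (v i \<otimes> w j) = \<zero>)" using Suc.IH by (metis less_imp_le)
  let ?D = "\<lambda>j. {x \<in> carrier R. \<forall>i<j. \<phi> (v i \<otimes> x) = \<zero>}"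
  have zs: "{\<zero>} \<in> ssub (\<lambda>r. r) {\<zero>}" by (rule prime_ssub[OF zero_prime])
  have sl: "semilinear F (\<lambda>r. r) (\<lambda>x. \<phi> (v j \<otimes> x))" if "j < k" for j
    using semilinear_comp_mult[OF \<phi>] vw[OF that] by blast
  have D: "?D j \<in> ssub F {\<zero>}" if "j \<le> k" for j using that
  proof (induction j)
    case 0
    then show ?case using carrier_ssub[OF F_hom] by simp
  next
    case (Suc j)
    have "?D (Suc j) = ?D j \<inter> {x \<in> carrier R. \<phi> (v j \<otimes> x) \<in> {\<zero>}}" by (auto simp: less_Suc_eq)
    then show ?case using Int_ssub[OF _ vimage_ssub[OF sl F_hom zs]] Suc by simp
  qed
  \<comment> \<open>Each functional \<open>x \<mapsto> \<phi> (v j \<otimes> x)\<close> has rank at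
    most one, so the common kernel \<open>?D k\<close> has corank at most \<open>k\<close>. This is
    below the rank of \<open>F_*R\<close>, and \<open>?D k\<close> contains some \<open>y\<close>
    other than \<zero>.\<close>
  have "len F {\<zero>} (?D j) (carrier R) \<le> enat j" if "j \<le> k" for j using that
  proof (induction j)
    case 0
    then show ?case using len_zero[OF F_hom one_closed oneideal] by simp
  next
    case (Suc j)
    have "len F {\<zero>} (?D (Suc j)) (carrier R) = len F {\<zero>} (?D (Suc j)) (?D j) + len F {\<zero>} (?D j) (carrier R)"
      using D[of j] Suc.prems by (intro len_add[OF zero_prime F_hom _ carrier_ssub[OF F_hom]]) auto
    also have "len F {\<zero>} (?D (Suc j)) (?D j) \<le> len (\<lambda>r. r) {\<zero>} {\<zero>} (carrier R)"
    proof (rule len_push[OF zero_prime F_hom id_hom sl])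
      show "?D j \<in> lsub F" using D[of j] Suc.prems ssubD(1) by simp
      have D_satur: "?D (Suc j) \<subseteq> satur F {\<zero>} (?D (Suc j))" by (rule satur_upper[OF zero_prime F_hom]) auto
      show "x \<in> satur F {\<zero>} (?D (Suc j))" if "x \<in> ?D j" "\<phi> (v j \<otimes> x) \<in> {\<zero>}" for x
      proof -
        have "x \<in> ?D (Suc j)" using that by (auto simp: less_Suc_eq)
        then show ?thesis using D_satur by (rule rev_subsetD)
      qed
      show "(\<lambda>x. \<phi> (v j \<otimes> x)) ` ?D j \<subseteq> carrier R" using sl[of j] Suc.prems by (auto simp: semilinear_def)
    qed (use Suc.prems ssubD(1)[OF zs] carrier_ssub[OF id_hom] in auto)
    also have "\<dots> \<le> 1" by (rule len_prime_le[OF zero_prime])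
    also have "len F {\<zero>} (?D j) (carrier R) \<le> enat j" using Suc by simp
    finally show ?case by (simp add: one_enat_def add_left_mono add_right_mono)
  qed
  from this[of k] have "?D k \<noteq> {\<zero>}" using k by (auto simp: \<rho>_def)
  moreover have "\<zero> \<in> ?D k" using D[of k] lsubD(3)[OF ssubD(1)] by blast
  ultimately obtain y where y: "y \<in> carrier R" "y \<noteq> \<zero>" "\<And>i. i < k \<Longrightarrow> \<phi> (v i \<otimes> y) = \<zero>" by blast
  \<comment> \<open>Chosen such that \<open>?u y = F(y) x0\<close>, whose value under \<phi> is
    \<open>y \<phi>(x0)\<close>, nonzero in a domain.\<close>
  let ?u = "x0 \<otimes> y [^] (p - 1)"
  have "?u \<otimes> y = F y \<otimes> x0" using x0(1) y(1) by (simp add: F_eq_mult m_ac)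
  then have "\<phi> (?u \<otimes> y) = y \<otimes> \<phi> x0" using \<phi> x0(1) y(1) by (simp add: semilinear_def)
  moreover have "\<phi> x0 \<in> carrier R" using \<phi> x0(1) by (auto simp: semilinear_def)
  ultimately have "\<phi> (?u \<otimes> y) \<noteq> \<zero>" using y x0 integral by metis
  then show ?case using vw y x0(1)
    by (intro exI[of _ "v(k := ?u)"] exI[of _ "w(k := y)"]) (auto simp: less_Suc_eq)
qed simp

lemma common_multiple:
  fixes k :: nat
  assumes "\<And>j. j < k \<Longrightarrow> z j \<in> carrier R \<and> z j \<noteq> \<zero>"
  shows "\<exists>y\<in>carrier R. y \<noteq> \<zero> \<and> (\<forall>j<k. y \<in> PIdl (z j))"
  using assms
proof (induction k)
  case 0
  then show ?case by (intro bexI[of _ \<one>]) auto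
next
  case (Suc k)
  then obtain y where y: "y \<in> carrier R" "y \<noteq> \<zero>" "\<And>j. j < k \<Longrightarrow> y \<in> PIdl (z j)" by auto
  have zk: "z k \<in> carrier R" "z k \<noteq> \<zero>" using Suc.prems by auto
  have "y \<otimes> z k \<in> PIdl (z j)" if "j < Suc k" for j
  proof (cases "j = k")
    case True
    then show ?thesis using y(1) by (auto simp: cgenideal_def)
  next
    case False
    then have "y \<in> PIdl (z j)" "z j \<in> carrier R" using that y(3) Suc.prems[of j] by auto
    then show ?thesis using ideal.I_r_closed[OF cgenideal_ideal] zk by blast
  qed
  moreover have "y \<otimes> z k \<noteq> \<zero>" using y zk integral by metis
  ultimately show ?case using y zk by (intro bexI[of _ "y \<otimes> z k"]) auto
qed

text \<open>Let \<open>N_j\<close> consist of the elements that the first \<open>j\<close>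
  functionals \<open>x \<mapsto> \<phi>(v_i x)\<close> send into \<open>A\<close>. The quotient of
  \<open>N_j\<close> by \<open>N_(j+1)\<close> embeds into \<open>R/A\<close> with image containing
  \<open>(A + zR)/A\<close>. After \<rho> 0 steps the submodule reached still contains
  \<open>A'\<close>, so the total is at most the length of \<open>F_*(R/A')\<close>.\<close>

lemma L_le_F:
  assumes \<phi>: "semilinear F (\<lambda>r. r) \<phi>" and x0: "x0 \<in> carrier R" "\<phi> x0 \<noteq> \<zero>"
  obtains z where "z \<in> carrier R" "z \<noteq> \<zero>"
    "\<And>A A'. ideal A R \<Longrightarrow> ideal A' R \<Longrightarrow> \<phi> ` A' \<subseteq> A \<Longrightarrow>
      \<rho> {\<zero>} * L A \<le> \<rho> \<mm> * L A' + \<rho> {\<zero>} * L (A <+>\<^bsub>R\<^esub> PIdl z)"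
proof -
  obtain r where r: "\<rho> {\<zero>} = enat r" using \<rho>_finite[OF zero_prime] by auto
  obtain v w where vw: "\<And>j. j < r \<Longrightarrow> v j \<in> carrier R \<and> w j \<in> carrier R \<and> \<phi> (v j \<otimes> w j) \<noteq> \<zero> \<and>
    (\<forall>i<j. \<phi> (v i \<otimes> w j) = \<zero>)"
    using triangular_duals[OF \<phi> x0, of r] r by auto
  have sl: "semilinear F (\<lambda>r. r) (\<lambda>x. \<phi> (v j \<otimes> x))" if "j < r" for j
    using semilinear_comp_mult[OF \<phi>] vw[OF that] by blast
  have "\<phi> (v j \<otimes> w j) \<in> carrier R" if "j < r" for j
    using sl[OF that] vw[OF that] by (auto simp: semilinear_def)
  \<comment> \<open>A common multiple of the diagonal values \<open>\<phi>(v_j w_j)\<close>: it is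
    fixed before \<open>A\<close> and \<open>A'\<close> are given.\<close>
  then obtain z where z: "z \<in> carrier R" "z \<noteq> \<zero>" "\<And>j. j < r \<Longrightarrow> z \<in> PIdl (\<phi> (v j \<otimes> w j))"
    using common_multiple[of r "\<lambda>j. \<phi> (v j \<otimes> w j)"] vw by blast
  show ?thesis
  proof (rule that[OF z(1,2)])
    fix A A' assume A: "ideal A R" and A': "ideal A' R" and \<phi>A: "\<phi> ` A' \<subseteq> A"
    let ?N = "\<lambda>j. {x \<in> carrier R. \<forall>i<j. \<phi> (v i \<otimes> x) \<in> A}" and ?B = "A <+>\<^bsub>R\<^esub> PIdl z"
    have As: "A \<in> ssub (\<lambda>r. r) \<mm>" and Al: "A \<in> lsub (\<lambda>r. r)"
      using ideal_mm_ssub[OF A] ideal_lsub[OF A id_hom] by auto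
    have Bi: "ideal ?B R" "A \<subseteq> ?B" using add_cgen_ideal[OF A z(1)] add_cgen_upper(1)[OF A z(1)] by auto
    have N: "?N j \<in> ssub F \<mm>" if "j \<le> r" for j using that
    proof (induction j)
      case 0
      then show ?case using carrier_ssub[OF F_hom] by simp
    next
      case (Suc j)
      have "?N (Suc j) = ?N j \<inter> {x \<in> carrier R. \<phi> (v j \<otimes> x) \<in> A}" by (auto simp: less_Suc_eq)
      then show ?case using Int_ssub[OF _ vimage_ssub[OF sl F_hom As]] Suc by simp
    qed
    have LA: "L A = len (\<lambda>r. r) \<mm> A ?B + L ?B"
      unfolding L_def using Bi(2) ideal_subset[OF Bi(1)]
      by (intro len_add[OF mm_prime id_hom ideal_mm_ssub[OF Bi(1)] carrier_ssub[OF id_hom]])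
    have "enat j * L A \<le> len F \<mm> (?N j) (carrier R) + enat j * L ?B" if "j \<le> r" for j using that
    proof (induction j)
      case (Suc j)
      then have j: "j < r" by simp
      have "len (\<lambda>r. r) \<mm> A ?B \<le> len F \<mm> (?N (Suc j)) (?N j)"
      proof (rule len_pull[OF mm_prime F_hom id_hom sl[OF j] Al])
        show "?N j \<in> ssub F \<mm>" using N j by simp
        let ?\<theta> = "\<lambda>x. \<phi> (v j \<otimes> x)"
        have N0: "?N j \<in> lsub F" using N[of j] j ssubD(1) by simp
        have im: "?\<theta> ` ?N j \<in> lsub (\<lambda>r. r)" by (rule image_lsub[OF sl[OF j] id_hom N0])
        \<comment> \<open>Triangularity enters here: the earlier functionals vanish on
          \<open>w j\<close>, while its value under the \<open>j\<close>-th one divides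
          \<open>z\<close>.\<close>
        have wN: "w j \<in> ?N j" using vw[OF j] lsubD(3)[OF Al] by auto
        have "PIdl (\<phi> (v j \<otimes> w j)) \<subseteq> ?\<theta> ` ?N j"
          using cgenideal_minimal im wN unfolding ideal_iff_lsub by blast
        then have "z \<in> ?\<theta> ` ?N j" using z(3)[OF j] by blast
        then have "PIdl z \<subseteq> ?\<theta> ` ?N j" using cgenideal_minimal im unfolding ideal_iff_lsub by blast
        then have "?B \<subseteq> A <+>\<^bsub>R\<^esub> ?\<theta> ` ?N j" by (intro set_add_mono) auto
        also have "\<dots> \<subseteq> satur (\<lambda>r. r) \<mm> (A <+>\<^bsub>R\<^esub> ?\<theta> ` ?N j)"
          by (rule satur_upper[OF mm_prime id_hom lsubD(1)[OF set_add_lsub[OF id_hom Al im]]])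
        finally show "?B \<subseteq> satur (\<lambda>r. r) \<mm> (A <+>\<^bsub>R\<^esub> ?\<theta> ` ?N j)" .
        show "x \<in> ?N j \<and> \<phi> (v j \<otimes> x) \<in> satur (\<lambda>r. r) \<mm> A" if "x \<in> ?N (Suc j)" for x
          using that satur_upper[OF mm_prime id_hom ideal_subset[OF A]] by (auto simp: less_Suc_eq)
      qed
      then have "L A \<le> len F \<mm> (?N (Suc j)) (?N j) + L ?B" unfolding LA by (rule add_right_mono)
      moreover have "enat j * L A \<le> len F \<mm> (?N j) (carrier R) + enat j * L ?B" using Suc by simp
      ultimately have "L A + enat j * L A \<le> (len F \<mm> (?N (Suc j)) (?N j) + L ?B) +
          (len F \<mm> (?N j) (carrier R) + enat j * L ?B)" by (rule add_mono)
      also have "\<dots> = (len F \<mm> (?N (Suc j)) (?N j) + len F \<mm> (?N j) (carrier R)) + (L ?B + enat j * L ?B)"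
        by (simp add: add_ac)
      also have "len F \<mm> (?N (Suc j)) (?N j) + len F \<mm> (?N j) (carrier R) = len F \<mm> (?N (Suc j)) (carrier R)"
        using N[of j] j by (intro len_add[OF mm_prime F_hom _ carrier_ssub[OF F_hom], symmetric]) auto
      finally show ?case by (simp flip: eSuc_enat add: mult_eSuc)
    qed (simp add: zero_enat_def[symmetric])
    then have "\<rho> {\<zero>} * L A \<le> len F \<mm> (?N r) (carrier R) + \<rho> {\<zero>} * L ?B" by (simp add: r)
    also have "len F \<mm> (?N r) (carrier R) \<le> len F \<mm> A' (carrier R)"
    proof (rule len_mono[OF mm_prime _ order_refl])
      show "A' \<subseteq> ?N r" using \<phi>A ideal.Icarr[OF A'] ideal.I_l_closed[OF A'] vw by blast
    qed
    also have "\<dots> = \<rho> \<mm> * L A'" unfolding L_def by (rule len_F[OF mm_prime A'])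
    finally show "\<rho> {\<zero>} * L A \<le> \<rho> \<mm> * L A' + \<rho> {\<zero>} * L ?B" by (simp add: add_right_mono)
  qed
qed

lemma L_principal_growth:
  assumes z: "z \<in> carrier R" "z \<noteq> \<zero>"
  shows "\<exists>C\<ge>0. \<forall>n. real (the_enat (L (PIdl z <+>\<^bsub>R\<^esub> M n))) \<le> C * (real p ^ d / p) ^ n"
proof (rule L_growth[OF cgenideal_ideal[OF z(1)]])
  fix P assume P: "primeideal P R" "PIdl z \<subseteq> P"
  have "{\<zero>} \<subset> P"
    using P cgenideal_self[OF z(1)] z(2) additive_subgroup.zero_closed[OF ideal.axioms(1)[OF primeideal.axioms(1)[OF P(1)]]]
    by auto
  then show "coht P < enat d" using coht_less[OF zero_prime P(1)] coht_zero by simp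
qed

text \<open>The constant is chosen before the sequence, from the growth constants of two fixed
  principal ideals, \<alpha> and \<open>d\<close>. The containments under \<open>F\<close> and
  \<phi> give the two sides of the recursion, and \<open>M (n + \<alpha>) \<subseteq> I n\<close>
  controls both errors.\<close>

lemma L_sequence:
  assumes \<phi>: "semilinear F (\<lambda>r. r) \<phi>" and x0: "x0 \<in> carrier R" "\<phi> x0 \<noteq> \<zero>"
    and c: "c \<in> carrier R" "c \<noteq> \<zero>"
  shows "\<exists>C>0. \<forall>I. (\<forall>n. ideal (I n) R) \<and> (\<forall>n. \<forall>s\<in>I n. c \<otimes> F s \<in> I (Suc n)) \<and>
      (\<forall>n. \<phi> ` I (Suc n) \<subseteq> I n) \<and> (\<forall>n. M (n + \<alpha>) \<subseteq> I n) \<longrightarrow>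
    (\<lambda>n. real (the_enat (L (I n))) / real (p ^ (n * d))) \<longlonglongrightarrow> lim (\<lambda>n. real (the_enat (L (I n))) / real (p ^ (n * d))) \<and>
    (\<forall>n. \<bar>real (the_enat (L (I n))) / real (p ^ (n * d)) - lim (\<lambda>n. real (the_enat (L (I n))) / real (p ^ (n * d)))\<bar> \<le> C / real (p ^ n))"
proof -
  obtain z1 where z1: "z1 \<in> carrier R" "z1 \<notin> {\<zero>}"
    "\<And>Q A A' c. primeideal Q R \<Longrightarrow> ideal A' R \<Longrightarrow> {\<zero>} \<subseteq> A' \<Longrightarrow> c \<in> carrier R \<Longrightarrow> A \<subseteq> carrier R \<Longrightarrow>
      (\<And>s. s \<in> A \<Longrightarrow> c \<otimes> F s \<in> A') \<Longrightarrow>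
      \<rho> Q * len (\<lambda>r. r) Q A' (carrier R) \<le> \<rho> {\<zero>} * len (\<lambda>r. r) Q A (carrier R) +
        \<rho> Q * len (\<lambda>r. r) Q (A' <+>\<^bsub>R\<^esub> PIdl (c \<otimes> z1)) (carrier R)"
    using len_F_le[OF zero_prime] by blast
  obtain z2 where z2: "z2 \<in> carrier R" "z2 \<noteq> \<zero>"
    "\<And>A A'. ideal A R \<Longrightarrow> ideal A' R \<Longrightarrow> \<phi> ` A' \<subseteq> A \<Longrightarrow>
      \<rho> {\<zero>} * L A \<le> \<rho> \<mm> * L A' + \<rho> {\<zero>} * L (A <+>\<^bsub>R\<^esub> PIdl z2)"
    using L_le_F[OF \<phi> x0] by blast
  have cz: "c \<otimes> z1 \<in> carrier R" "c \<otimes> z1 \<noteq> \<zero>" using c z1(1,2) integral by auto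
  define q where "q = real p ^ d / p"
  have q: "q \<ge> 0" by (simp add: q_def)
  obtain C1 where C1: "C1 \<ge> 0" "\<And>n. real (the_enat (L (PIdl (c \<otimes> z1) <+>\<^bsub>R\<^esub> M n))) \<le> C1 * q ^ n"
    using L_principal_growth[OF cz] unfolding q_def by blast
  obtain C2 where C2: "C2 \<ge> 0" "\<And>n. real (the_enat (L (PIdl z2 <+>\<^bsub>R\<^esub> M n))) \<le> C2 * q ^ n"
    using L_principal_growth[OF z2(1,2)] unfolding q_def by blast
  obtain e where e: "\<rho> \<mm> = enat e" "1 \<le> e"
    using \<rho>_finite[OF mm_prime] \<rho>_ge_1[OF mm_prime] by (auto simp: one_enat_def)
  \<comment> \<open>The first term is the error of the upper estimate, taken at
    \<open>Suc n\<close>; the second is that of the lower estimate at \<open>n\<close>, weighted by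
    \<open>\<rho> 0 / \<rho> \<mm> = p^d\<close>; the 1 makes \<open>C\<close> positive.\<close>
  define C where "C = C1 * q ^ Suc \<alpha> + real p ^ d * (C2 * q ^ \<alpha>) + 1"
  have Cpos: "C > 0" unfolding C_def using C1(1) C2(1) q by (intro add_nonneg_pos add_nonneg_nonneg mult_nonneg_nonneg) auto
  have pd: "1 \<le> real p ^ d" using p_ge_2 by simp
  show ?thesis
  proof (intro exI[of _ "2 * C"] conjI allI impI)
    show "2 * C > 0" using Cpos by simp
  next
    fix I
    assume "(\<forall>n. ideal (I n) R) \<and> (\<forall>n. \<forall>s\<in>I n. c \<otimes> F s \<in> I (Suc n)) \<and>
      (\<forall>n. \<phi> ` I (Suc n) \<subseteq> I n) \<and> (\<forall>n. M (n + \<alpha>) \<subseteq> I n)"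
    then have I: "\<And>n. ideal (I n) R" "\<And>n s. s \<in> I n \<Longrightarrow> c \<otimes> F s \<in> I (Suc n)"
      "\<And>n. \<phi> ` I (Suc n) \<subseteq> I n" "\<And>n. M (n + \<alpha>) \<subseteq> I n" by blast+
    have "\<forall>n. \<exists>k. L (I n) = enat k" using L_finite[OF I(1) I(4)] by simp
    then obtain l where l: "\<And>n. L (I n) = enat (l n)" by metis
    \<comment> \<open>The sequence leaves the bound here: \<open>I n + zR\<close> contains
      \<open>zR + M (n + \<alpha>)\<close>, whose colength depends on \<open>z\<close> and
      \<open>n + \<alpha>\<close> alone.\<close>
    have tail: "real (the_enat (L (I n <+>\<^bsub>R\<^esub> PIdl z))) \<le> C' * q ^ (n + \<alpha>)"
      "L (I n <+>\<^bsub>R\<^esub> PIdl z) = enat (the_enat (L (I n <+>\<^bsub>R\<^esub> PIdl z)))"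
      if z: "z \<in> carrier R" "\<And>n. real (the_enat (L (PIdl z <+>\<^bsub>R\<^esub> M n))) \<le> C' * q ^ n" for z C' n
    proof -
      have i: "ideal (I n <+>\<^bsub>R\<^esub> PIdl z) R" "I n \<subseteq> I n <+>\<^bsub>R\<^esub> PIdl z" "PIdl z \<subseteq> I n <+>\<^bsub>R\<^esub> PIdl z"
        using sum_ideal_upper[OF I(1) cgenideal_ideal[OF z(1)]] by auto
      have M: "M (n + \<alpha>) \<subseteq> I n <+>\<^bsub>R\<^esub> PIdl z" using I(4) i(2) by blast
      show fin: "L (I n <+>\<^bsub>R\<^esub> PIdl z) = enat (the_enat (L (I n <+>\<^bsub>R\<^esub> PIdl z)))"
        using L_finite[OF i(1) M] by auto
      obtain a where a: "L (PIdl z <+>\<^bsub>R\<^esub> M (n + \<alpha>)) = enat a"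
        using L_finite sum_ideal_upper(1,3)[OF cgenideal_ideal[OF z(1)] M_ideal[of "n + \<alpha>"]] by blast
      moreover have "L (I n <+>\<^bsub>R\<^esub> PIdl z) \<le> L (PIdl z <+>\<^bsub>R\<^esub> M (n + \<alpha>))"
        by (intro L_mono sum_ideal_least[OF i(1) i(3) M])
      ultimately have "the_enat (L (I n <+>\<^bsub>R\<^esub> PIdl z)) \<le> the_enat (L (PIdl z <+>\<^bsub>R\<^esub> M (n + \<alpha>)))"
        using fin by (metis enat_ord_simps(1) the_enat.simps)
      then show "real (the_enat (L (I n <+>\<^bsub>R\<^esub> PIdl z))) \<le> C' * q ^ (n + \<alpha>)"
        using z(2)[of "n + \<alpha>"] by linarith
    qed
    have rec: "\<bar>real (l (Suc n)) - real p ^ d * real (l n)\<bar> \<le> C * q ^ n" for n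
    proof -
      have u1: "\<rho> \<mm> * L (I (Suc n)) \<le> \<rho> {\<zero>} * L (I n) + \<rho> \<mm> * L (I (Suc n) <+>\<^bsub>R\<^esub> PIdl (c \<otimes> z1))"
        unfolding L_def
        by (rule z1(3)[OF mm_prime I(1) _ c(1) ideal_subset[OF I(1)] I(2)])
          (use additive_subgroup.zero_closed[OF ideal.axioms(1)[OF I(1)]] in auto)
      define w where "w = the_enat (L (I (Suc n) <+>\<^bsub>R\<^esub> PIdl (c \<otimes> z1)))"
      note w = tail[OF cz(1) C1(2), of "Suc n", folded w_def]
      have "e * l (Suc n) \<le> p ^ d * e * l n + e * w"
        using u1 w(2) \<rho>_zero e(1) l[of n] l[of "Suc n"] by simp
      then have "e * l (Suc n) \<le> e * (p ^ d * l n + w)" by (simp add: algebra_simps)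
      then have "l (Suc n) \<le> p ^ d * l n + w" using e(2) by simp
      then have 1: "real (l (Suc n)) \<le> real p ^ d * real (l n) + real w"
        by (metis of_nat_add of_nat_le_iff of_nat_mult of_nat_power)
      have u2: "\<rho> {\<zero>} * L (I n) \<le> \<rho> \<mm> * L (I (Suc n)) + \<rho> {\<zero>} * L (I n <+>\<^bsub>R\<^esub> PIdl z2)"
        by (rule z2(3)[OF I(1) I(1) I(3)])
      define y where "y = the_enat (L (I n <+>\<^bsub>R\<^esub> PIdl z2))"
      note y = tail[OF z2(1) C2(2), of n, folded y_def]
      have "p ^ d * e * l n \<le> e * l (Suc n) + p ^ d * e * y"
        using u2 y(2) \<rho>_zero e(1) l[of n] l[of "Suc n"] by simp
      then have "e * (p ^ d * l n) \<le> e * (l (Suc n) + p ^ d * y)" by (simp add: algebra_simps)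
      then have "p ^ d * l n \<le> l (Suc n) + p ^ d * y" using e(2) by simp
      then have 2: "real p ^ d * real (l n) \<le> real (l (Suc n)) + real p ^ d * real y"
        by (metis of_nat_add of_nat_le_iff of_nat_mult of_nat_power)
      have w': "real w \<le> (C1 * q ^ Suc \<alpha>) * q ^ n" using w(1) by (simp add: power_add mult_ac)
      have "real p ^ d * real y \<le> real p ^ d * (C2 * q ^ (n + \<alpha>))" using y(1) by (intro mult_left_mono) auto
      then have y': "real p ^ d * real y \<le> (real p ^ d * (C2 * q ^ \<alpha>)) * q ^ n"
        by (simp add: power_add mult_ac)
      have n0: "0 \<le> (C1 * q ^ Suc \<alpha>) * q ^ n" "0 \<le> (real p ^ d * (C2 * q ^ \<alpha>)) * q ^ n" "0 \<le> q ^ n"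
        using C1(1) C2(1) q by auto
      have "C * q ^ n = (C1 * q ^ Suc \<alpha>) * q ^ n + (real p ^ d * (C2 * q ^ \<alpha>)) * q ^ n + q ^ n"
        by (simp add: C_def algebra_simps)
      then show ?thesis using 1 2 w' y' n0 by linarith
    qed
    let ?b = "\<lambda>n. real (l n) / real (p ^ (n * d))"
    have step: "\<bar>?b (Suc n) - ?b n\<bar> \<le> C / real p ^ n" for n
    proof -
      have "?b (Suc n) - ?b n = (real (l (Suc n)) - real p ^ d * real (l n)) / real p ^ (Suc n * d)"
        using p_ge_2 by (simp add: field_simps power_add)
      then have "\<bar>?b (Suc n) - ?b n\<bar> = \<bar>real (l (Suc n)) - real p ^ d * real (l n)\<bar> / real p ^ (Suc n * d)"
        by (simp add: abs_divide)
      also have "\<dots> \<le> C * q ^ n / real p ^ (Suc n * d)"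
        using rec[of n] by (intro divide_right_mono) auto
      also have "\<dots> = C / real p ^ n / real p ^ d"
      proof -
        have "q ^ n = real p ^ (n * d) / real p ^ n"
          by (simp add: q_def power_divide power_mult[symmetric] mult.commute)
        then show ?thesis using p_ge_2 by (simp add: field_simps power_add)
      qed
      also have "\<dots> \<le> C / real p ^ n / 1"
        using pd Cpos p_ge_2 by (intro divide_left_mono) auto
      finally show ?thesis by simp
    qed
    have p2: "2 \<le> real p" using p_ge_2 by simp
    have b: "(\<lambda>n. real (the_enat (L (I n))) / real (p ^ (n * d))) = ?b" by (simp add: l)
    show "(\<lambda>n. real (the_enat (L (I n))) / real (p ^ (n * d))) \<longlonglongrightarrow>
        lim (\<lambda>n. real (the_enat (L (I n))) / real (p ^ (n * d)))"
      unfolding b by (rule geometric_limit(1)[OF step p2]) (use Cpos in simp)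
    show "\<bar>real (the_enat (L (I n))) / real (p ^ (n * d)) -
        lim (\<lambda>n. real (the_enat (L (I n))) / real (p ^ (n * d)))\<bar> \<le> 2 * C / real (p ^ n)" for n
      unfolding b using geometric_limit(2)[OF step p2, of n] Cpos by (simp add: l)
  qed
qed

end

section \<open>Powers of an ideal and the h-function\<close>

text \<open>To exclude a \<open>Gcd\<close> of 1 it must be attained. By division with remainder the
  least positive member divides all others, so a \<open>Gcd\<close> of 1 would make 1 itself a
  member and force \<one> = \<zero>.\<close>

lemma (in domain) ring_char_ge_2:
  assumes "ring_char R > 0" shows "ring_char R \<ge> 2"
proof (rule ccontr)
  let ?S = "{n :: nat. add_pow R n \<one> = \<zero>}"
  assume "\<not> ring_char R \<ge> 2"
  then have gcd1: "Gcd ?S = 1" using assms by (simp add: ring_char_def)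
  have "\<exists>n. n \<in> ?S \<and> n > 0"
  proof (rule ccontr)
    assume none: "\<nexists>n. n \<in> ?S \<and> n > 0"
    have "n = 0" if "n \<in> ?S" for n using none that by (metis gr0I)
    then have "?S \<subseteq> {0}" by (intro subsetI) simp
    then have "Gcd ?S = 0" by (simp only: Gcd_0_iff)
    then show False using gcd1 by simp
  qed
  then obtain m where m: "m \<in> ?S" "m > 0" and least: "\<And>n. n \<in> ?S \<Longrightarrow> n > 0 \<Longrightarrow> m \<le> n"
    using exists_least_iff[of "\<lambda>n. n \<in> ?S \<and> n > 0"] by (metis not_le)
  have "m dvd n" if n: "n \<in> ?S" for n
  proof -
    have "add_pow R (m * (n div m)) \<one> = \<zero>"
      using m(1) add.nat_pow_pow[of \<one> "n div m" m] add.nat_pow_one[of "n div m"] by simp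
    then have "add_pow R (m * (n div m)) \<one> \<oplus> add_pow R (n mod m) \<one> = add_pow R (n mod m) \<one>" by simp
    moreover have "add_pow R (m * (n div m)) \<one> \<oplus> add_pow R (n mod m) \<one> = add_pow R n \<one>"
      using add.nat_pow_mult[of \<one> "m * (n div m)" "n mod m"] by simp
    ultimately have "n mod m \<in> ?S" using n by simp
    then have "n mod m = 0" using least[of "n mod m"] m(2) mod_less_divisor[of m n] by fastforce
    then show ?thesis by auto
  qed
  then have "m dvd Gcd ?S" by (rule Gcd_greatest)
  then have "m = 1" using gcd1 by simp
  then show False using m(1) by simp
qed

context cring
begin

abbreviation ipow :: "'a set \<Rightarrow> nat \<Rightarrow> 'a set" where
  "ipow I n \<equiv> I [^]\<^bsub>ideals_set R\<^esub> n"

lemma one_ideals_set: "\<one>\<^bsub>ideals_set R\<^esub> = carrier R" by (simp add: ideals_set_def)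

lemma ipow_0: "ipow I 0 = carrier R" by (simp add: ideals_set_def)

lemma ipow_Suc: "ipow I (Suc n) = ideal_prod R (ipow I n) I" by (simp add: ideals_set_def)

context
  fixes I assumes I: "ideal I R"
begin

lemma ipow_ideal: "ideal (ipow I n) R"
proof (induction n)
  case 0
  then show ?case unfolding ipow_0 by (rule oneideal)
next
  case (Suc n)
  then show ?case unfolding ipow_Suc using I by (rule ideal_prod_is_ideal)
qed

lemma ipow_antimono: "m \<le> n \<Longrightarrow> ipow I n \<subseteq> ipow I m"
proof (induction rule: dec_induct)
  case (step n)
  have "ipow I (Suc n) \<subseteq> ipow I n" unfolding ipow_Suc using ideal_prod_inter[OF ipow_ideal I] by blast
  then show ?case using step.IH by blast
qed simp

lemma ipow_mult: "x \<in> ipow I a \<Longrightarrow> y \<in> ipow I b \<Longrightarrow> x \<otimes> y \<in> ipow I (a + b)"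
proof (induction b arbitrary: y)
  case 0
  then show ?case using ideal.I_r_closed[OF ipow_ideal] unfolding ipow_0 by simp
next
  case (Suc b)
  have x: "x \<in> carrier R" using ideal.Icarr[OF ipow_ideal Suc.prems(1)] .
  have prod_carr: "u \<in> carrier R" if "u \<in> ideal_prod R (ipow I b) I" for u
    using ideal_prod_in_carrier[OF ipow_ideal I] that by blast
  from Suc.prems(2) have "y \<in> ideal_prod R (ipow I b) I" by (simp only: ipow_Suc)
  then have "x \<otimes> y \<in> ideal_prod R (ipow I (a + b)) I"
  proof (induction y rule: ideal_prod.induct)
    case (prod i j)
    have "x \<otimes> i \<in> ipow I (a + b)" using Suc.IH[OF Suc.prems(1) prod(1)] .
    then have "(x \<otimes> i) \<otimes> j \<in> ideal_prod R (ipow I (a + b)) I" using prod(2) by (rule ideal_prod.prod)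
    then show ?case using x ideal.Icarr[OF ipow_ideal prod(1)] ideal.Icarr[OF I prod(2)] by (simp add: m_assoc)
  next
    case (sum s1 s2)
    then show ?case using x prod_carr by (simp add: r_distr ideal_prod.sum)
  qed
  then show ?case by (simp only: add_Suc_right ipow_Suc)
qed

lemma ipow_1: "x \<in> I \<Longrightarrow> x \<in> ipow I 1"
proof -
  assume x: "x \<in> I"
  have "\<one> \<otimes> x \<in> ideal_prod R (ipow I 0) I" using x by (intro ideal_prod.prod) (simp_all add: one_ideals_set)
  then have "\<one> \<otimes> x \<in> ipow I 1" by (simp only: One_nat_def ipow_Suc)
  then show ?thesis using ideal.Icarr[OF I x] by simp
qed

lemma ipow_power: "x \<in> ipow I n \<Longrightarrow> x [^] (k :: nat) \<in> ipow I (n * k)"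
proof (induction k)
  case 0
  then show ?case by (simp add: one_ideals_set)
next
  case (Suc k)
  then show ?case using ipow_mult[of "x [^] k" "n * k" x n] by (simp add: add.commute)
qed

end

section \<open>Products of generators, written as lists\<close>

definition monomial :: "'a list \<Rightarrow> 'a" where "monomial xs = foldr (\<otimes>) xs \<one>"

lemma monomial_simps: "monomial [] = \<one>" "monomial (x # xs) = x \<otimes> monomial xs"
  by (simp_all add: monomial_def)

lemma monomial_closed [simp]: "set xs \<subseteq> carrier R \<Longrightarrow> monomial xs \<in> carrier R"
  by (induction xs) (auto simp: monomial_simps)

lemma monomial_ipow:
  assumes "ideal I R" "set xs \<subseteq> I" shows "monomial xs \<in> ipow I (length xs)"
  using assms(2)
proof (induction xs)
  case Nil
  then show ?case by (simp add: monomial_simps one_ideals_set)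
next
  case (Cons x xs)
  then show ?case using ipow_mult[OF assms(1) ipow_1[OF assms(1), of x], of "monomial xs" "length xs"]
    by (simp add: monomial_simps)
qed

lemma monomial_extract:
  assumes "set xs \<subseteq> carrier R" "k \<le> count_list xs g" "g \<in> carrier R"
  shows "\<exists>ys. set ys \<subseteq> set xs \<and> length ys + k = length xs \<and> monomial xs = g [^] k \<otimes> monomial ys"
  using assms(1,2)
proof (induction xs arbitrary: k)
  case Nil
  then show ?case by (auto simp: monomial_simps)
next
  case (Cons x xs)
  show ?case
  proof (cases "x = g \<and> k > 0")
    case True
    then obtain k' where k': "k = Suc k'" using gr0_conv_Suc by blast
    then obtain ys where ys: "set ys \<subseteq> set xs" "length ys + k' = length xs" "monomial xs = g [^] k' \<otimes> monomial ys"
      using Cons.IH[of k'] Cons.prems True by auto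
    have "monomial ys \<in> carrier R" using ys(1) Cons.prems by auto
    then have "monomial (x # xs) = g [^] k \<otimes> monomial ys"
      using True ys(3) k' assms(3) by (simp add: monomial_simps m_ac)
    then show ?thesis using ys k' by (intro exI[of _ ys]) auto
  next
    case False
    show ?thesis
    proof (cases "k = 0")
      case True
      then show ?thesis using Cons.prems(1) by (intro exI[of _ "x # xs"]) simp
    next
      case k: False
      then have kc: "k \<le> count_list xs g" using False Cons.prems(2) by auto
      obtain ys where ys: "set ys \<subseteq> set xs" "length ys + k = length xs" "monomial xs = g [^] k \<otimes> monomial ys"
        using Cons.IH[OF _ kc] Cons.prems(1) by auto
      have c: "monomial ys \<in> carrier R" "x \<in> carrier R" using ys(1) Cons.prems by auto
      then have "monomial (x # xs) = g [^] k \<otimes> monomial (x # ys)"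
        using ys(3) assms(3) by (simp add: monomial_simps m_lcomm)
      then show ?thesis using ys by (intro exI[of _ "x # ys"]) auto
    qed
  qed
qed

text \<open>Products are reduced to generators one factor at a time through colon ideals: the
  elements whose product with a fixed element lies in the target ideal form an ideal.\<close>

lemma ipow_monomials:
  assumes G: "G \<subseteq> carrier R"
  shows "ipow (Idl G) n \<subseteq> Idl {monomial xs |xs. length xs = n \<and> set xs \<subseteq> G}"
proof (induction n)
  case 0
  have "\<one> \<in> {monomial xs |xs. length xs = 0 \<and> set xs \<subseteq> G}"
    by (auto simp: monomial_simps)
  then have "\<one> \<in> Idl {monomial xs |xs. length xs = 0 \<and> set xs \<subseteq> G}"
    using genideal_self[of "{monomial xs |xs. length xs = 0 \<and> set xs \<subseteq> G}"] G monomial_closed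
    by (auto simp: monomial_simps)
  moreover have "ideal (Idl {monomial xs |xs. length xs = 0 \<and> set xs \<subseteq> G}) R"
    using G by (intro genideal_ideal) auto
  ultimately show ?case using ideal.one_imp_carrier unfolding ipow_0 by blast
next
  case (Suc n)
  let ?M = "\<lambda>n. {monomial xs |xs. length xs = n \<and> set xs \<subseteq> G}"
  have Mc: "?M n \<subseteq> carrier R" for n
    using G by (auto intro!: monomial_closed)
  have Mi: "ideal (Idl (?M n)) R" for n using Mc by (rule genideal_ideal)
  have Gi: "ideal (Idl G) R" using G by (rule genideal_ideal)
  have gen: "y \<otimes> i \<in> Idl (?M (Suc n))" if y: "y \<in> Idl (?M n)" and i: "i \<in> Idl G" for y i
  proof -
    have ic: "i \<in> carrier R" using ideal.Icarr[OF Gi i] .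
    have mono: "m \<otimes> i \<in> Idl (?M (Suc n))" if m: "m \<in> ?M n" for m
    proof -
      obtain xs where xs: "m = monomial xs" "length xs = n" "set xs \<subseteq> G" using m by blast
      have mc: "m \<in> carrier R" using m Mc by blast
      have "G \<subseteq> {r \<in> carrier R. r \<otimes> m \<in> Idl (?M (Suc n))}"
      proof
        fix g assume g: "g \<in> G"
        have "g \<otimes> m = monomial (g # xs)" using xs by (simp add: monomial_simps)
        then have "g \<otimes> m \<in> ?M (Suc n)" using xs g by (intro CollectI exI[of _ "g # xs"]) auto
        then show "g \<in> {r \<in> carrier R. r \<otimes> m \<in> Idl (?M (Suc n))}"
          using genideal_self[OF Mc, of "Suc n"] g G by blast
      qed
      then have "Idl G \<subseteq> {r \<in> carrier R. r \<otimes> m \<in> Idl (?M (Suc n))}"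
        by (rule genideal_minimal[OF colon_ideal[OF Mi mc]])
      then have "i \<otimes> m \<in> Idl (?M (Suc n))" using i by blast
      then show ?thesis using ic mc by (simp add: m_comm)
    qed
    then have "?M n \<subseteq> {r \<in> carrier R. r \<otimes> i \<in> Idl (?M (Suc n))}" using Mc by blast
    then have "Idl (?M n) \<subseteq> {r \<in> carrier R. r \<otimes> i \<in> Idl (?M (Suc n))}"
      by (rule genideal_minimal[OF colon_ideal[OF Mi ic]])
    then show ?thesis using y by blast
  qed
  show ?case
  proof
    fix x assume "x \<in> ipow (Idl G) (Suc n)"
    then have "x \<in> ideal_prod R (ipow (Idl G) n) (Idl G)" by (simp only: ipow_Suc)
    then show "x \<in> Idl (?M (Suc n))"
    proof (induction x rule: ideal_prod.induct)
      case (prod i j)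
      then show ?case using gen Suc.IH by blast
    next
      case (sum s1 s2)
      then show ?case using additive_subgroup.a_closed[OF ideal.axioms(1)[OF Mi]] by blast
    qed
  qed
qed

end

context F_finite_local_domain
begin

text \<open>Among more than \<open>card G * (p - 1)\<close> factors from \<open>G\<close> some \<open>g\<close> occurs \<open>p\<close> times, and \<open>g\<^sup>p\<close>
  leaves \<open>\<phi>\<close> as a factor \<open>g\<close>.\<close>

lemma \<phi>_ipow:
  assumes \<phi>: "semilinear F (\<lambda>r. r) \<phi>" and G: "G \<subseteq> carrier R" "finite G"
  shows "p * j + card G * (p - 1) < N + p \<Longrightarrow> x \<in> ipow (Idl G) N \<Longrightarrow> \<phi> x \<in> ipow (Idl G) j"
proof (induction j arbitrary: N x)
  case 0
  then show ?case using \<phi> ideal.Icarr[OF ipow_ideal[OF genideal_ideal[OF G(1)]]]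
    unfolding ipow_0 by (auto simp: semilinear_def)
next
  case (Suc j)
  have Gi: "ideal (Idl G) R" using G(1) by (rule genideal_ideal)
  let ?J = "ipow (Idl G) (Suc j)"
  have Ji: "ideal ?J R" by (rule ipow_ideal[OF Gi])
  \<comment> \<open>Testing all multiples \<open>y \<otimes> x\<close> makes \<open>?T\<close> an
    ideal, whereas the preimage of an ideal under \<phi> is in general only an
    \<open>F\<close>-submodule. It then suffices to check monomials.\<close>
  let ?T = "{x \<in> carrier R. \<forall>y\<in>carrier R. \<phi> (y \<otimes> x) \<in> ?J}"
  have \<phi>l: "\<phi> (a \<oplus> b) = \<phi> a \<oplus> \<phi> b" "\<phi> (F a \<otimes> b) = a \<otimes> \<phi> b" if "a \<in> carrier R" "b \<in> carrier R" for a b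
    using \<phi> that by (auto simp: semilinear_def)
  have T: "ideal ?T R"
    unfolding ideal_iff_lsub
  proof (rule lsubI)
    show "\<zero> \<in> ?T" using semilinear_zero[OF \<phi>] additive_subgroup.zero_closed[OF ideal.axioms(1)[OF Ji]] by simp
    show "a \<oplus> b \<in> ?T" if "a \<in> ?T" "b \<in> ?T" for a b
      using that additive_subgroup.a_closed[OF ideal.axioms(1)[OF Ji]] by (auto simp: r_distr \<phi>l)
    show "r \<otimes> a \<in> ?T" if r: "r \<in> carrier R" and a: "a \<in> ?T" for r a
    proof -
      have "\<phi> (y \<otimes> (r \<otimes> a)) \<in> ?J" if "y \<in> carrier R" for y
      proof -
        have "y \<otimes> (r \<otimes> a) = (y \<otimes> r) \<otimes> a" using that r a by (simp add: m_assoc)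
        then show ?thesis using a r that by simp
      qed
      then show ?thesis using r a by simp
    qed
  qed auto
  have "monomial xs \<in> ?T" if xs: "length xs = N" "set xs \<subseteq> G" for xs
  proof -
    have xc: "set xs \<subseteq> carrier R" using xs(2) G(1) by blast
    have "\<exists>g\<in>G. p \<le> count_list xs g"
    proof (rule ccontr)
      assume "\<not> (\<exists>g\<in>G. p \<le> count_list xs g)"
      then have "\<And>g. g \<in> G \<Longrightarrow> count_list xs g \<le> p - 1" by force
      then have "sum (count_list xs) G \<le> card G * (p - 1)" using sum_bounded_above[of G "count_list xs" "p - 1"] by simp
      then have "N \<le> card G * (p - 1)" using sum_count_set[OF xs(2) G(2)] xs(1) by simp
      then show False using Suc.prems(1) by simp
    qed
    then obtain g where g: "g \<in> G" "p \<le> count_list xs g" by blast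
    have gc: "g \<in> carrier R" using g G by blast
    obtain ys where ys: "set ys \<subseteq> set xs" "length ys + p = length xs" "monomial xs = g [^] p \<otimes> monomial ys"
      using monomial_extract[OF xc g(2) gc] by blast
    have yc: "set ys \<subseteq> carrier R" "set ys \<subseteq> Idl G" "monomial ys \<in> carrier R"
      using ys(1) xc xs(2) genideal_self[OF G(1)] by auto
    have "\<phi> (y \<otimes> monomial xs) \<in> ?J" if y: "y \<in> carrier R" for y
    proof -
      have "y \<otimes> monomial xs = F g \<otimes> (y \<otimes> monomial ys)"
        using ys(3) y gc yc(3) by (simp add: F_pow m_lcomm)
      then have eq: "\<phi> (y \<otimes> monomial xs) = g \<otimes> \<phi> (y \<otimes> monomial ys)"
        using \<phi>l(2)[OF gc] y yc(3) by simp
      have "monomial ys \<in> ipow (Idl G) (length ys)" by (rule monomial_ipow[OF Gi yc(2)])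
      then have "y \<otimes> monomial ys \<in> ipow (Idl G) (length ys)"
        using ideal.I_l_closed[OF ipow_ideal[OF Gi] _ y] by blast
      \<comment> \<open>Extraction of \<open>g^p\<close> lowers the exponent \<open>N\<close> by
        \<open>p\<close> and \<open>Suc j\<close> by one, which preserves the inequality.\<close>
      moreover have "p * j + card G * (p - 1) < length ys + p" using Suc.prems(1) ys(2) xs(1) by simp
      ultimately have "\<phi> (y \<otimes> monomial ys) \<in> ipow (Idl G) j" using Suc.IH by blast
      moreover have "g \<in> ipow (Idl G) 1" using ipow_1[OF Gi] g(1) genideal_self[OF G(1)] by blast
      ultimately have "g \<otimes> \<phi> (y \<otimes> monomial ys) \<in> ipow (Idl G) (1 + j)" by (intro ipow_mult[OF Gi])
      then show ?thesis unfolding eq by simp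
    qed
    then show ?thesis using xc by simp
  qed
  then have "{monomial xs |xs. length xs = N \<and> set xs \<subseteq> G} \<subseteq> ?T" by blast
  then have "Idl {monomial xs |xs. length xs = N \<and> set xs \<subseteq> G} \<subseteq> ?T" by (rule genideal_minimal[OF T])
  then have "x \<in> ?T" using ipow_monomials[OF G(1), of N] Suc.prems(2) by blast
  then have "\<phi> (\<one> \<otimes> x) \<in> ?J" by blast
  then show ?case using \<open>x \<in> ?T\<close> by simp
qed

text \<open>By \<open>\<phi>_ipow\<close> the map \<phi> divides exponents by \<open>p\<close> with
  the offset \<open>card G * (p - 1)\<close>. The product of all generators lies in the power
  \<open>card G\<close> of \<open>I\<close> and, as
  \<open>p * card G = card G * (p - 1) + card G\<close>, makes up for this loss.\<close>

lemma twisted_\<phi>: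
  assumes \<phi>: "semilinear F (\<lambda>r. r) \<phi>" and x0: "x0 \<in> carrier R" "\<phi> x0 \<noteq> \<zero>" and I: "ideal I R"
  obtains g where "g \<in> carrier R" "semilinear F (\<lambda>r. r) (\<lambda>x. g \<otimes> \<phi> x)" "g \<otimes> \<phi> x0 \<noteq> \<zero>"
    "\<And>N k x. p * k < N + p \<Longrightarrow> x \<in> ipow I N \<Longrightarrow> g \<otimes> \<phi> x \<in> ipow I k"
proof -
  obtain A where A: "A \<subseteq> carrier R" "finite A" "I = Idl A" using finetely_gen[OF I] by blast
  \<comment> \<open>Removing \<zero> keeps the product of the generators nonzero; for the zero ideal
    \<open>G\<close> is empty and the factor is \<one>.\<close>
  define G where "G = A - {\<zero>}"
  have G: "G \<subseteq> carrier R" "finite G" using A by (auto simp: G_def)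
  have Gi: "ideal (Idl G) R" using G(1) by (rule genideal_ideal)
  have "A \<subseteq> Idl G"
    using genideal_self[OF G(1)] additive_subgroup.zero_closed[OF ideal.axioms(1)[OF Gi]] by (auto simp: G_def)
  then have "I \<subseteq> Idl G" unfolding A(3) by (rule genideal_minimal[OF Gi])
  moreover have "Idl G \<subseteq> I" using I A genideal_self[OF A(1)] by (intro genideal_minimal) (auto simp: G_def)
  ultimately have IG: "I = Idl G" by blast
  obtain gs where gs: "set gs = G" "distinct gs" using finite_distinct_list[OF G(2)] by blast
  have len: "length gs = card G" using distinct_card[OF gs(2)] gs(1) by simp
  let ?g = "monomial gs"
  have gc: "?g \<in> carrier R" using gs G by simp
  have g0: "?g \<noteq> \<zero>"
  proof -
    have "set xs \<subseteq> carrier R - {\<zero>} \<Longrightarrow> monomial xs \<noteq> \<zero>" for xs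
    proof (induction xs)
      case Nil
      then show ?case by (simp add: monomial_simps)
    next
      case (Cons x xs)
      have "monomial xs \<in> carrier R" using Cons.prems by (intro monomial_closed) auto
      then show ?case using Cons integral[of x "monomial xs"] by (auto simp: monomial_simps)
    qed
    then show ?thesis using gs(1) G(1) by (auto simp: G_def)
  qed
  have gI: "?g \<in> ipow I (card G)"
    using monomial_ipow[OF I, of gs] gs(1) genideal_self[OF G(1)] IG len by simp
  have \<phi>c: "\<phi> x \<in> carrier R" if "x \<in> carrier R" for x using \<phi> that by (auto simp: semilinear_def)
  show ?thesis
  proof (rule that[OF gc])
    show "semilinear F (\<lambda>r. r) (\<lambda>x. ?g \<otimes> \<phi> x)"
      using \<phi> gc \<phi>c by (auto simp: semilinear_def r_distr m_lcomm)
    show "?g \<otimes> \<phi> x0 \<noteq> \<zero>" using g0 x0(2) gc \<phi>c[OF x0(1)] integral by blast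
    fix N k x assume Nk: "p * k < N + p" and x: "x \<in> ipow I N"
    have xc: "x \<in> carrier R" using ideal.Icarr[OF ipow_ideal[OF I] x] .
    show "?g \<otimes> \<phi> x \<in> ipow I k"
    \<comment> \<open>Up to \<open>card G\<close> the factor alone suffices; beyond that, \<phi> has
      to supply only the excess \<open>j\<close>.\<close>
    proof (cases "k \<le> card G")
      case True
      have "?g \<otimes> \<phi> x \<in> ipow I (card G)" using ideal.I_r_closed[OF ipow_ideal[OF I] gI \<phi>c[OF xc]] .
      then show ?thesis using ipow_antimono[OF I True] by blast
    next
      case False
      define j where "j = k - card G"
      have k: "k = card G + j" using False by (simp add: j_def)
      have "card G * (p - 1) + card G = p * card G" using p_ge_2 by (cases p) auto
      then have "p * j + card G * (p - 1) < N + p" using Nk unfolding k by (simp add: distrib_left)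
      then have "\<phi> x \<in> ipow I j" using \<phi>_ipow[OF \<phi> G] x unfolding IG by blast
      then show ?thesis using ipow_mult[OF I gI] k by simp
    qed
  qed
qed

text \<open>Scalars act on \<open>R/A\<close> through a surjection, so its submodules are the ideals
  of the quotient ring. These correspond to the ideals above \<open>A\<close>, by images in one
  direction and unions of cosets in the other, and all ideals above \<open>A\<close> are counted by
  \<open>L\<close>.\<close>

lemma module_length_quot:
  assumes A: "ideal A R"
  shows "module_length R (quot_module R A) = L A"
proof -
  let ?Q = "R Quot A"
  interpret Q: ring ?Q using ideal.quotient_is_ring[OF A] .
  have carr: "carrier ?Q = {A +>\<^bsub>R\<^esub> r |r. r \<in> carrier R}"
    by (auto simp: FactRing_def A_RCOSETS_def')
  have Qc: "cring ?Q" by (rule ideal.quotient_is_cring[OF A is_cring])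
  have "submodule N R (quot_module R A) \<longleftrightarrow> ideal N ?Q" for N
  proof
    assume N: "submodule N R (quot_module R A)"
    have "subgroup N (add_monoid ?Q)"
      using submodule.axioms(1)[OF N]
      by (simp add: quot_module_def restrict_scalars_def subgroup_def m_inv_def)
    moreover have "x \<otimes>\<^bsub>?Q\<^esub> a \<in> N" if "a \<in> N" "x \<in> carrier ?Q" for a x
      using submodule.smult_closed[OF N, of _ a] that carr
      by (auto simp: quot_module_def restrict_scalars_def)
    moreover have "a \<otimes>\<^bsub>?Q\<^esub> x \<in> N" if "a \<in> N" "x \<in> carrier ?Q" for a x
    proof -
      have "a \<in> carrier ?Q" using \<open>subgroup N (add_monoid ?Q)\<close> that(1) by (auto simp: subgroup_def)
      then show ?thesis using calculation(2)[OF that] cring.cring_simprules(14)[OF Qc] that(2) by metis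
    qed
    ultimately show "ideal N ?Q" using idealI[OF Q.ring_axioms] by blast
  next
    assume N: "ideal N ?Q"
    have "subgroup N (add_monoid ?Q)" using N by (simp add: ideal_def additive_subgroup_def)
    then have "subgroup N (add_monoid (quot_module R A))"
      by (simp add: quot_module_def restrict_scalars_def subgroup_def m_inv_def)
    moreover have "a \<odot>\<^bsub>quot_module R A\<^esub> x \<in> N" if "a \<in> carrier R" "x \<in> N" for a x
      using ideal.I_l_closed[OF N that(2), of "A +>\<^bsub>R\<^esub> a"] that carr
      by (auto simp: quot_module_def restrict_scalars_def)
    ultimately show "submodule N R (quot_module R A)" by (simp add: submodule_def submodule_axioms_def)
  qed
  then have e1: "module_length R (quot_module R A) = chain_sup {N. ideal N ?Q}"
    by (simp add: module_length_def)
  have "{N \<in> ssub (\<lambda>r. r) \<mm>. A \<subseteq> N \<and> N \<subseteq> carrier R} = {N. ideal N R \<and> A \<subseteq> N}"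
    using ideal_mm_ssub ssubD(1) ideal_iff_lsub ideal_subset by blast
  then have e2: "L A = chain_sup {N. ideal N R \<and> A \<subseteq> N}" by (simp add: L_def len_def)
  note bij = quot_ideal_correspondence[OF A]
  have union: "\<Union> ((+>) A ` N) = N" if "ideal N R" "A \<subseteq> N" for N
    using ideal_incl_iff[OF A that(1)] that(2) by simp
  have image: "(+>) A ` N \<in> {N. ideal N ?Q}" if "ideal N R" "A \<subseteq> N" for N
    using bij that by (auto simp: bij_betw_def)
  have surj: "\<exists>N. ideal N R \<and> A \<subseteq> N \<and> K = (+>) A ` N" if "ideal K ?Q" for K
  proof -
    have "K \<in> (\<lambda>J. (+>) A ` J) ` {J. ideal J R \<and> A \<subseteq> J}" using bij that by (simp add: bij_betw_def)
    then show ?thesis by blast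
  qed
  have "chain_sup {N. ideal N R \<and> A \<subseteq> N} \<le> chain_sup {N. ideal N ?Q}"
  proof (rule chain_sup_map[where g = "\<lambda>N. (+>) A ` N"])
    fix B C assume BC: "B \<in> {N. ideal N R \<and> A \<subseteq> N}" "C \<in> {N. ideal N R \<and> A \<subseteq> N}" "B \<subset> C"
    have "\<Union> ((+>) A ` B) = B" "\<Union> ((+>) A ` C) = C" using union BC(1,2) by blast+
    then have "(+>) A ` B \<noteq> (+>) A ` C" using BC(3) by (metis psubset_eq)
    then show "(+>) A ` B \<subset> (+>) A ` C" using BC(3) by blast
  qed (use image in auto)
  moreover have "chain_sup {N. ideal N ?Q} \<le> chain_sup {N. ideal N R \<and> A \<subseteq> N}"
  proof (rule chain_sup_map[where g = Union])
    fix K assume "K \<in> {N. ideal N ?Q}"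
    then show "\<Union> K \<in> {N. ideal N R \<and> A \<subseteq> N}" using surj[of K] union by auto
  next
    fix B C assume BC: "B \<in> {N. ideal N ?Q}" "C \<in> {N. ideal N ?Q}" "B \<subset> C"
    obtain N where N: "ideal N R" "A \<subseteq> N" "B = (+>) A ` N" using surj BC(1) by blast
    obtain N' where N': "ideal N' R" "A \<subseteq> N'" "C = (+>) A ` N'" using surj BC(2) by blast
    have "\<Union> B = N" "\<Union> C = N'" using union[OF N(1,2)] union[OF N'(1,2)] N(3) N'(3) by simp_all
    then have "\<Union> B \<noteq> \<Union> C" using N(3) N'(3) BC(3) by (metis psubset_eq)
    then show "\<Union> B \<subset> \<Union> C" using BC(3) by blast
  qed
  ultimately show ?thesis using e1 e2 by simp
qed

lemma M_antimono: assumes "a \<le> b" shows "M b \<subseteq> M a"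
  unfolding M_def[of b]
proof (rule frob_power_least[OF M_ideal])
  fix x assume x: "x \<in> \<mm>"
  have xc: "x \<in> carrier R" using prime_mem[OF mm_prime x] .
  have xa: "x [^] (p ^ a) \<in> M a" using frob_power_mem[OF mm_ideal x] by (simp add: M_def)
  obtain k where k: "p ^ (b - a) = Suc k" using p_ge_2 by (cases "p ^ (b - a)") auto
  have "x [^] (p ^ b) = (x [^] (p ^ a)) [^] Suc k"
    using xc assms by (simp add: nat_pow_pow flip: k power_add)
  also have "\<dots> = (x [^] (p ^ a)) [^] k \<otimes> x [^] (p ^ a)" by simp
  also have "\<dots> \<in> M a" by (intro ideal.I_l_closed[OF M_ideal xa] nat_pow_closed xc)
  finally show "x [^] (p ^ b) \<in> M a" .
qed

text \<open>With \<open>x = s p^n\<close>, the first bound lets \<open>F\<close> carry the power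
  \<open>\<lceil>x\<rceil>\<close> of \<open>I\<close> into the power
  \<open>\<lceil>px\<rceil>\<close>. The second is the premise of \<open>twisted_\<phi>\<close> for
  \<open>k = \<lceil>x\<rceil>\<close> and \<open>N = \<lceil>px\<rceil>\<close>. Both hold for
  every real \<open>s\<close>, \<open>nat\<close> sending negative ceilings to 0.\<close>

lemma ceiling_bounds:
  fixes s :: real
  shows "nat \<lceil>s * real (p ^ Suc n)\<rceil> \<le> nat \<lceil>s * real (p ^ n)\<rceil> * p"
    and "p * nat \<lceil>s * real (p ^ n)\<rceil> < nat \<lceil>s * real (p ^ Suc n)\<rceil> + p"
proof -
  let ?x = "s * real (p ^ n)"
  have eq: "s * real (p ^ Suc n) = ?x * real p" by (simp add: mult_ac)
  have p: "real p > 0" using p_ge_2 by simp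
  have "?x * real p \<le> of_int \<lceil>?x\<rceil> * real p" using p by (intro mult_right_mono) auto
  then have "\<lceil>?x * real p\<rceil> \<le> \<lceil>?x\<rceil> * int p" by (simp add: ceiling_le_iff)
  also have "\<dots> \<le> int (nat \<lceil>?x\<rceil>) * int p" by (intro mult_right_mono) auto
  finally show "nat \<lceil>s * real (p ^ Suc n)\<rceil> \<le> nat \<lceil>?x\<rceil> * p"
    unfolding eq by (simp add: nat_le_iff)
  show "p * nat \<lceil>?x\<rceil> < nat \<lceil>s * real (p ^ Suc n)\<rceil> + p"
  proof (cases "\<lceil>?x\<rceil> \<le> 0")
    case True
    then show ?thesis using p_ge_2 by simp
  next
    case False
    have "of_int \<lceil>?x\<rceil> - 1 < ?x" by linarith
    then have "(of_int \<lceil>?x\<rceil> - 1) * real p < ?x * real p" using p by (intro mult_strict_right_mono) auto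
    then have "real_of_int ((\<lceil>?x\<rceil> - 1) * int p) < ?x * real p" by simp
    then have "(\<lceil>?x\<rceil> - 1) * int p < \<lceil>?x * real p\<rceil>" by (simp only: less_ceiling_iff)
    moreover have "(\<lceil>?x\<rceil> - 1) * int p = \<lceil>?x\<rceil> * int p - int p" by (simp add: left_diff_distrib)
    moreover have "\<lceil>?x * real p\<rceil> \<le> int (nat \<lceil>?x * real p\<rceil>)" by linarith
    ultimately have "\<lceil>?x\<rceil> * int p < int (nat \<lceil>?x * real p\<rceil>) + int p" by linarith
    moreover have "\<lceil>?x\<rceil> = int (nat \<lceil>?x\<rceil>)" using False by simp
    ultimately have "int (p * nat \<lceil>?x\<rceil>) < int (nat \<lceil>?x * real p\<rceil> + p)" by (simp add: mult.commute)
    then show ?thesis unfolding eq by (simp only: of_nat_less_iff)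
  qed
qed

text \<open>\<open>C\<close> is quantified before \<open>J\<close>, \<open>t\<close> and
  \<open>s\<close>, which is the independence of the family; the factor \<open>g\<close> comes from
  \<phi>, \<open>x0\<close> and \<open>I\<close>. The containments under \<open>F\<close> and the
  twisted \<phi> hold for each real \<open>s\<close>, and \<alpha> enters through
  \<open>M (n + \<alpha>)\<close>.\<close>

lemma uniform_estimate:
  assumes c: "c \<in> carrier R" "c \<noteq> \<zero>" and \<phi>: "semilinear F (\<lambda>r. r) \<phi>"
    and x0: "x0 \<in> carrier R" "\<phi> x0 \<noteq> \<zero>" and I: "ideal I R"
  shows "\<exists>C>0. \<forall>J t. frob_compatible R p c \<phi> J \<and> frob_contained R \<mm> p I J t (int \<alpha>) \<longrightarrow>
    (\<forall>s\<le>t. (\<forall>n. I_length R p I J n s \<noteq> \<infinity>) \<and>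
      (\<lambda>n. h_seq R p d I J n s) \<longlonglongrightarrow> h_fun R p d I J s \<and>
      (\<forall>n. \<bar>h_seq R p d I J n s - h_fun R p d I J s\<bar> \<le> C / real (p ^ n)))"
proof -
  obtain g where g: "g \<in> carrier R" "semilinear F (\<lambda>r. r) (\<lambda>x. g \<otimes> \<phi> x)" "g \<otimes> \<phi> x0 \<noteq> \<zero>"
    "\<And>N k x. p * k < N + p \<Longrightarrow> x \<in> ipow I N \<Longrightarrow> g \<otimes> \<phi> x \<in> ipow I k"
    using twisted_\<phi>[OF \<phi> x0 I] by blast
  obtain C where C: "C > 0" and main: "\<And>K. (\<forall>n. ideal (K n) R) \<and> (\<forall>n. \<forall>s\<in>K n. c \<otimes> F s \<in> K (Suc n)) \<and>
      (\<forall>n. (\<lambda>x. g \<otimes> \<phi> x) ` K (Suc n) \<subseteq> K n) \<and> (\<forall>n. M (n + \<alpha>) \<subseteq> K n) \<Longrightarrow>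
    (\<lambda>n. real (the_enat (L (K n))) / real (p ^ (n * d))) \<longlonglongrightarrow> lim (\<lambda>n. real (the_enat (L (K n))) / real (p ^ (n * d))) \<and>
    (\<forall>n. \<bar>real (the_enat (L (K n))) / real (p ^ (n * d)) - lim (\<lambda>n. real (the_enat (L (K n))) / real (p ^ (n * d)))\<bar> \<le> C / real (p ^ n))"
    using L_sequence[OF g(2) x0(1) g(3) c, of \<alpha>] by blast
  show ?thesis
  proof (intro exI[of _ C] conjI allI impI)
    show "C > 0" by (rule C)
  next
    fix J t s
    assume "frob_compatible R p c \<phi> J \<and> frob_contained R \<mm> p I J t (int \<alpha>)" and st: "s \<le> t"
    then have J: "\<And>n. ideal (J n) R" "\<And>n. c <#\<^bsub>R\<^esub> frob_power R (J n) p \<subseteq> J (Suc n)"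
      "\<And>n. \<phi> ` J (Suc n) \<subseteq> J n" and Mt: "\<And>n. M (n + \<alpha>) \<subseteq> I_seq R p I J n t"
      by (auto simp: frob_compatible_def frob_contained_def M_def nat_int_add)
    let ?K = "\<lambda>n. I_seq R p I J n s" and ?k = "\<lambda>s n. nat \<lceil>s * real (p ^ n)\<rceil>"
    have K: "I_seq R p I J n s = ipow I (?k s n) <+>\<^bsub>R\<^esub> J n" for n s by (simp add: I_seq_def ideal_pow_def)
    have Ki: "ideal (?K n) R" for n unfolding K by (rule add_ideals[OF ipow_ideal[OF I] J(1)])
    have KF: "c \<otimes> F x \<in> ?K (Suc n)" if x: "x \<in> ?K n" for n x
    proof -
      obtain a b where ab: "a \<in> ipow I (?k s n)" "b \<in> J n" "x = a \<oplus> b"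
        using x unfolding K by (auto simp: set_add_mem)
      have abc: "a \<in> carrier R" "b \<in> carrier R"
        using ideal.Icarr[OF ipow_ideal[OF I] ab(1)] ideal.Icarr[OF J(1) ab(2)] by auto
      have "F a \<in> ipow I (?k s n * p)" unfolding F_pow by (rule ipow_power[OF I ab(1)])
      then have "F a \<in> ipow I (?k s (Suc n))" using ipow_antimono[OF I ceiling_bounds(1)] by blast
      then have "c \<otimes> F a \<in> ipow I (?k s (Suc n))" using ideal.I_l_closed[OF ipow_ideal[OF I] _ c(1)] by blast
      moreover have "F b \<in> frob_power R (J n) p" unfolding F_pow by (rule frob_power_mem[OF J(1) ab(2)])
      then have "c \<otimes> F b \<in> J (Suc n)" using J(2)[of n] by (auto simp: l_coset_def)
      moreover have "c \<otimes> F x = c \<otimes> F a \<oplus> c \<otimes> F b" using ab(3) abc c(1) by (simp add: F_add r_distr)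
      ultimately show ?thesis unfolding K set_add_mem by blast
    qed
    have K\<phi>: "g \<otimes> \<phi> x \<in> ?K n" if x: "x \<in> ?K (Suc n)" for n x
    proof -
      obtain a b where ab: "a \<in> ipow I (?k s (Suc n))" "b \<in> J (Suc n)" "x = a \<oplus> b"
        using x unfolding K by (auto simp: set_add_mem)
      have abc: "a \<in> carrier R" "b \<in> carrier R"
        using ideal.Icarr[OF ipow_ideal[OF I] ab(1)] ideal.Icarr[OF J(1) ab(2)] by auto
      have "g \<otimes> \<phi> a \<in> ipow I (?k s n)" by (rule g(4)[OF ceiling_bounds(2) ab(1)])
      moreover have "g \<otimes> \<phi> b \<in> J n" using J(3)[of n] ab(2) ideal.I_l_closed[OF J(1) _ g(1)] by blast
      moreover have "g \<otimes> \<phi> x = g \<otimes> \<phi> a \<oplus> g \<otimes> \<phi> b" using g(2) abc ab(3) unfolding semilinear_def by blast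
      ultimately show ?thesis unfolding K set_add_mem by blast
    qed
    \<comment> \<open>A smaller \<open>s\<close> means a smaller exponent and a larger ideal, so the
      \<alpha> that works for \<open>t\<close> works for all \<open>s \<le> t\<close>.\<close>
    have KM: "M (n + \<alpha>) \<subseteq> ?K n" for n
    proof -
      have "?k s n \<le> ?k t n" using st by (intro nat_mono ceiling_mono mult_right_mono) auto
      then have "I_seq R p I J n t \<subseteq> ?K n" unfolding K by (intro set_add_mono ipow_antimono[OF I]) auto
      then show ?thesis using Mt[of n] by blast
    qed
    have len: "I_length R p I J n s = L (?K n)" for n
      unfolding I_length_def by (rule module_length_quot[OF Ki])
    show "I_length R p I J n s \<noteq> \<infinity>" for n unfolding len by (rule L_finite[OF Ki KM])
    have h: "h_seq R p d I J n s = real (the_enat (L (?K n))) / real (p ^ (n * d))" for n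
      by (simp add: h_seq_def len)
    have *: "(\<lambda>n. h_seq R p d I J n s) \<longlonglongrightarrow> lim (\<lambda>n. h_seq R p d I J n s) \<and>
      (\<forall>n. \<bar>h_seq R p d I J n s - lim (\<lambda>n. h_seq R p d I J n s)\<bar> \<le> C / real (p ^ n))"
      unfolding h by (rule main) (use Ki KF K\<phi> KM in blast)
    show "(\<lambda>n. h_seq R p d I J n s) \<longlonglongrightarrow> h_fun R p d I J s" using * by (simp add: h_fun_def)
    show "\<bar>h_seq R p d I J n s - h_fun R p d I J s\<bar> \<le> C / real (p ^ n)" for n using * by (simp add: h_fun_def)
  qed
qed

text \<open>The ideals \<open>M n\<close> decrease, so \<alpha> may be enlarged, in particular from
  a negative integer to 0.\<close>

lemma frob_contained_nat:
  assumes "frob_contained R \<mm> p I J t \<alpha>"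
  shows "frob_contained R \<mm> p I J t (int (nat \<alpha>))"
  unfolding frob_contained_def
proof
  fix n
  have "nat (int n + \<alpha>) \<le> nat (int n + int (nat \<alpha>))" by (intro nat_mono add_left_mono) simp
  then have "M (nat (int n + int (nat \<alpha>))) \<subseteq> M (nat (int n + \<alpha>))" by (rule M_antimono)
  then show "frob_power R \<mm> (p ^ nat (int n + int (nat \<alpha>))) \<subseteq> I_seq R p I J n t"
    using assms unfolding frob_contained_def M_def by blast
qed

end

lemma uniform_limit_of_rate:
  fixes f :: "nat \<Rightarrow> real \<Rightarrow> real"
  assumes "\<And>n s. s \<in> B \<Longrightarrow> \<bar>f n s - h s\<bar> \<le> C / real (p ^ n)" and "p \<ge> 2"
  shows "uniform_limit B f h sequentially"
proof (rule uniform_limitI)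
  fix e :: real assume e: "e > 0"
  have "(\<lambda>n. C * (1 / real p) ^ n) \<longlonglongrightarrow> C * 0"
    using assms(2) by (intro tendsto_mult tendsto_const LIMSEQ_realpow_zero) auto
  then have "(\<lambda>n. C / real (p ^ n)) \<longlonglongrightarrow> 0" by (simp add: power_divide)
  then have "\<forall>\<^sub>F n in sequentially. C / real (p ^ n) < e" using e by (rule order_tendstoD)
  then show "\<forall>\<^sub>F n in sequentially. \<forall>s\<in>B. dist (f n s) (h s) < e"
    by eventually_elim (use assms(1) in \<open>fastforce simp: dist_real_def intro: le_less_trans\<close>)
qed

theorem theorem3p7:
  fixes R (structure) and \<mm> :: "'a set" and p d :: nat
    and c :: 'a and \<phi> :: "'a \<Rightarrow> 'a" and I :: "'a set"
  assumes "noetherian_domain R" and "local_ring R \<mm>"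
    and "ring_char R = p" and "p > 0"
    and "F_finite R p"
    and "krull_dim R = enat d"
    and "c \<in> carrier R" and "c \<noteq> \<zero>"
    and "\<phi> \<in> module_Hom R (frob_push R p) (self_module R)"
    and "\<exists>x\<in>carrier R. \<phi> x \<noteq> \<zero>"
    and "ideal I R"
  shows
    "(\<forall>\<alpha> :: nat. \<exists>C :: real. C > 0 \<and>
        (\<forall>J t. frob_compatible R p c \<phi> J \<and> frob_bounded R \<mm> p I J
              \<and> frob_contained R \<mm> p I J t (int \<alpha>) \<longrightarrow>
           (\<forall>s\<le>t.
              (\<forall>n. I_length R p I J n s \<noteq> \<infinity>) \<and>
              (\<lambda>n. h_seq R p d I J n s) \<longlonglongrightarrow> h_fun R p d I J s \<and>
              (\<forall>n. \<bar>h_seq R p d I J n s - h_fun R p d I J s\<bar> \<le> C / real (p ^ n)))))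
     \<and> (\<forall>J. frob_compatible R p c \<phi> J \<and> frob_bounded R \<mm> p I J \<longrightarrow>
          (\<forall>t :: real. \<exists>C :: real. C > 0 \<and>
             (\<forall>s\<in>{0..t}. \<forall>n.
                \<bar>h_seq R p d I J n s - h_fun R p d I J s\<bar> \<le> C / real (p ^ n))))
     \<and> (\<forall>J. frob_compatible R p c \<phi> J \<and> frob_bounded R \<mm> p I J \<longrightarrow>
          (\<forall>B :: real set. bounded B \<longrightarrow>
             uniform_limit B (h_seq R p d I J) (h_fun R p d I J) sequentially))"
proof -
  interpret noetherian_domain R by fact
  have "2 \<le> p" using assms(3,4) ring_char_ge_2 by blast
  interpret F_finite_local_domain R p \<mm> d
    by unfold_locales (fact assms \<open>2 \<le> p\<close>)+
  have \<phi>: "semilinear F (\<lambda>r. r) \<phi>"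
    using assms(9)
    by (auto simp: semilinear_def module_Hom_def frob_push_def self_module_def restrict_scalars_def hom_def)
  obtain x0 where x0: "x0 \<in> carrier R" "\<phi> x0 \<noteq> \<zero>" using assms(10) by blast
  note est = uniform_estimate[OF assms(7,8) \<phi> x0 assms(11)]
  \<comment> \<open>\<open>frob_bounded\<close> supplies an \<alpha> for the given \<open>t\<close>,
    so this constant may depend on the family. The estimate on \<open>{0..t}\<close> and uniform
    convergence on sets bounded above by \<open>t\<close> both follow from it.\<close>
  have rate: "\<exists>C>0. \<forall>s\<le>t. \<forall>n. \<bar>h_seq R p d I J n s - h_fun R p d I J s\<bar> \<le> C / real (p ^ n)"
    if J: "frob_compatible R p c \<phi> J" "frob_bounded R \<mm> p I J" for J t
  proof -
    obtain \<alpha> where "frob_contained R \<mm> p I J t \<alpha>" using J(2) by (auto simp: frob_bounded_def)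
    then have "frob_contained R \<mm> p I J t (int (nat \<alpha>))" by (rule frob_contained_nat)
    then show ?thesis using est[of "nat \<alpha>"] J(1) by blast
  qed
  show ?thesis
  proof (intro conjI allI impI)
    fix \<alpha> :: nat
    show "\<exists>C>0. \<forall>J t. frob_compatible R p c \<phi> J \<and> frob_bounded R \<mm> p I J
              \<and> frob_contained R \<mm> p I J t (int \<alpha>) \<longrightarrow>
           (\<forall>s\<le>t.
              (\<forall>n. I_length R p I J n s \<noteq> \<infinity>) \<and>
              (\<lambda>n. h_seq R p d I J n s) \<longlonglongrightarrow> h_fun R p d I J s \<and>
              (\<forall>n. \<bar>h_seq R p d I J n s - h_fun R p d I J s\<bar> \<le> C / real (p ^ n)))"
      using est[of \<alpha>] by blast
  next
    fix J and t :: real assume "frob_compatible R p c \<phi> J \<and> frob_bounded R \<mm> p I J"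
    then show "\<exists>C>0. \<forall>s\<in>{0..t}. \<forall>n. \<bar>h_seq R p d I J n s - h_fun R p d I J s\<bar> \<le> C / real (p ^ n)"
      using rate[of J t] by auto
  next
    fix J and B :: "real set"
    assume J: "frob_compatible R p c \<phi> J \<and> frob_bounded R \<mm> p I J" and "bounded B"
    then obtain t where t: "\<And>s. s \<in> B \<Longrightarrow> s \<le> t" by (metis abs_le_D1 bounded_real)
    obtain C where "\<forall>s\<le>t. \<forall>n. \<bar>h_seq R p d I J n s - h_fun R p d I J s\<bar> \<le> C / real (p ^ n)"
      using rate[of J t] J by blast
    then show "uniform_limit B (h_seq R p d I J) (h_fun R p d I J) sequentially"
      using t p_ge_2 by (intro uniform_limit_of_rate) auto
  qed
qed

end
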